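(* Let $I=]a,b[$ be a bounded open interval, $n\ge 1$, $\lambda>0$, and $\boldsymbol f\in L^2(I,\mathbb R^n)$. Let $\boldsymbol u$ be the unique minimizer over $L^2(I,\mathbb R^n)$ of \[E(\boldsymbol w)= TV(\boldsymbol w)+\tfrac{1}{2\lambda}\int_I|\boldsymbol w-\boldsymbol f|^2 .\] Suppose that $\boldsymbol f\in BV(U,\mathbb R^n)$ for an open interval $U\subset I$. Then $|\boldsymbol u'|\le|\boldsymbol f'|$ in the sense of Borel measures on $U$, i.e. \[|\boldsymbol u'|(A)\le|\boldsymbol f'|(A)\quad\text{for every Borel set } A\subset U.\]
   Context: For an open interval $\Omega$, the (vectorial) total variation $TV_\Omega\colon L^2(\Omega,\mathbb R^n)\to[0,+\infty]$ is $TV_\Omega(\boldsymbol u)=\sup\{\int_\Omega \boldsymbol u\cdot\boldsymbol\varphi'\colon \boldsymbol\varphi\in C^1_c(\Omega,\mathbb R^n),\ |\boldsymbol\varphi|\le1\}$, where $|\cdot|$ is the Euclidean norm; it equals $|\boldsymbol u'|(\Omega)$ if $\boldsymbol u\in BV(\Omega,\mathbb R^n)$ and $+\infty$ otherwise, and $TV=TV_I$. Here $\boldsymbol u'$ denotes the distributional derivative (an $\mathbb R^n$-valued measure for $BV$ functions) and $|\boldsymbol u'|$ its total variation measure with respect to the Euclidean norm. $E$ is strictly convex and has a unique minimizer, which lies in $BV(I,\mathbb R^n)$. *)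

theory Defs
  imports "HOL-Analysis.Analysis"
begin

definition C1c :: "real set \<Rightarrow> (real \<Rightarrow> real^'n) \<Rightarrow> bool" where
  "C1c \<Omega> \<phi> \<longleftrightarrow> \<phi> C1_differentiable_on UNIV \<and>
     (\<exists>K. compact K \<and> K \<subseteq> \<Omega> \<and> (\<forall>x. x \<notin> K \<longrightarrow> \<phi> x = 0))"

definition L2 :: "real set \<Rightarrow> (real \<Rightarrow> real^'n) \<Rightarrow> bool" where
  "L2 \<Omega> w \<longleftrightarrow> set_borel_measurable lborel \<Omega> w \<and>
     set_integrable lborel \<Omega> (\<lambda>x. (norm (w x))\<^sup>2)"

definition TV :: "real set \<Rightarrow> (real \<Rightarrow> real^'n) \<Rightarrow> ereal" where
  "TV \<Omega> u = (SUP \<phi> \<in> {\<phi>. C1c \<Omega> \<phi> \<and> (\<forall>x. norm (\<phi> x) \<le> 1)}.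
      ereal (LINT x:\<Omega>|lborel. u x \<bullet> vector_derivative \<phi> (at x)))"

definition energy :: "real set \<Rightarrow> real \<Rightarrow> (real \<Rightarrow> real^'n) \<Rightarrow> (real \<Rightarrow> real^'n) \<Rightarrow> ereal" where
  "energy I lam f w = TV I w + ereal (1 / (2 * lam) * (LINT x:I|lborel. (norm (w x - f x))\<^sup>2))"

text \<open>\<mu> is the distributional derivative u' of u on \<Omega>, an R^n-valued Borel measure on \<Omega>,
  given as \<mu>(A) = int_A \<sigma> d\<nu> for a finite Borel measure \<nu> on \<Omega> and a \<nu>-integrable density \<sigma>
  (every finite R^n-valued Borel measure has such a form), with
  int_\<Omega> u . phi' = - int phi . d\<mu> for all test functions phi.\<close>
definition is_deriv_measure :: "real set \<Rightarrow> (real \<Rightarrow> real^'n) \<Rightarrow> (real set \<Rightarrow> real^'n) \<Rightarrow> bool" where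
  "is_deriv_measure \<Omega> u \<mu> \<longleftrightarrow>
     (\<exists>(\<nu>::real measure) (\<sigma>::real \<Rightarrow> real^'n).
        finite_measure \<nu> \<and> space \<nu> = \<Omega> \<and> sets \<nu> = sets (restrict_space borel \<Omega>) \<and>
        integrable \<nu> \<sigma> \<and>
        (\<forall>A \<in> sets \<nu>. \<mu> A = (LINT x:A|\<nu>. \<sigma> x)) \<and>
        (\<forall>\<phi>. C1c \<Omega> \<phi> \<longrightarrow>
           (LINT x:\<Omega>|lborel. u x \<bullet> vector_derivative \<phi> (at x)) = - (\<integral>x. \<phi> x \<bullet> \<sigma> x \<partial>\<nu>)))"

definition var_measure :: "(real set \<Rightarrow> real^'n) \<Rightarrow> real set \<Rightarrow> ennreal" where
  "var_measure \<mu> A = (SUP B \<in> {B :: nat \<Rightarrow> real set. disjoint_family B \<and> range B \<subseteq> sets borel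
        \<and> (\<Union>k. B k) = A}. (\<Sum>k. ennreal (norm (\<mu> (B k)))))"

end

theory Submission
  imports Defs
begin

text \<open>
  Let \<open>z\<close> be the primitive of \<open>(u - f) / \<lambda>\<close> vanishing at \<open>a\<close>. Comparing \<open>u\<close> with \<open>u\<close> plus a step
  function gives \<open>|z| \<le> 1\<close> and \<open>z(b) = 0\<close>; comparing it with the function obtained by collapsing \<open>u\<close> on an
  interval gives \<open>|u'| = z \<cdot> u'\<close>, so \<open>u'\<close> lives on the contact set \<open>K = {|z| = 1}\<close>.
  On \<open>U\<close> we have \<open>\<lambda> z'' = u' - f'\<close> as measures. Since \<open>|z|\<^sup>2\<close> is maximal on \<open>K\<close>, the measure
  \<open>z \<cdot> z''\<close> is nonpositive on \<open>K\<close>. Hence \<open>|u'| = z \<cdot> u' \<le> z \<cdot> f' \<le> |f'|\<close> on \<open>K\<close>, and so everywhere on \<open>U\<close>.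
\<close>

section \<open>Integrals against finite Borel measures on the line\<close>

text \<open>Formally \<open>(|z|^2)'' = 2 |z'|^2 + 2 z . z''\<close> cannot be positive where
  \<open>|z|^2\<close> is maximal, which explains the sign of \<open>z . z''\<close>. But
  \<open>z''\<close> is only a measure, possibly with atoms and a singular part, and the contact set
  is merely closed, so no pointwise second-derivative test applies; a weak form with weights that
  concentrate on the contact set replaces it. Collapsing an interval yields information for one
  fixed vector \<open>e\<close> at a time. The pointwise identity for the density of
  \<open>u'\<close> needs the passage from intervals to Borel sets and a countable dense family of
  vectors. The derivatives of \<open>u\<close> and \<open>f\<close> come as densities over unrelated
  measures, so they can be compared only through integrals over sets. Such comparisons start on
  half-open intervals, whose indicators are limits of C1 cutoffs at every point, atoms included.
  Total variation is accessible only through test functions: that of a competitor is bounded by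
  altering the test function that is applied to \<open>u\<close>.\<close>

lemma borel_measurable_halfline_integral:
  fixes \<sigma> :: "real \<Rightarrow> 'a::euclidean_space"
  assumes "finite_measure N" and N: "sets N = sets borel" and "integrable N \<sigma>"
  shows "(\<lambda>x. \<integral>y. indicator {..x} y *\<^sub>R \<sigma> y \<partial>N) \<in> borel_measurable borel"
proof -
  interpret finite_measure N by fact
  note [measurable_cong] = N
  have [measurable]: "\<sigma> \<in> borel_measurable N" using assms by auto
  have "(\<lambda>(x::real, y::real). indicator {..x} y *\<^sub>R \<sigma> y) = (\<lambda>p. if snd p \<le> fst p then \<sigma> (snd p) else 0)"
    by (auto simp: fun_eq_iff indicator_def)
  also have "\<dots> \<in> borel_measurable (borel \<Otimes>\<^sub>M N)"
    by measurable
  finally show ?thesis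
    by (rule borel_measurable_lebesgue_integral)
qed

lemma norm_restricted_integral_le:
  fixes \<sigma> :: "'b \<Rightarrow> 'a::euclidean_space"
  assumes "integrable N \<sigma>"
  shows "norm (\<integral>y. indicator A y *\<^sub>R \<sigma> y \<partial>N) \<le> (\<integral>y. norm (\<sigma> y) \<partial>N)"
proof -
  have "norm (\<integral>y. indicator A y *\<^sub>R \<sigma> y \<partial>N) \<le> (\<integral>y. norm (indicator A y *\<^sub>R \<sigma> y) \<partial>N)"
    by (rule integral_norm_bound)
  also have "\<dots> \<le> (\<integral>y. norm (\<sigma> y) \<partial>N)"
    using assms by (intro integral_mono') (auto simp: indicator_def)
  finally show ?thesis .
qed

text \<open>Integration by parts for a distribution function: exchanging the integrals turns the
  left half-line in \<open>y\<close> into a right half-line in \<open>x\<close>. If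
  \<open>\<psi>\<close> is the derivative of a compactly supported \<open>\<Phi>\<close>, the inner
  integral is \<open>- \<Phi> y\<close>, so the distribution function has weak derivative
  \<open>\<sigma>\<close> times \<open>N\<close>.\<close>

lemma Fubini_halfline:
  fixes \<sigma> \<psi> :: "real \<Rightarrow> 'a::euclidean_space"
  assumes "finite_measure N" and N: "sets N = sets borel"
    and s: "integrable N \<sigma>" and p: "integrable lborel \<psi>"
  shows "(\<integral>x. (\<integral>y. indicator {..x} y *\<^sub>R \<sigma> y \<partial>N) \<bullet> \<psi> x \<partial>lborel)
       = (\<integral>y. \<sigma> y \<bullet> (\<integral>x. indicator {y..} x *\<^sub>R \<psi> x \<partial>lborel) \<partial>N)"
proof -
  interpret N: finite_measure N by fact
  interpret pair_sigma_finite lborel N ..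
  note [measurable_cong] = N
  have [measurable]: "\<sigma> \<in> borel_measurable N" "\<psi> \<in> borel_measurable lborel" using s p by auto
  define F where "F = (\<lambda>x y. if y \<le> x then \<sigma> y \<bullet> \<psi> x else (0::real))"
  have F_alt: "case_prod F = (\<lambda>p. if snd p \<le> fst p then \<sigma> (snd p) \<bullet> \<psi> (fst p) else 0)"
    by (auto simp: F_def fun_eq_iff)
  have [measurable]: "case_prod F \<in> borel_measurable (lborel \<Otimes>\<^sub>M N)"
    unfolding F_alt by measurable
  have bd: "norm (F x y) \<le> norm (\<psi> x) * norm (\<sigma> y)" for x y
    using Cauchy_Schwarz_ineq2[of "\<sigma> y" "\<psi> x"] by (auto simp: F_def mult.commute)
  have intF: "integrable (lborel \<Otimes>\<^sub>M N) (case_prod F)"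
  proof (rule Fubini_integrable)
    have i: "integrable N (\<lambda>y. F x y)" for x
      by (rule Bochner_Integration.integrable_bound[of _ "\<lambda>y. norm (\<psi> x) * norm (\<sigma> y)"])
         (use s bd in \<open>auto intro!: AE_I2 simp: F_def\<close>)
    then show "AE x in lborel. integrable N (\<lambda>y. case (x, y) of (x, y) \<Rightarrow> F x y)" by simp
    show "integrable lborel (\<lambda>x. \<integral>y. norm (case (x, y) of (x, y) \<Rightarrow> F x y) \<partial>N)"
    proof (rule Bochner_Integration.integrable_bound[of _ "\<lambda>x. norm (\<psi> x) * (\<integral>y. norm (\<sigma> y) \<partial>N)"])
      show "integrable lborel (\<lambda>x. norm (\<psi> x) * (\<integral>y. norm (\<sigma> y) \<partial>N))" using p by simp
      have "(\<integral>y. \<bar>F x y\<bar> \<partial>N) \<le> (\<integral>y. norm (\<psi> x) * norm (\<sigma> y) \<partial>N)" for x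
        using i[of x] s bd[of x] by (intro integral_mono) auto
      then show "AE x in lborel. norm (\<integral>y. norm (case (x, y) of (x, y) \<Rightarrow> F x y) \<partial>N) \<le> norm (norm (\<psi> x) * (\<integral>y. norm (\<sigma> y) \<partial>N))"
        by (auto intro!: AE_I2 simp: abs_mult)
    qed measurable
  qed measurable
  have "(\<integral>x. (\<integral>y. indicator {..x} y *\<^sub>R \<sigma> y \<partial>N) \<bullet> \<psi> x \<partial>lborel) = (\<integral>x. (\<integral>y. F x y \<partial>N) \<partial>lborel)"
  proof (rule Bochner_Integration.integral_cong[OF refl])
    fix x
    have "integrable N (\<lambda>y. indicator {..x} y *\<^sub>R \<sigma> y)"
      using s by (intro integrable_mult_indicator) (auto simp: N)
    then have "(\<integral>y. indicator {..x} y *\<^sub>R \<sigma> y \<partial>N) \<bullet> \<psi> x = (\<integral>y. (indicator {..x} y *\<^sub>R \<sigma> y) \<bullet> \<psi> x \<partial>N)"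
      by (intro integral_inner_left[symmetric])
    also have "\<dots> = (\<integral>y. F x y \<partial>N)"
      by (rule Bochner_Integration.integral_cong) (auto simp: F_def indicator_def)
    finally show "(\<integral>y. indicator {..x} y *\<^sub>R \<sigma> y \<partial>N) \<bullet> \<psi> x = (\<integral>y. F x y \<partial>N)" .
  qed
  also have "\<dots> = (\<integral>y. (\<integral>x. F x y \<partial>lborel) \<partial>N)"
    using Fubini_integral[OF intF] by simp
  also have "\<dots> = (\<integral>y. \<sigma> y \<bullet> (\<integral>x. indicator {y..} x *\<^sub>R \<psi> x \<partial>lborel) \<partial>N)"
  proof (rule Bochner_Integration.integral_cong[OF refl])
    fix y
    have "integrable lborel (\<lambda>x. indicator {y..} x *\<^sub>R \<psi> x)"
      using p by (intro integrable_mult_indicator) auto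
    then have "\<sigma> y \<bullet> (\<integral>x. indicator {y..} x *\<^sub>R \<psi> x \<partial>lborel) = (\<integral>x. \<sigma> y \<bullet> (indicator {y..} x *\<^sub>R \<psi> x) \<partial>lborel)"
      by (intro integral_inner_right[symmetric])
    also have "\<dots> = (\<integral>x. F x y \<partial>lborel)"
      by (rule Bochner_Integration.integral_cong) (auto simp: F_def indicator_def)
    finally show "(\<integral>x. F x y \<partial>lborel) = \<sigma> y \<bullet> (\<integral>x. indicator {y..} x *\<^sub>R \<psi> x \<partial>lborel)" by simp
  qed
  finally show ?thesis .
qed

section \<open>Countable additivity and comparison of signed densities\<close>

lemma integral_indicator_disjoint_sums:
  fixes k :: "'b \<Rightarrow> 'a::euclidean_space"
  assumes k: "integrable N k" and A: "\<And>i. A i \<in> sets N" "disjoint_family A"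
  shows "(\<lambda>i. \<integral>x. indicator (A i) x *\<^sub>R k x \<partial>N) sums (\<integral>x. indicator (\<Union>i. A i) x *\<^sub>R k x \<partial>N)"
proof -
  have "set_integrable N (\<Union>i. A i) k"
    using k A unfolding set_integrable_def by (intro integrable_mult_indicator) auto
  from lebesgue_integral_countable_add[OF A(1) _ this] A(2)
    and sums_unique
  have eq: "(\<integral>x. indicator (\<Union>i. A i) x *\<^sub>R k x \<partial>N) = (\<Sum>i. \<integral>x. indicator (A i) x *\<^sub>R k x \<partial>N)"
    unfolding set_lebesgue_integral_def by (auto simp: disjoint_family_on_def)
  \<comment> \<open>The identity for \<open>suminf\<close> yields convergence only together with
    summability. Disjointness bounds all partial sums of the integrals of \<open>norm (k x)\<close>
    by its total integral, so the series converges absolutely.\<close>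
  have "summable (\<lambda>i. \<integral>x. indicator (A i) x *\<^sub>R k x \<partial>N)"
  proof (rule summable_norm_cancel, rule summable_comparison_test')
    fix n
    show "norm (norm (\<integral>x. indicator (A n) x *\<^sub>R k x \<partial>N)) \<le> (\<integral>x. indicator (A n) x * norm (k x) \<partial>N)"
      using integral_norm_bound[of N "\<lambda>x. indicator (A n) x *\<^sub>R k x"] by simp
  next
    show "summable (\<lambda>i. \<integral>x. indicator (A i) x * norm (k x) \<partial>N)"
    proof (rule summableI_nonneg_bounded)
      fix n
      show "0 \<le> (\<integral>x. indicator (A n) x * norm (k x) \<partial>N)" by simp
      have i: "integrable N (\<lambda>x. indicator (A i) x * norm (k x))" for i
        using integrable_mult_indicator[OF A(1)[of i] integrable_norm[OF k]] by simp
      have "(\<Sum>i<n. \<integral>x. indicator (A i) x * norm (k x) \<partial>N) = (\<integral>x. (\<Sum>i<n. indicator (A i) x * norm (k x)) \<partial>N)"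
        by (rule Bochner_Integration.integral_sum[symmetric]) (rule i)
      also have "\<dots> = (\<integral>x. indicator (\<Union>i<n. A i) x * norm (k x) \<partial>N)"
        by (rule Bochner_Integration.integral_cong)
           (auto simp: sum_distrib_right[symmetric] indicator_UN_disjoint disjoint_family_on_mono[OF _ A(2)])
      also have "\<dots> \<le> (\<integral>x. norm (k x) \<partial>N)"
        using k by (intro integral_mono') (auto simp: indicator_def)
      finally show "(\<Sum>i<n. \<integral>x. indicator (A i) x * norm (k x) \<partial>N) \<le> (\<integral>x. norm (k x) \<partial>N)" .
    qed
  qed
  then show ?thesis unfolding eq by (rule summable_sums)
qed

text \<open>The difference of the two signed measures has a nondecreasing distribution function, so it is the
  Lebesgue-Stieltjes measure of that function.\<close>
lemma integral_le_on_borel_if_le_on_intervals: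
  fixes k l :: "real \<Rightarrow> real"
  assumes "finite_measure N" and N: "sets N = sets borel" and k: "integrable N k"
    and "finite_measure M" and M: "sets M = sets borel" and l: "integrable M l"
    and k0: "\<And>x. x \<notin> {a<..<b} \<Longrightarrow> k x = 0" and l0: "\<And>x. x \<notin> {a<..<b} \<Longrightarrow> l x = 0"
    and le: "\<And>p q. a < p \<Longrightarrow> p < q \<Longrightarrow> q < b \<Longrightarrow>
       (\<integral>x. indicator {p<..q} x *\<^sub>R k x \<partial>N) \<le> (\<integral>x. indicator {p<..q} x *\<^sub>R l x \<partial>M)"
    and B: "B \<in> sets borel"
  shows "(\<integral>x. indicator B x *\<^sub>R k x \<partial>N) \<le> (\<integral>x. indicator B x *\<^sub>R l x \<partial>M)"
proof -
  interpret N: finite_measure N by fact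
  interpret M: finite_measure M by fact
  define D where "D = (\<lambda>A. (\<integral>x. indicator A x *\<^sub>R l x \<partial>M) - (\<integral>x. indicator A x *\<^sub>R k x \<partial>N))"
  define F where "F = (\<lambda>x. D {..x})"
  \<comment> \<open>The sets have to converge only at points of \<open>{a<..<b}\<close>, because
    both densities vanish elsewhere. Hence intervals inside \<open>{a<..<b}\<close> can approximate
    those that reach or cross its ends.\<close>
  have lim: "(\<lambda>n. D (A n)) \<longlonglongrightarrow> D A'" if "\<And>n. A n \<in> sets borel" "A' \<in> sets borel"
      "\<And>x. x \<in> {a<..<b} \<Longrightarrow> eventually (\<lambda>n. x \<in> A n \<longleftrightarrow> x \<in> A') sequentially" for A :: "nat \<Rightarrow> real set" and A'
  proof -
    have *: "(\<lambda>n. \<integral>x. indicator (A n) x *\<^sub>R g x \<partial>L) \<longlonglongrightarrow> (\<integral>x. indicator A' x *\<^sub>R g x \<partial>L)"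
      if "sets L = sets borel" "integrable L g" "\<And>x. x \<notin> {a<..<b} \<Longrightarrow> g x = 0" for L and g :: "real \<Rightarrow> real"
    proof (rule integral_dominated_convergence[where w = "\<lambda>x. norm (g x)"])
      show "AE x in L. (\<lambda>n. indicator (A n) x *\<^sub>R g x) \<longlonglongrightarrow> indicator A' x *\<^sub>R g x"
      proof (rule AE_I2)
        fix x show "(\<lambda>n. indicator (A n) x *\<^sub>R g x) \<longlonglongrightarrow> indicator A' x *\<^sub>R g x"
        proof (cases "x \<in> {a<..<b}")
          case True
          then have "eventually (\<lambda>n. indicator (A n) x *\<^sub>R g x = indicator A' x *\<^sub>R g x) sequentially"
            using \<open>\<And>x. x \<in> {a<..<b} \<Longrightarrow> _\<close>[OF True] by (auto elim!: eventually_mono simp: indicator_def)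
          then show ?thesis by (rule tendsto_eventually)
        qed (use that in auto)
      qed
    qed (use that \<open>\<And>n. A n \<in> _\<close> \<open>A' \<in> _\<close> borel_measurable_integrable[OF that(2)] in
          \<open>auto intro!: AE_I2 borel_measurable_scaleR borel_measurable_indicator simp: indicator_def\<close>)
    show ?thesis unfolding D_def using * N M k l k0 l0 by (intro tendsto_diff) auto
  qed
  have ind: "integrable L (\<lambda>x. indicator A x *\<^sub>R g x)"
    if "sets L = sets borel" "integrable L g" "A \<in> sets borel" for L and g :: "real \<Rightarrow> real" and A
    using that by (intro integrable_mult_indicator) auto
  have D_Un: "D (A \<union> A') = D A + D A'" if "A \<in> sets borel" "A' \<in> sets borel" "A \<inter> A' = {}" for A A'
  proof -
    have eq: "indicator (A \<union> A') x *\<^sub>R g x = indicator A x *\<^sub>R g x + indicator A' x *\<^sub>R g x" for x and g :: "real \<Rightarrow> real"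
      using that by (auto simp: indicator_def)
    show ?thesis unfolding D_def eq
      by (simp only: Bochner_Integration.integral_add[OF ind[OF N k that(1)] ind[OF N k that(2)]]
           Bochner_Integration.integral_add[OF ind[OF M l that(1)] ind[OF M l that(2)]])
  qed
  have F_diff: "F y - F x = D {x<..y}" if "x \<le> y" for x y
  proof -
    have "{..y} = {..x} \<union> {x<..y}" using that by auto
    moreover have "D ({..x} \<union> {x<..y}) = D {..x} + D {x<..y}" by (rule D_Un) auto
    ultimately show ?thesis unfolding F_def by simp
  qed
  have D_nonneg: "0 \<le> D {x<..y}" for x y
  proof (rule LIMSEQ_le_const)
    \<comment> \<open>The hypothesis \<open>le\<close> demands end points strictly inside
      \<open>{a<..<b}\<close>, so they are moved inwards by \<open>1 / Suc n\<close>. The result may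
      be empty, where \<open>D\<close> is zero.\<close>
    let ?J = "\<lambda>n::nat. {max x (a + 1 / Suc n) <.. min y (b - 1 / Suc n)}"
    show "(\<lambda>n. D (?J n)) \<longlonglongrightarrow> D {x<..y}"
    proof (rule lim)
      fix t assume t: "t \<in> {a<..<b}"
      have "eventually (\<lambda>n. 1 / real (Suc n) < t - a \<and> 1 / real (Suc n) < b - t) sequentially"
        using t by (intro eventually_conj order_tendstoD(2)[OF lim_1_over_n[THEN LIMSEQ_Suc]]) auto
      then show "eventually (\<lambda>n. t \<in> ?J n \<longleftrightarrow> t \<in> {x<..y}) sequentially"
        by (auto elim!: eventually_mono)
    qed auto
    have "0 \<le> D (?J n)" for n
    proof (cases "max x (a + 1 / Suc n) < min y (b - 1 / Suc n)")
      case True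
      have "a < max x (a + 1 / Suc n)" "min y (b - 1 / Suc n) < b"
        by (auto simp: less_max_iff_disj min_less_iff_disj)
      from le[OF this(1) True this(2)] show ?thesis by (simp add: D_def)
    next
      case False
      then have e: "?J n = {}" by (simp only: greaterThanAtMost_empty_iff not_less)
      show ?thesis unfolding e by (simp add: D_def)
    qed
    then show "\<exists>N. \<forall>n\<ge>N. 0 \<le> D (?J n)" by auto
  qed
  have mono: "F x \<le> F y" if "x \<le> y" for x y using F_diff[OF that] D_nonneg[of x y] by simp
  have rcont: "continuous (at_right x) F" for x
    unfolding continuous_within
  proof (rule tendsto_at_right_sequentially[of x "x + 1"])
    fix S :: "nat \<Rightarrow> real" assume S: "\<And>n. x < S n" "S \<longlonglongrightarrow> x"
    show "(\<lambda>n. F (S n)) \<longlonglongrightarrow> F x" unfolding F_def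
    proof (rule lim)
      fix t assume "t \<in> {a<..<b}"
      show "eventually (\<lambda>n. t \<in> {..S n} \<longleftrightarrow> t \<in> {..x}) sequentially"
      proof (cases "t \<le> x")
        case True
        then show ?thesis using S(1) by (auto intro!: always_eventually) (meson less_imp_le order_trans)
      next
        case False
        then have "eventually (\<lambda>n. S n < t) sequentially" using S(2) by (intro order_tendstoD(2)) auto
        then show ?thesis using False by (auto elim!: eventually_mono)
      qed
    qed auto
  qed simp
  define S where "S = interval_measure F"
  have S_Ioc: "emeasure S {x<..y} = ennreal (D {x<..y})" if "x \<le> y" for x y
    unfolding S_def using emeasure_interval_measure_Ioc[OF that mono rcont] F_diff[OF that] by simp
  have sets_S: "sets S = sets borel" "space S = UNIV" by (auto simp: S_def)
  have D_lim: "(\<lambda>n. D {-real n<..real n}) \<longlonglongrightarrow> D UNIV"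
  proof (rule lim)
    fix x :: real
    have "eventually (\<lambda>n. \<bar>x\<bar> < real n) sequentially"
      using filterlim_real_sequentially by (simp add: filterlim_at_top_dense)
    then show "eventually (\<lambda>n. x \<in> {-real n<..real n} \<longleftrightarrow> x \<in> UNIV) sequentially"
      by (auto elim!: eventually_mono)
  qed auto
  have S_UNIV: "emeasure S UNIV = ennreal (D UNIV)"
  proof (rule LIMSEQ_unique)
    have "(\<lambda>n. emeasure S {-real n<..real n}) \<longlonglongrightarrow> emeasure S (\<Union>n. {-real n<..real n})"
      by (rule Lim_emeasure_incseq) (auto simp: sets_S incseq_def)
    also have "(\<Union>n. {-real n<..real n}) = UNIV"
    proof -
      have "\<exists>n. - real n < x \<and> x \<le> real n" for x :: real
        using reals_Archimedean2[of "\<bar>x\<bar>"] by (metis abs_less_iff less_imp_le minus_less_iff)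
      then show ?thesis by auto
    qed
    finally show "(\<lambda>n. emeasure S {-real n<..real n}) \<longlonglongrightarrow> emeasure S UNIV" .
    from D_lim show "(\<lambda>n. emeasure S {-real n<..real n}) \<longlonglongrightarrow> ennreal (D UNIV)"
      by (subst S_Ioc) auto
  qed
  interpret S: finite_measure S by (rule finite_measureI) (simp add: sets_S S_UNIV)
  have D_UNIV: "0 \<le> D UNIV"
    using D_lim D_nonneg by (intro LIMSEQ_le_const) auto
  \<comment> \<open>A pi-lambda argument: \<open>D\<close> is so far only a real-valued additive set
    function, but it agrees with \<open>S\<close> on half-open intervals, and both respect
    complements and countable disjoint unions.\<close>
  have "Int_stable (range (\<lambda>(a, b). {a<..b::real}))" "range (\<lambda>(a, b). {a<..b::real}) \<subseteq> Pow UNIV"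
    by (auto simp: Int_stable_def)
  moreover have "B \<in> sigma_sets UNIV (range (\<lambda>(a, b). {a<..b::real}))"
    using B unfolding borel_sigma_sets_Ioc by simp
  ultimately have "D B = measure S B"
  proof (induction rule: sigma_sets_induct_disjoint)
    case (basic A)
    then obtain x y where A: "A = {x<..y}" by auto
    show ?case
    proof (cases "x \<le> y")
      case True
      then show ?thesis using S_Ioc[OF True] D_nonneg by (simp add: A measure_def)
    next
      case False
      then have "A = {}" using A by auto
      then show ?thesis by (simp add: D_def)
    qed
  next
    case empty
    show ?case by (simp add: D_def)
  next
    case (compl A)
    then have A: "A \<in> sets borel" unfolding borel_sigma_sets_Ioc by simp
    have "D UNIV = D A + D (UNIV - A)" using D_Un[of A "UNIV - A"] A by simp
    moreover have "measure S (UNIV - A) = measure S UNIV - measure S A"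
      using S.finite_measure_compl[of A] A sets_S by simp
    moreover have "measure S UNIV = D UNIV" using S_UNIV D_UNIV by (simp add: measure_def)
    ultimately show ?case using compl by simp
  next
    case (union A)
    then have A: "A i \<in> sets borel" for i unfolding borel_sigma_sets_Ioc by auto
    have "(\<lambda>i. D (A i)) sums D (\<Union>i. A i)"
      unfolding D_def using A N M k l union
      by (intro sums_diff integral_indicator_disjoint_sums) auto
    moreover have "(\<lambda>i. measure S (A i)) sums measure S (\<Union>i. A i)"
      using A sets_S union by (intro S.finite_measure_UNION) auto
    ultimately show ?case using union by (auto intro: sums_unique2)
  qed
  then have "0 \<le> D B" by simp
  then show ?thesis by (simp add: D_def)
qed

section \<open>Test functions and the variation measure\<close>

lemma C1cI:
  assumes "\<And>x. (\<phi> has_vector_derivative D x) (at x)" "continuous_on UNIV D"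
    and "compact K" "K \<subseteq> \<Omega>" "\<And>x. x \<notin> K \<Longrightarrow> \<phi> x = 0"
  shows "C1c \<Omega> \<phi>"
  using assms unfolding C1c_def C1_differentiable_on_def by blast

lemma C1c_mono: "C1c \<Omega> \<phi> \<Longrightarrow> \<Omega> \<subseteq> \<Omega>' \<Longrightarrow> C1c \<Omega>' \<phi>"
  unfolding C1c_def by blast

lemma C1c_has_derivative:
  "C1c \<Omega> \<phi> \<Longrightarrow> (\<phi> has_vector_derivative vector_derivative \<phi> (at x)) (at x)"
  unfolding C1c_def C1_differentiable_on_eq by (auto simp: vector_derivative_works)

lemma C1c_continuous_derivative:
  "C1c \<Omega> \<phi> \<Longrightarrow> continuous_on UNIV (\<lambda>x. vector_derivative \<phi> (at x))"
  unfolding C1c_def C1_differentiable_on_eq by auto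

lemma C1c_continuous: "C1c \<Omega> \<phi> \<Longrightarrow> continuous_on UNIV \<phi>"
  using C1c_has_derivative has_vector_derivative_continuous
  by (force simp: continuous_on_eq_continuous_at)

lemma C1c_eq_0: "C1c \<Omega> \<phi> \<Longrightarrow> x \<notin> \<Omega> \<Longrightarrow> \<phi> x = 0"
  unfolding C1c_def by blast

lemma C1c_support:
  assumes "C1c \<Omega> \<phi>"
  obtains K where "compact K" "K \<subseteq> \<Omega>" "\<And>x. x \<notin> K \<Longrightarrow> \<phi> x = 0"
    "\<And>x. x \<notin> K \<Longrightarrow> vector_derivative \<phi> (at x) = 0"
proof -
  from assms obtain K where K: "compact K" "K \<subseteq> \<Omega>" "\<And>x. x \<notin> K \<Longrightarrow> \<phi> x = 0"
    unfolding C1c_def by blast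
  have "vector_derivative \<phi> (at x) = 0" if "x \<notin> K" for x
  proof -
    have "((\<lambda>_. 0) has_vector_derivative 0) (at x)" by simp
    moreover have "open (- K)" using compact_imp_closed[OF K(1)] by auto
    ultimately have "(\<phi> has_vector_derivative 0) (at x)"
      by (rule has_vector_derivative_transform_within_open) (use that K(3) in auto)
    then show ?thesis by (rule vector_derivative_at)
  qed
  with K show ?thesis using that by blast
qed

lemma C1c_derivative_bounded:
  assumes "C1c \<Omega> \<phi>"
  obtains B where "\<And>x. norm (vector_derivative \<phi> (at x)) \<le> B"
proof -
  obtain K where K: "compact K" "\<And>x. x \<notin> K \<Longrightarrow> vector_derivative \<phi> (at x) = 0"
    using C1c_support[OF assms] by metis
  have "bounded ((\<lambda>x. vector_derivative \<phi> (at x)) ` K)"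
    by (intro compact_imp_bounded compact_continuous_image K continuous_on_subset[OF C1c_continuous_derivative[OF assms]]) auto
  then obtain B where B: "\<And>x. x \<in> K \<Longrightarrow> norm (vector_derivative \<phi> (at x)) \<le> B"
    unfolding bounded_iff by auto
  have "norm (vector_derivative \<phi> (at x)) \<le> max B 0" for x
    using B[of x] K(2)[of x] by (cases "x \<in> K") auto
  then show ?thesis by (rule that)
qed

lemma C1c_derivative_integrable:
  assumes "C1c \<Omega> \<phi>"
  shows "integrable lborel (\<lambda>x. vector_derivative \<phi> (at x))"
proof -
  obtain K where K: "compact K" "\<And>x. x \<notin> K \<Longrightarrow> vector_derivative \<phi> (at x) = 0"
    using C1c_support[OF assms] by metis
  have "integrable lborel (\<lambda>x. indicator K x *\<^sub>R vector_derivative \<phi> (at x))"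
    by (intro borel_integrable_compact K continuous_on_subset[OF C1c_continuous_derivative[OF assms]]) auto
  also have "(\<lambda>x. indicator K x *\<^sub>R vector_derivative \<phi> (at x)) = (\<lambda>x. vector_derivative \<phi> (at x))"
    using K(2) by (auto simp: indicator_def fun_eq_iff)
  finally show ?thesis .
qed

text \<open>The half-line form matches the inner integral of \<open>Fubini_halfline\<close>. It
  covers every real \<open>y\<close>, since it is integrated against measures on the whole line; the
  upper limit \<open>max y b\<close> in the proof takes care of \<open>y \<ge> b\<close>.\<close>

lemma C1c_integral_tail:
  assumes "C1c {a<..<b} \<phi>"
  shows "(\<integral>x. indicator {y..} x *\<^sub>R vector_derivative \<phi> (at x) \<partial>lborel) = - \<phi> y"
proof -
  obtain K where K: "K \<subseteq> {a<..<b}" "\<And>x. x \<notin> K \<Longrightarrow> vector_derivative \<phi> (at x) = 0"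
    using C1c_support[OF assms] by metis
  have 0: "vector_derivative \<phi> (at x) = 0" if "x \<ge> b" for x
    using K(1) that by (intro K(2)) auto
  have "(\<integral>x. indicator {y..} x *\<^sub>R vector_derivative \<phi> (at x) \<partial>lborel)
      = (\<integral>x. indicator {y..max y b} x *\<^sub>R vector_derivative \<phi> (at x) \<partial>lborel)"
    by (rule Bochner_Integration.integral_cong) (auto simp: indicator_def 0)
  also have "\<dots> = \<phi> (max y b) - \<phi> y"
    by (rule integral_FTC_Icc)
       (auto intro: has_vector_derivative_at_within C1c_has_derivative[OF assms] continuous_on_subset[OF C1c_continuous_derivative[OF assms]])
  also have "\<phi> (max y b) = 0" by (rule C1c_eq_0[OF assms]) auto
  finally show ?thesis by simp
qed

lemma C1c_integral_head:
  assumes "C1c {a<..<b} \<phi>"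
  shows "(\<integral>x. indicator {..y} x *\<^sub>R vector_derivative \<phi> (at x) \<partial>lborel) = \<phi> y"
proof -
  obtain K where K: "K \<subseteq> {a<..<b}" "\<And>x. x \<notin> K \<Longrightarrow> vector_derivative \<phi> (at x) = 0"
    using C1c_support[OF assms] by metis
  have 0: "vector_derivative \<phi> (at x) = 0" if "x \<le> a" for x
    using K(1) that by (intro K(2)) auto
  have "(\<integral>x. indicator {..y} x *\<^sub>R vector_derivative \<phi> (at x) \<partial>lborel)
      = (\<integral>x. indicator {min y a..y} x *\<^sub>R vector_derivative \<phi> (at x) \<partial>lborel)"
    by (rule Bochner_Integration.integral_cong) (auto simp: indicator_def 0)
  also have "\<dots> = \<phi> y - \<phi> (min y a)"
    by (rule integral_FTC_Icc)
       (auto intro: has_vector_derivative_at_within C1c_has_derivative[OF assms] continuous_on_subset[OF C1c_continuous_derivative[OF assms]])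
  also have "\<phi> (min y a) = 0" by (rule C1c_eq_0[OF assms]) auto
  finally show ?thesis by simp
qed

section \<open>Vector measures and their variation\<close>

lemma is_deriv_measureE:
  fixes u :: "real \<Rightarrow> real^'n"
  assumes "is_deriv_measure {a<..<b} u \<mu>"
  obtains N :: "real measure" and \<sigma> :: "real \<Rightarrow> real^'n"
  where "finite_measure N" "sets N = sets borel" "integrable N \<sigma>"
    "\<And>x. x \<notin> {a<..<b} \<Longrightarrow> \<sigma> x = 0"
    "\<And>A. A \<in> sets borel \<Longrightarrow> A \<subseteq> {a<..<b} \<Longrightarrow> \<mu> A = (\<integral>x. indicator A x *\<^sub>R \<sigma> x \<partial>N)"
    "\<And>\<phi>. C1c {a<..<b} \<phi> \<Longrightarrow>
       (LINT x:{a<..<b}|lborel. u x \<bullet> vector_derivative \<phi> (at x)) = - (\<integral>x. \<sigma> x \<bullet> \<phi> x \<partial>N)"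
proof -
  let ?I = "{a<..<b}"
  from assms obtain \<nu> :: "real measure" and \<sigma> :: "real \<Rightarrow> real^'n" where fin: "finite_measure \<nu>"
    and sp: "space \<nu> = ?I" and st: "sets \<nu> = sets (restrict_space borel ?I)"
    and i: "integrable \<nu> \<sigma>" and m: "\<And>A. A \<in> sets \<nu> \<Longrightarrow> \<mu> A = (LINT x:A|\<nu>. \<sigma> x)"
    and t: "\<And>\<phi>. C1c ?I \<phi> \<Longrightarrow>
           (LINT x:?I|lborel. u x \<bullet> vector_derivative \<phi> (at x)) = - (\<integral>x. \<phi> x \<bullet> \<sigma> x \<partial>\<nu>)"
    unfolding is_deriv_measure_def by blast
  \<comment> \<open>Pushing the measure forward to the line and extending the density by zero leaves
    the interval visible only in the zeros of \<open>\<sigma>'\<close>. Derivatives given on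
    different intervals then live on one space.\<close>
  define N where "N = distr \<nu> borel (\<lambda>x. x)"
  define \<sigma>' where "\<sigma>' = (\<lambda>x. indicator ?I x *\<^sub>R \<sigma> x)"
  have id[measurable]: "(\<lambda>x. x) \<in> measurable \<nu> borel"
    using st by (simp add: measurable_def sp sets_restrict_space image_iff) (metis Int_commute)
  interpret finite_measure \<nu> by fact
  have "\<sigma> \<in> borel_measurable (restrict_space borel ?I)"
    using borel_measurable_integrable[OF i] st by (simp cong: measurable_cong_sets)
  then have s'[measurable]: "\<sigma>' \<in> borel_measurable borel"
    unfolding \<sigma>'_def by (subst (asm) borel_measurable_restrict_space_iff) auto
  have eq: "\<sigma>' x = \<sigma> x" if "x \<in> space \<nu>" for x using that sp by (simp add: \<sigma>'_def)
  show thesis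
  proof (rule that[of N \<sigma>'])
    show "finite_measure N" unfolding N_def by (rule finite_measure_distr) (rule id)
    show "sets N = sets borel" by (simp add: N_def)
    show "integrable N \<sigma>'" unfolding N_def
      by (subst integrable_distr_eq) (use i eq in \<open>auto cong: Bochner_Integration.integrable_cong\<close>)
    show "\<sigma>' x = 0" if "x \<notin> ?I" for x using that by (simp add: \<sigma>'_def)
    show "\<mu> A = (\<integral>x. indicator A x *\<^sub>R \<sigma>' x \<partial>N)" if A: "A \<in> sets borel" "A \<subseteq> ?I" for A
    proof -
      have "A \<in> sets \<nu>" using A st by (auto simp: sets_restrict_space)
      then have "\<mu> A = (\<integral>x. indicator A x *\<^sub>R \<sigma> x \<partial>\<nu>)" using m by (simp add: set_lebesgue_integral_def)
      also have "\<dots> = (\<integral>x. indicator A x *\<^sub>R \<sigma>' x \<partial>\<nu>)"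
        by (rule Bochner_Integration.integral_cong) (auto simp: eq)
      also have "\<dots> = (\<integral>x. indicator A x *\<^sub>R \<sigma>' x \<partial>N)" unfolding N_def
        using A by (subst integral_distr) auto
      finally show ?thesis .
    qed
    fix \<phi> :: "real \<Rightarrow> real^'n" assume \<phi>: "C1c ?I \<phi>"
    have [measurable]: "\<phi> \<in> borel_measurable borel"
      using C1c_continuous[OF \<phi>] by (rule borel_measurable_continuous_onI)
    have "(\<integral>x. \<phi> x \<bullet> \<sigma> x \<partial>\<nu>) = (\<integral>x. \<sigma>' x \<bullet> \<phi> x \<partial>\<nu>)"
      by (rule Bochner_Integration.integral_cong) (auto simp: eq inner_commute)
    also have "\<dots> = (\<integral>x. \<sigma>' x \<bullet> \<phi> x \<partial>N)" unfolding N_def by (subst integral_distr) auto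
    finally show "(LINT x:?I|lborel. u x \<bullet> vector_derivative \<phi> (at x)) = - (\<integral>x. \<sigma>' x \<bullet> \<phi> x \<partial>N)"
      using t[OF \<phi>] by simp
  qed
qed

text \<open>The direction \<open>v\<close> varies from point to point, whereas
  \<open>var_measure\<close> sees only the vectors \<open>\<mu> C\<close>. On a piece where
  \<open>v\<close> is nearly constant the integral is nearly \<open>\<mu> C \<bullet> v y\<close>,
  which is at most \<open>norm (\<mu> C)\<close>; separability provides a partition into countably
  many such pieces.\<close>

lemma integral_le_var_measure:
  fixes \<sigma> v :: "real \<Rightarrow> real^'n"
  assumes N: "sets N = sets borel" and s: "integrable N \<sigma>"
    and \<mu>: "\<And>C. C \<in> sets borel \<Longrightarrow> C \<subseteq> A \<Longrightarrow> \<mu> C = (\<integral>x. indicator C x *\<^sub>R \<sigma> x \<partial>N)"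
    and A: "A \<in> sets borel" and B: "B \<in> sets borel" "B \<subseteq> A"
    and v[measurable]: "v \<in> borel_measurable borel" and v1: "\<And>x. x \<in> B \<Longrightarrow> norm (v x) \<le> 1"
  shows "ennreal (\<integral>x. indicator B x *\<^sub>R (\<sigma> x \<bullet> v x) \<partial>N) \<le> var_measure \<mu> A"
proof (rule ennreal_le_epsilon)
  note [measurable_cong] = N and [measurable] = A B(1)
  have [measurable]: "\<sigma> \<in> borel_measurable N" using s by auto
  define S where "S = (\<integral>x. indicator B x *\<^sub>R norm (\<sigma> x) \<partial>N)"
  have S: "0 \<le> S" unfolding S_def by simp
  fix \<delta> :: real assume \<delta>: "0 < \<delta>"
  \<comment> \<open>On one piece \<open>v\<close> oscillates by at most
    \<open>2 * \<epsilon>\<close>, which costs \<open>2 * \<epsilon> * S\<close> in total. The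
    \<open>+ 1\<close> keeps the quotient meaningful when \<open>S = 0\<close>.\<close>
  define \<epsilon> where "\<epsilon> = \<delta> / (2 * (S + 1))"
  have \<epsilon>: "0 < \<epsilon>" "2 * \<epsilon> * S \<le> \<delta>" using \<delta> S by (auto simp: \<epsilon>_def field_simps)
  obtain D :: "(real^'n) set" where D: "countable D" "\<And>X. open X \<Longrightarrow> X \<noteq> {} \<Longrightarrow> \<exists>d\<in>D. d \<in> X"
    by (erule countable_dense_setE)
  then have "D \<noteq> {}" using D(2)[of UNIV] by auto
  define e where "e = from_nat_into D"
  \<comment> \<open>The sets where \<open>v\<close> is within \<open>\<epsilon>\<close> of the
    \<open>k\<close>-th point of a dense sequence cover \<open>B\<close>; \<open>disjointed\<close>
    shrinks them to a partition and so preserves the closeness.\<close>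
  define C where "C = disjointed (\<lambda>k. {x \<in> B. dist (v x) (e k) < \<epsilon>})"
  have C_dist: "dist (v x) (e k) < \<epsilon>" if "x \<in> C k" for x k
    using that disjointed_subset[of "\<lambda>k. {x \<in> B. dist (v x) (e k) < \<epsilon>}" k] unfolding C_def by auto
  have "range (\<lambda>k. {x \<in> B. dist (v x) (e k) < \<epsilon>}) \<subseteq> sets borel" by auto
  then have C_sets[measurable]: "C k \<in> sets borel" for k
    unfolding C_def using sets.range_disjointed_sets[of "\<lambda>k. {x \<in> B. dist (v x) (e k) < \<epsilon>}" borel] by auto
  have C_disj: "disjoint_family C" unfolding C_def by (rule disjoint_family_disjointed)
  have C_UN: "(\<Union>k. C k) = B"
  proof -
    have "\<exists>k. dist (v x) (e k) < \<epsilon>" for x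
    proof -
      obtain d where "d \<in> D" "d \<in> ball (v x) \<epsilon>" using D(2)[of "ball (v x) \<epsilon>"] \<epsilon> by auto
      then show ?thesis unfolding e_def using from_nat_into_surj[OF D(1) \<open>d \<in> D\<close>] by auto
    qed
    then show ?thesis unfolding C_def UN_disjointed_eq by auto
  qed
  have CB: "C k \<subseteq> B" for k using C_UN by auto
  have int: "integrable N (\<lambda>x. indicator X x *\<^sub>R \<sigma> x)" "integrable N (\<lambda>x. indicator X x *\<^sub>R norm (\<sigma> x))"
    if "X \<in> sets borel" for X
    using that s N by (intro integrable_mult_indicator; simp)+
  have int_v: "integrable N (\<lambda>x. indicator B x *\<^sub>R (\<sigma> x \<bullet> v x))"
  proof (rule Bochner_Integration.integrable_bound[OF int(2)[OF B(1)]])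
    have "\<bar>\<sigma> x \<bullet> v x\<bar> \<le> norm (\<sigma> x)" if "x \<in> B" for x
      using Cauchy_Schwarz_ineq2[of "\<sigma> x" "v x"] v1[OF that] mult_left_le[of "norm (v x)" "norm (\<sigma> x)"] by simp
    then show "AE x in N. norm (indicator B x *\<^sub>R (\<sigma> x \<bullet> v x)) \<le> norm (indicator B x *\<^sub>R norm (\<sigma> x))"
      by (auto simp: indicator_def)
  qed measurable
  define s where "s = (\<lambda>k. \<integral>x. indicator (C k) x *\<^sub>R norm (\<sigma> x) \<partial>N)"
  define i where "i = (\<lambda>k. \<integral>x. indicator (C k) x *\<^sub>R (\<sigma> x \<bullet> v x) \<partial>N)"
  have s_sums: "s sums S"
    using integral_indicator_disjoint_sums[of N "\<lambda>x. norm (\<sigma> x)" C] C_disj C_UN N assms(2) by (simp add: s_def S_def)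
  have i_sums: "i sums (\<integral>x. indicator B x *\<^sub>R (\<sigma> x \<bullet> v x) \<partial>N)"
  proof -
    have eq: "indicator (C k) x *\<^sub>R indicator B x *\<^sub>R (\<sigma> x \<bullet> v x) = indicator (C k) x *\<^sub>R (\<sigma> x \<bullet> v x)" for k x
      using CB[of k] by (auto simp: indicator_def)
    have eq': "indicator B x *\<^sub>R indicator B x *\<^sub>R (\<sigma> x \<bullet> v x) = indicator B x *\<^sub>R (\<sigma> x \<bullet> v x)" for x
      by (auto simp: indicator_def)
    show ?thesis
      using integral_indicator_disjoint_sums[OF int_v, of C] C_disj N unfolding eq eq' C_UN i_def by simp
  qed
  have \<mu>C: "\<mu> (C k) = (\<integral>x. indicator (C k) x *\<^sub>R \<sigma> x \<partial>N)" for k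
    using CB B by (intro \<mu>) auto
  have \<mu>s: "norm (\<mu> (C k)) \<le> s k" for k
    unfolding \<mu>C s_def using integral_norm_bound[of N "\<lambda>x. indicator (C k) x *\<^sub>R \<sigma> x"] by simp
  have summ: "summable (\<lambda>k. norm (\<mu> (C k)))"
    by (rule summable_comparison_test'[OF sums_summable[OF s_sums]]) (use \<mu>s in auto)
  have i_le: "i k \<le> norm (\<mu> (C k)) + 2 * \<epsilon> * s k" for k
  proof (cases "C k = {}")
    case True
    then show ?thesis by (simp add: i_def s_def)
  next
    case False
    then obtain y where y: "y \<in> C k" by auto
    have bd: "indicator (C k) x *\<^sub>R (\<sigma> x \<bullet> v x) \<le> (indicator (C k) x *\<^sub>R \<sigma> x) \<bullet> v y + 2 * \<epsilon> * (indicator (C k) x *\<^sub>R norm (\<sigma> x))" for x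
    proof (cases "x \<in> C k")
      case True
      have "dist (v x) (v y) \<le> 2 * \<epsilon>"
        using C_dist[OF True] C_dist[OF y] dist_triangle2[of "v x" "v y" "e k"] by simp
      then have "\<sigma> x \<bullet> (v x - v y) \<le> norm (\<sigma> x) * (2 * \<epsilon>)"
        using Cauchy_Schwarz_ineq2[of "\<sigma> x" "v x - v y"] mult_left_mono[of "norm (v x - v y)" "2 * \<epsilon>" "norm (\<sigma> x)"]
        by (simp add: dist_norm)
      then show ?thesis using True by (simp add: inner_diff_right mult.commute)
    qed auto
    have "i k \<le> (\<integral>x. (indicator (C k) x *\<^sub>R \<sigma> x) \<bullet> v y + 2 * \<epsilon> * (indicator (C k) x *\<^sub>R norm (\<sigma> x)) \<partial>N)"
      unfolding i_def
    proof (rule integral_mono[OF _ _ bd])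
      have "integrable N (\<lambda>x. indicator (C k) x *\<^sub>R indicator B x *\<^sub>R (\<sigma> x \<bullet> v x))"
        by (rule integrable_mult_indicator[OF _ int_v]) (simp add: N)
      also have "(\<lambda>x. indicator (C k) x *\<^sub>R indicator B x *\<^sub>R (\<sigma> x \<bullet> v x)) = (\<lambda>x. indicator (C k) x *\<^sub>R (\<sigma> x \<bullet> v x))"
        using CB[of k] by (auto simp: indicator_def fun_eq_iff)
      finally show "integrable N (\<lambda>x. indicator (C k) x *\<^sub>R (\<sigma> x \<bullet> v x))" .
      show "integrable N (\<lambda>x. (indicator (C k) x *\<^sub>R \<sigma> x) \<bullet> v y + 2 * \<epsilon> * (indicator (C k) x *\<^sub>R norm (\<sigma> x)))"
        by (intro Bochner_Integration.integrable_add integrable_inner_left integrable_mult_right int) auto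
    qed
    also have "\<dots> = \<mu> (C k) \<bullet> v y + 2 * \<epsilon> * s k"
      unfolding \<mu>C s_def
      by (subst Bochner_Integration.integral_add, intro integrable_inner_left int, simp,
          intro integrable_mult_right int, simp, subst integral_inner_left, rule int, auto)
    also have "\<mu> (C k) \<bullet> v y \<le> norm (\<mu> (C k))"
    proof -
      have "\<mu> (C k) \<bullet> v y \<le> norm (\<mu> (C k)) * norm (v y)" by (rule norm_cauchy_schwarz)
      also have "\<dots> \<le> norm (\<mu> (C k))" using v1[of y] y CB[of k] by (intro mult_left_le) auto
      finally show ?thesis .
    qed
    finally show ?thesis by simp
  qed
  have "(\<integral>x. indicator B x *\<^sub>R (\<sigma> x \<bullet> v x) \<partial>N) \<le> (\<Sum>k. norm (\<mu> (C k)) + 2 * \<epsilon> * s k)"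
    unfolding sums_unique[OF i_sums]
    by (intro suminf_le i_le sums_summable[OF i_sums] summable_add summ summable_mult sums_summable[OF s_sums])
  also have "\<dots> = (\<Sum>k. norm (\<mu> (C k))) + 2 * \<epsilon> * S"
    by (subst suminf_add[symmetric])
       (auto intro!: summ summable_mult sums_summable[OF s_sums] simp: suminf_mult[OF sums_summable[OF s_sums]] sums_unique[OF s_sums, symmetric])
  also have "\<dots> \<le> (\<Sum>k. norm (\<mu> (C k))) + \<delta>" using \<epsilon> by simp
  finally have "ennreal (\<integral>x. indicator B x *\<^sub>R (\<sigma> x \<bullet> v x) \<partial>N) \<le> ennreal ((\<Sum>k. norm (\<mu> (C k))) + \<delta>)"
    by (rule ennreal_leI)
  also have "\<dots> = (\<Sum>k. ennreal (norm (\<mu> (C k)))) + ennreal \<delta>"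
    using \<delta> summ by (simp add: ennreal_plus suminf_nonneg suminf_ennreal2)
  also have "(\<Sum>k. ennreal (norm (\<mu> (C k)))) \<le> var_measure \<mu> A"
  proof -
    define P where "P = (\<lambda>k. case k of 0 \<Rightarrow> A - B | Suc j \<Rightarrow> C j)"
    have "disjoint_family P"
      unfolding disjoint_family_on_def
    proof (intro ballI impI)
      fix m n :: nat assume "m \<noteq> n"
      then show "P m \<inter> P n = {}"
        using CB C_disj unfolding P_def disjoint_family_on_def by (cases m; cases n) auto
    qed
    moreover have "range P \<subseteq> sets borel" using A B by (auto simp: P_def split: nat.split)
    moreover have "(\<Union>k. P k) = A"
    proof -
      have "(\<Union>k. P k) = P 0 \<union> (\<Union>k. P (Suc k))" by (auto simp: P_def split: nat.splits)
      then show ?thesis using C_UN B by (auto simp: P_def)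
    qed
    ultimately have "(\<Sum>k. ennreal (norm (\<mu> (P k)))) \<le> var_measure \<mu> A"
      unfolding var_measure_def by (intro SUP_upper) auto
    moreover have "(\<Sum>k. ennreal (norm (\<mu> (C k)))) \<le> (\<Sum>k. ennreal (norm (\<mu> (P k))))"
    proof -
      have "(\<Sum>k. ennreal (norm (\<mu> (P k)))) = (\<Sum>k. ennreal (norm (\<mu> (P (k + 1))))) + (\<Sum>k<1. ennreal (norm (\<mu> (P k))))"
        by (rule suminf_offset) simp
      moreover have "P (k + 1) = C k" for k by (simp add: P_def)
      ultimately show ?thesis by simp
    qed
    ultimately show ?thesis by simp
  qed
  finally show "ennreal (\<integral>x. indicator B x *\<^sub>R (\<sigma> x \<bullet> v x) \<partial>N) \<le> var_measure \<mu> A + ennreal \<delta>"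
    by (metis add_right_mono order_trans)
qed

section \<open>Cutoffs and primitives\<close>

lemma integrable_scaleR_indicator_bounded:
  fixes c :: "'a::{banach,second_countable_topology}"
  assumes "bounded A" "A \<in> sets borel"
  shows "integrable lborel (\<lambda>x::real. indicator A x *\<^sub>R c)"
  using emeasure_bounded_finite[OF assms(1)] assms(2) by (intro integrable_scaleR_left integrable_real_indicator) auto

text \<open>The squared positive part is a simple C1 function that vanishes on a half-line. Both
  families of test functions below are built from it.\<close>

lemma pos_square_has_derivative:
  "((\<lambda>t. (max 0 t)\<^sup>2) has_real_derivative 2 * max 0 t) (at (t::real))"
proof (cases "t = 0")
  case True
  have "((\<lambda>h. (max 0 h)\<^sup>2 / h) \<longlongrightarrow> (0::real)) (at 0)"
  proof (rule Lim_null_comparison)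
    show "\<forall>\<^sub>F h in at (0::real). norm ((max 0 h)\<^sup>2 / h) \<le> \<bar>h\<bar>"
      by (auto simp: eventually_at_filter max_def power2_eq_square abs_mult)
    show "((\<lambda>h::real. \<bar>h\<bar>) \<longlongrightarrow> 0) (at 0)" by (rule tendsto_rabs_zero[OF tendsto_ident_at])
  qed
  then show ?thesis by (simp add: True DERIV_def)
next
  case False
  show ?thesis
  proof (cases "t > 0")
    case True
    have "((\<lambda>t. t\<^sup>2) has_real_derivative 2 * t) (at t)" by (auto intro!: derivative_eq_intros)
    then have "((\<lambda>t. (max 0 t)\<^sup>2) has_real_derivative 2 * t) (at t)"
      by (rule DERIV_cong_ev[THEN iffD1, rotated -1])
         (use True in \<open>auto intro!: eventually_mono[OF eventually_gt_at_top] simp: eventually_nhds intro: exI[of _ "{0<..}"]\<close>)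
    then show ?thesis using True by simp
  next
    case f: False
    have "((\<lambda>t. 0) has_real_derivative 0) (at t)" by simp
    then have "((\<lambda>t. (max 0 t)\<^sup>2) has_real_derivative 0) (at t)"
      by (rule DERIV_cong_ev[THEN iffD1, rotated -1])
         (use f False in \<open>auto simp: eventually_nhds intro: exI[of _ "{..<0}"]\<close>)
    then show ?thesis using f by simp
  qed
qed

lemma eventually_one_le_shifted_mult:
  fixes s t :: real
  assumes "0 < t" "0 \<le> s"
  shows "eventually (\<lambda>n. 1 \<le> (real n + s) * t) sequentially"
proof -
  have "filterlim (\<lambda>n. t * real n) at_top sequentially"
    by (rule filterlim_tendsto_pos_mult_at_top[OF tendsto_const assms(1) filterlim_real_sequentially])
  then have "eventually (\<lambda>n. 1 \<le> t * real n) sequentially" by (simp add: filterlim_at_top)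
  then show ?thesis
  proof eventually_elim
    case (elim n)
    have "0 \<le> s * t" using assms by simp
    with elim show ?case by (simp add: algebra_simps)
  qed
qed

text \<open>The limit must be correct at every point, including \<open>p\<close> and
  \<open>q\<close>, because the measures that it is integrated against may have atoms there. A
  single \<open>r\<close> below \<open>b\<close> confines the supports for all
  \<open>n\<close>.\<close>

lemma C1_cutoff:
  fixes p q b :: real
  assumes pq: "p < q" "q < b"
  obtains \<eta> \<eta>' :: "nat \<Rightarrow> real \<Rightarrow> real" and r :: real
  where "r < b" "\<And>n x. (\<eta> n has_real_derivative \<eta>' n x) (at x)" "\<And>n. continuous_on UNIV (\<eta>' n)"
    "\<And>n x. 0 \<le> \<eta> n x" "\<And>n x. \<eta> n x \<le> 1" "\<And>n x. x \<notin> {p..r} \<Longrightarrow> \<eta> n x = 0"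
    "\<And>x. (\<lambda>n. \<eta> n x) \<longlonglongrightarrow> indicator {p<..q} x"
proof -
  \<comment> \<open>A C1 step that is 0 for \<open>t \<le> 0\<close> and 1 for
    \<open>t \<ge> 1\<close>. The value 0 at \<open>t = 0\<close> is what excludes \<open>p\<close>
    from the limit of \<open>\<eta>\<close> and includes \<open>q\<close>.\<close>
  define s :: "real \<Rightarrow> real" where "s = (\<lambda>t. (max 0 (1 - (max 0 (1 - t))\<^sup>2))\<^sup>2)"
  define s' :: "real \<Rightarrow> real" where "s' = (\<lambda>t. (2 * max 0 (1 - (max 0 (1 - t))\<^sup>2)) * (2 * max 0 (1 - t)))"
  have s_deriv: "(s has_real_derivative s' t) (at t)" for t
  proof -
    have "((\<lambda>t. (max 0 (1 - t))\<^sup>2) has_real_derivative 2 * max 0 (1 - t) * (0 - 1)) (at t)"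
      by (rule DERIV_chain2[OF pos_square_has_derivative]) (auto intro!: derivative_eq_intros)
    from DERIV_diff[OF DERIV_const[of 1] this]
    have "((\<lambda>t. 1 - (max 0 (1 - t))\<^sup>2) has_real_derivative 2 * max 0 (1 - t)) (at t)" by simp
    then show ?thesis unfolding s_def s'_def by (rule DERIV_chain2[OF pos_square_has_derivative])
  qed
  have s'_cont: "continuous_on UNIV s'" unfolding s'_def by (intro continuous_intros)
  have s0: "s t = 0" if "t \<le> 0" for t
  proof -
    have "1 \<le> (1 - t)\<^sup>2" using that by (simp add: one_le_power)
    then show ?thesis using that by (simp add: s_def)
  qed
  have s1: "s t = 1" if "t \<ge> 1" for t using that by (simp add: s_def)
  have s_mono: "s x \<le> s y" if "x \<le> y" for x y
    unfolding s_def using that by (intro power_mono max.mono diff_mono) auto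
  have s_ge0: "0 \<le> s t" for t by (simp add: s_def)
  have s_le1: "s t \<le> 1" for t unfolding s_def by (rule power_le_one) auto
  \<comment> \<open>The summand \<open>2 / (b - q)\<close> gives
    \<open>m n * (x - q) \<ge> 1\<close> beyond the midpoint of \<open>q\<close> and
    \<open>b\<close>, already for \<open>n = 0\<close>. Both steps are 1 there and cancel.\<close>
  define m where "m = (\<lambda>n. real n + 2 / (b - q))"
  have m0: "m n > 0" for n using pq by (auto simp: m_def intro!: add_nonneg_pos)
  have m_inf: "eventually (\<lambda>n. 1 \<le> m n * t) sequentially" if "t > 0" for t
    unfolding m_def using that pq by (intro eventually_one_le_shifted_mult) auto
  define \<eta> where "\<eta> = (\<lambda>n x. s (m n * (x - p)) - s (m n * (x - q)))"
  define \<eta>' where "\<eta>' = (\<lambda>n x. s' (m n * (x - p)) * m n - s' (m n * (x - q)) * m n)"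
  have arg: "m n * (x - q) \<le> m n * (x - p)" for n x using m0[of n] pq by (intro mult_left_mono) auto
  show thesis
  proof (rule that[of "(q + b) / 2" \<eta> \<eta>'])
    show "(q + b) / 2 < b" using pq by simp
    show "(\<eta> n has_real_derivative \<eta>' n x) (at x)" for n x
      unfolding \<eta>_def \<eta>'_def
      by (intro DERIV_diff DERIV_chain2[OF s_deriv]) (auto intro!: derivative_eq_intros)
    show "continuous_on UNIV (\<eta>' n)" for n
      unfolding \<eta>'_def by (intro continuous_intros continuous_on_compose2[OF s'_cont]) auto
    show "0 \<le> \<eta> n x" for n x unfolding \<eta>_def using s_mono[OF arg] by simp
    show "\<eta> n x \<le> 1" for n x unfolding \<eta>_def using s_le1[of "m n * (x - p)"] s_ge0[of "m n * (x - q)"] by simp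
    show "\<eta> n x = 0" if "x \<notin> {p..(q + b) / 2}" for n x
    proof (cases "x < p")
      case True
      then have "m n * (x - p) \<le> 0" using m0[of n] by (simp add: mult_le_0_iff)
      then show ?thesis unfolding \<eta>_def using arg[of n x] by (simp add: s0)
    next
      case False
      then have "(b - q) / 2 \<le> x - q" using that by (simp add: field_simps)
      moreover have "2 / (b - q) \<le> m n" by (simp add: m_def)
      ultimately have "2 / (b - q) * ((b - q) / 2) \<le> m n * (x - q)"
        using pq m0[of n] by (intro mult_mono) auto
      moreover have "2 / w * (w / 2) = 1" if "w > 0" for w :: real using that by simp
      from this[of "b - q"] have "2 / (b - q) * ((b - q) / 2) = 1" using pq by simp
      ultimately have "1 \<le> m n * (x - q)" by linarith
      then show ?thesis unfolding \<eta>_def using arg[of n x] by (simp add: s1)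
    qed
    show "(\<lambda>n. \<eta> n x) \<longlonglongrightarrow> indicator {p<..q} x" for x
    proof (rule tendsto_eventually)
      consider "x \<le> p" | "p < x" "x \<le> q" | "q < x" by linarith
      then show "\<forall>\<^sub>F n in sequentially. \<eta> n x = indicator {p<..q} x"
      proof cases
        case 1
        then have "m n * (x - p) \<le> 0" "m n * (x - q) \<le> 0" for n
          using m0[of n] pq by (auto simp: mult_le_0_iff)
        then show ?thesis using 1 by (simp add: \<eta>_def s0)
      next
        case 2
        then have "m n * (x - q) \<le> 0" for n using m0[of n] by (auto simp: mult_le_0_iff)
        then show ?thesis using m_inf[of "x - p"] 2 by (auto elim!: eventually_mono simp: \<eta>_def s0 s1)
      next
        case 3
        then have "eventually (\<lambda>n. 1 \<le> m n * (x - p) \<and> 1 \<le> m n * (x - q)) sequentially"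
          using pq by (intro eventually_conj m_inf) auto
        then show ?thesis using 3 by (auto elim!: eventually_mono simp: \<eta>_def s1)
      qed
    qed
  qed
qed

text \<open>C1 approximations of the tent that rises linearly to height 1 on \<open>{p..q}\<close>
  and falls back on \<open>{q..r}\<close>; the rise and the fall cancel, which makes the support
  compact. Tested against them, a function reveals the difference of its means over two adjacent
  intervals.\<close>

lemma C1_tent:
  fixes p q r b :: real
  assumes pq: "p < q" "q < r" "r < b"
  obtains \<tau> \<tau>' :: "nat \<Rightarrow> real \<Rightarrow> real" and r' :: real
  where "r' < b" "\<And>n x. (\<tau> n has_real_derivative \<tau>' n x) (at x)" "\<And>n. continuous_on UNIV (\<tau>' n)"
    "\<And>n x. \<bar>\<tau>' n x\<bar> \<le> 1 / (q - p) + 1 / (r - q)" "\<And>n x. x \<notin> {p..r'} \<Longrightarrow> \<tau> n x = 0"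
    "\<And>x. (\<lambda>n. \<tau>' n x) \<longlonglongrightarrow> indicator {p<..q} x / (q - p) - indicator {q<..r} x / (r - q)"
proof -
  \<comment> \<open>\<open>S\<close> is a primitive of the ramp \<open>h\<close>, a positive part
    with a rounded corner. Its offset \<open>1 / 2\<close> for \<open>t \<ge> 1\<close> cancels in
    the differences that form \<open>\<tau>\<close>.\<close>
  define S :: "real \<Rightarrow> real" where "S = (\<lambda>t. ((max 0 t)\<^sup>2 - (max 0 (t - 1))\<^sup>2) / 2)"
  define h :: "real \<Rightarrow> real" where "h = (\<lambda>t. max 0 t - max 0 (t - 1))"
  have S_deriv: "(S has_real_derivative h t) (at t)" for t
  proof -
    have "((\<lambda>t. (max 0 (t - 1))\<^sup>2) has_real_derivative 2 * max 0 (t - 1) * (1 - 0)) (at t)"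
      by (rule DERIV_chain2[OF pos_square_has_derivative]) (auto intro!: derivative_eq_intros)
    from DERIV_cdivide[OF DERIV_diff[OF pos_square_has_derivative this], of 2]
    show ?thesis unfolding S_def h_def by (simp add: diff_divide_distrib)
  qed
  have h_cont: "continuous_on UNIV h" unfolding h_def by (intro continuous_intros)
  have h01: "0 \<le> h t" "h t \<le> 1" for t by (auto simp: h_def)
  have h_mono: "h x \<le> h y" if "x \<le> y" for x y using that by (auto simp: h_def max_def)
  have h0: "h t = 0" "S t = 0" if "t \<le> 0" for t using that by (auto simp: h_def S_def)
  have h1: "h t = 1" "S t = t - 1 / 2" if "t \<ge> 1" for t using that by (auto simp: h_def S_def power2_eq_square field_simps)
  define m where "m = (\<lambda>n. real n + 2 / (b - r))"
  have m0: "m n > 0" for n using pq by (auto simp: m_def intro!: add_nonneg_pos)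
  have m_inf: "eventually (\<lambda>n. 1 \<le> m n * t) sequentially" if "t > 0" for t
    unfolding m_def using that pq by (intro eventually_one_le_shifted_mult) auto
  define \<tau> where "\<tau> = (\<lambda>n x. (S (m n * (x - p)) / m n - S (m n * (x - q)) / m n) / (q - p)
      - (S (m n * (x - q)) / m n - S (m n * (x - r)) / m n) / (r - q))"
  define \<tau>' where "\<tau>' = (\<lambda>n x. (h (m n * (x - p)) - h (m n * (x - q))) / (q - p)
      - (h (m n * (x - q)) - h (m n * (x - r))) / (r - q))"
  have arg: "m n * (x - q) \<le> m n * (x - p)" "m n * (x - r) \<le> m n * (x - q)" for n x
    using m0[of n] pq by (auto intro!: mult_left_mono)
  have h_lim: "(\<lambda>n. h (m n * (x - t))) \<longlonglongrightarrow> indicator {t<..} x" for x t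
  proof (cases "x \<le> t")
    case True
    then have "m n * (x - t) \<le> 0" for n using m0[of n] by (auto simp: mult_le_0_iff)
    then show ?thesis using True by (simp add: h0)
  next
    case False
    then show ?thesis using m_inf[of "x - t"]
      by (intro tendsto_eventually) (auto elim!: eventually_mono simp: h1)
  qed
  show thesis
  proof (rule that[of "(r + b) / 2" \<tau> \<tau>'])
    show "(r + b) / 2 < b" using pq by simp
    have S_scaled: "((\<lambda>x. S (m n * (x - t)) / m n) has_real_derivative h (m n * (x - t))) (at x)" for n x t
    proof -
      have "((\<lambda>x. S (m n * (x - t))) has_real_derivative h (m n * (x - t)) * m n) (at x)"
        by (rule DERIV_chain2[OF S_deriv]) (auto intro!: derivative_eq_intros)
      from DERIV_cdivide[OF this, of "m n"] show ?thesis using m0[of n] by simp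
    qed
    show "(\<tau> n has_real_derivative \<tau>' n x) (at x)" for n x
      unfolding \<tau>_def \<tau>'_def by (intro DERIV_diff DERIV_cdivide S_scaled)
    show "continuous_on UNIV (\<tau>' n)" for n
      unfolding \<tau>'_def using pq by (intro continuous_intros continuous_on_compose2[OF h_cont]) auto
    show "\<bar>\<tau>' n x\<bar> \<le> 1 / (q - p) + 1 / (r - q)" for n x
    proof -
      have "0 \<le> h (m n * (x - p)) - h (m n * (x - q))" "h (m n * (x - p)) - h (m n * (x - q)) \<le> 1"
        "0 \<le> h (m n * (x - q)) - h (m n * (x - r))" "h (m n * (x - q)) - h (m n * (x - r)) \<le> 1"
        using h_mono[OF arg(1)[of n x]] h_mono[OF arg(2)[of n x]] h01(2)[of "m n * (x - p)"] h01(1)[of "m n * (x - q)"]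
          h01(2)[of "m n * (x - q)"] h01(1)[of "m n * (x - r)"] by linarith+
      then have "0 \<le> (h (m n * (x - p)) - h (m n * (x - q))) / (q - p)"
        "(h (m n * (x - p)) - h (m n * (x - q))) / (q - p) \<le> 1 / (q - p)"
        "0 \<le> (h (m n * (x - q)) - h (m n * (x - r))) / (r - q)"
        "(h (m n * (x - q)) - h (m n * (x - r))) / (r - q) \<le> 1 / (r - q)"
        using pq by (auto intro!: divide_right_mono)
      then show ?thesis unfolding \<tau>'_def by linarith
    qed
    show "\<tau> n x = 0" if "x \<notin> {p..(r + b) / 2}" for n x
    proof (cases "x < p")
      case True
      then have "m n * (x - p) \<le> 0" using m0[of n] by (simp add: mult_le_0_iff)
      then have "S (m n * (x - p)) = 0" "S (m n * (x - q)) = 0" "S (m n * (x - r)) = 0"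
        using arg[of n x] by (auto intro!: h0)
      then show ?thesis unfolding \<tau>_def by simp
    next
      case False
      then have "(b - r) / 2 \<le> x - r" using that by (simp add: field_simps)
      moreover have "2 / (b - r) \<le> m n" by (simp add: m_def)
      ultimately have "2 / (b - r) * ((b - r) / 2) \<le> m n * (x - r)"
        using pq m0[of n] by (intro mult_mono) auto
      moreover have "2 / w * (w / 2) = 1" if "w > 0" for w :: real using that by simp
      from this[of "b - r"] have "2 / (b - r) * ((b - r) / 2) = 1" using pq by simp
      ultimately have "1 \<le> m n * (x - r)" by linarith
      then have "S (m n * (x - p)) = m n * (x - p) - 1 / 2" "S (m n * (x - q)) = m n * (x - q) - 1 / 2"
        "S (m n * (x - r)) = m n * (x - r) - 1 / 2"
        using arg[of n x] by (auto intro!: h1)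
      then have "S (m n * (x - p)) / m n - S (m n * (x - q)) / m n = q - p"
        "S (m n * (x - q)) / m n - S (m n * (x - r)) / m n = r - q"
        using m0[of n] by (simp_all add: field_simps)
      then show ?thesis unfolding \<tau>_def using pq by simp
    qed
    show "(\<lambda>n. \<tau>' n x) \<longlonglongrightarrow> indicator {p<..q} x / (q - p) - indicator {q<..r} x / (r - q)" for x
    proof -
      have "(\<lambda>n. \<tau>' n x) \<longlonglongrightarrow> (indicator {p<..} x - indicator {q<..} x) / (q - p)
          - (indicator {q<..} x - indicator {r<..} x) / (r - q)"
        unfolding \<tau>'_def using pq by (intro tendsto_diff tendsto_divide tendsto_const h_lim) auto
      also have "indicator {p<..} x - indicator {q<..} x = (indicator {p<..q} x :: real)"
        using pq by (auto simp: indicator_def)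
      also have "indicator {q<..} x - indicator {r<..} x = (indicator {q<..r} x :: real)"
        using pq by (auto simp: indicator_def)
      finally show ?thesis .
    qed
  qed
qed

section \<open>Primitives, weakly constant functions and Lipschitz test functions\<close>

lemma isCont_halfline_integral:
  fixes \<sigma> :: "real \<Rightarrow> 'a::euclidean_space"
  assumes N: "sets N = sets borel" and s: "integrable N \<sigma>" and ae: "AE y in N. y \<noteq> x"
  shows "isCont (\<lambda>x. \<integral>y. indicator {..x} y *\<^sub>R \<sigma> y \<partial>N) x"
  unfolding continuous_at_sequentially comp_def
proof (intro allI impI)
  fix X :: "nat \<Rightarrow> real" assume X: "X \<longlonglongrightarrow> x"
  show "(\<lambda>n. \<integral>y. indicator {..X n} y *\<^sub>R \<sigma> y \<partial>N) \<longlonglongrightarrow> (\<integral>y. indicator {..x} y *\<^sub>R \<sigma> y \<partial>N)"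
  proof (rule integral_dominated_convergence[where w = "\<lambda>y. norm (\<sigma> y)"])
    show "AE y in N. (\<lambda>n. indicator {..X n} y *\<^sub>R \<sigma> y) \<longlonglongrightarrow> indicator {..x} y *\<^sub>R \<sigma> y"
      using ae
    proof eventually_elim
      case (elim y)
      \<comment> \<open>Only \<open>y = x\<close> can keep switching sides while \<open>X n\<close>
        tends to \<open>x\<close>, and that point is null by assumption.\<close>
      have "eventually (\<lambda>n. (y \<le> X n) = (y \<le> x)) sequentially"
      proof (cases "y < x")
        case True
        then show ?thesis using order_tendstoD(1)[OF X True] by (auto elim!: eventually_mono)
      next
        case False
        then have xy: "x < y" using elim by simp
        then show ?thesis using order_tendstoD(2)[OF X xy] by (auto elim!: eventually_mono)
      qed
      then show ?case by (intro tendsto_eventually) (auto elim!: eventually_mono simp: indicator_def)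
    qed
  qed (use s N borel_measurable_integrable[OF s] in
        \<open>auto intro!: borel_measurable_scaleR borel_measurable_indicator simp: indicator_def\<close>)
qed

lemma primitive_has_vector_derivative:
  fixes z G :: "real \<Rightarrow> 'a::euclidean_space"
  assumes z: "\<And>x y. c < x \<Longrightarrow> x \<le> y \<Longrightarrow> y < d \<Longrightarrow> z y - z x = (\<integral>t. indicator {x<..y} t *\<^sub>R G t \<partial>lborel)"
    and G[measurable]: "G \<in> borel_measurable borel" and bd: "\<And>t. norm (G t) \<le> B"
    and x: "c < x" "x < d" and cont: "isCont G x"
  shows "(z has_vector_derivative G x) (at x)"
proof -
  define c' where "c' = (c + x) / 2"
  define d' where "d' = (x + d) / 2"
  have cd: "c < c'" "c' < x" "x < d'" "d' < d" using x by (auto simp: c'_def d'_def)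
  have si: "set_integrable lborel {c'..t} G" for t
    unfolding set_integrable_def
  proof (rule Bochner_Integration.integrable_bound[of _ "\<lambda>y. indicator {c'..t} y *\<^sub>R B"])
    show "integrable lborel (\<lambda>y. indicator {c'..t} y *\<^sub>R B)"
      by (intro integrable_scaleR_indicator_bounded) auto
  qed (use bd order_trans[OF norm_ge_zero bd] in \<open>auto simp: indicator_def\<close>)
  have zeq: "z c' + integral {c'..t} G = z t" if "t \<in> {c'<..<d'}" for t
  proof -
    have "z t - z c' = (\<integral>s. indicator {c'<..t} s *\<^sub>R G s \<partial>lborel)" using that cd by (intro z) auto
    also have "\<dots> = (\<integral>s. indicator {c'..t} s *\<^sub>R G s \<partial>lborel)"
      using AE_lborel_singleton[of c'] by (intro integral_cong_AE) (auto simp: indicator_def)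
    also have "\<dots> = integral {c'..t} G"
      using set_borel_integral_eq_integral(2)[OF si[of t]] by (simp add: set_lebesgue_integral_def)
    finally show ?thesis by (simp add: algebra_simps)
  qed
  have "((\<lambda>u. integral {c'..u} G) has_vector_derivative G x) (at x within {c'..d'} - {})"
    using cd cont by (intro integral_has_vector_derivative_continuous_at set_borel_integral_eq_integral si)
      (auto intro: continuous_at_imp_continuous_at_within)
  then have "((\<lambda>u. integral {c'..u} G) has_vector_derivative G x) (at x)"
    using cd by (simp add: at_within_Icc_at)
  then have "((\<lambda>u. z c' + integral {c'..u} G) has_vector_derivative G x) (at x)"
    by (auto intro!: derivative_eq_intros)
  then show ?thesis
    by (rule has_vector_derivative_transform_within_open[where S = "{c'<..<d'}"]) (use cd zeq in auto)
qed

text \<open>Tents show that adjacent intervals have equal means, so all intervals share one mean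
  \<open>C\<close>. The conclusion stays in integrated form because it is used to compute increments
  of a primitive.\<close>

lemma du_Bois_Reymond:
  fixes \<kappa> :: "real \<Rightarrow> real^'n"
  assumes cd: "c < d" and k: "integrable lborel \<kappa>"
    and test: "\<And>\<phi>. C1c {c<..<d} \<phi> \<Longrightarrow> (\<integral>x. \<kappa> x \<bullet> vector_derivative \<phi> (at x) \<partial>lborel) = 0"
  obtains C where "\<And>x y. c < x \<Longrightarrow> x \<le> y \<Longrightarrow> y < d \<Longrightarrow> (\<integral>t. indicator {x<..y} t *\<^sub>R \<kappa> t \<partial>lborel) = (y - x) *\<^sub>R C"
proof -
  have [measurable]: "\<kappa> \<in> borel_measurable borel" using k by auto
  define i where "i = (\<lambda>x y. \<integral>t. indicator {x<..y} t *\<^sub>R \<kappa> t \<partial>lborel)"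
  have int: "integrable lborel (\<lambda>t. indicator {x<..y} t *\<^sub>R \<kappa> t)" for x y
    using k by (intro integrable_mult_indicator) auto
  have i_add: "i x y + i y w = i x w" if "x \<le> y" "y \<le> w" for x y w
    unfolding i_def using that
    by (subst Bochner_Integration.integral_add[symmetric, OF int int])
       (auto intro!: Bochner_Integration.integral_cong simp: indicator_def)
  define sl where "sl = (\<lambda>x y. i x y /\<^sub>R (y - x))"
  have slope: "sl p q = sl q r" if pqr: "c < p" "p < q" "q < r" "r < d" for p q r
  proof -
    obtain \<tau> \<tau>' :: "nat \<Rightarrow> real \<Rightarrow> real" and r' :: real
      where r': "r' < d" and \<tau>: "\<And>n x. (\<tau> n has_real_derivative \<tau>' n x) (at x)"
      and \<tau>'_cont: "\<And>n. continuous_on UNIV (\<tau>' n)"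
      and \<tau>'_bd: "\<And>n x. \<bar>\<tau>' n x\<bar> \<le> 1 / (q - p) + 1 / (r - q)" and \<tau>_supp: "\<And>n x. x \<notin> {p..r'} \<Longrightarrow> \<tau> n x = 0"
      and \<tau>'_lim: "\<And>x. (\<lambda>n. \<tau>' n x) \<longlonglongrightarrow> indicator {p<..q} x / (q - p) - indicator {q<..r} x / (r - q)"
      using C1_tent[OF pqr(2-4)] by metis
    have [measurable]: "\<tau>' n \<in> borel_measurable borel" for n
      by (rule borel_measurable_continuous_onI[OF \<tau>'_cont])
    have "(sl p q - sl q r) \<bullet> e = 0" for e
    proof -
      have 0: "(\<integral>x. \<tau>' n x * (\<kappa> x \<bullet> e) \<partial>lborel) = 0" for n
      proof -
        have der: "((\<lambda>x. \<tau> n x *\<^sub>R e) has_vector_derivative \<tau>' n x *\<^sub>R e) (at x)" for x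
          using \<tau>[of n x] by (auto intro!: derivative_eq_intros)
        have "C1c {c<..<d} (\<lambda>x. \<tau> n x *\<^sub>R e)"
          by (rule C1cI[OF der, where K = "{p..r'}"]) (use \<tau>_supp \<tau>'_cont pqr r' in \<open>auto intro!: continuous_intros\<close>)
        from test[OF this] show ?thesis
          unfolding vector_derivative_at[OF der] by simp
      qed
      have "(\<lambda>n. \<integral>x. \<tau>' n x * (\<kappa> x \<bullet> e) \<partial>lborel)
        \<longlonglongrightarrow> (\<integral>x. (indicator {p<..q} x / (q - p) - indicator {q<..r} x / (r - q)) * (\<kappa> x \<bullet> e) \<partial>lborel)"
      proof (rule integral_dominated_convergence[where w = "\<lambda>x. (1 / (q - p) + 1 / (r - q)) * norm (\<kappa> x \<bullet> e)"])
        show "AE x in lborel. (\<lambda>n. \<tau>' n x * (\<kappa> x \<bullet> e))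
            \<longlonglongrightarrow> (indicator {p<..q} x / (q - p) - indicator {q<..r} x / (r - q)) * (\<kappa> x \<bullet> e)"
          using \<tau>'_lim by (intro AE_I2 tendsto_mult tendsto_const) auto
        show "AE x in lborel. norm (\<tau>' n x * (\<kappa> x \<bullet> e)) \<le> (1 / (q - p) + 1 / (r - q)) * norm (\<kappa> x \<bullet> e)" for n
          using \<tau>'_bd by (intro AE_I2) (auto simp: abs_mult intro!: mult_right_mono)
      qed (use k in auto)
      then have "(\<integral>x. (indicator {p<..q} x / (q - p) - indicator {q<..r} x / (r - q)) * (\<kappa> x \<bullet> e) \<partial>lborel) = 0"
        unfolding 0 by (simp add: LIMSEQ_const_iff)
      also have "(\<lambda>x. (indicator {p<..q} x / (q - p) - indicator {q<..r} x / (r - q)) * (\<kappa> x \<bullet> e))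
        = (\<lambda>x. ((indicator {p<..q} x *\<^sub>R \<kappa> x) /\<^sub>R (q - p) - (indicator {q<..r} x *\<^sub>R \<kappa> x) /\<^sub>R (r - q)) \<bullet> e)"
        by (auto simp: fun_eq_iff inner_diff_left left_diff_distrib right_diff_distrib divide_inverse mult_ac)
      also have "(\<integral>x. ((indicator {p<..q} x *\<^sub>R \<kappa> x) /\<^sub>R (q - p) - (indicator {q<..r} x *\<^sub>R \<kappa> x) /\<^sub>R (r - q)) \<bullet> e \<partial>lborel)
        = (sl p q - sl q r) \<bullet> e"
        unfolding sl_def i_def
        by (subst integral_inner_left, intro Bochner_Integration.integrable_diff integrable_scaleR_right int,
            subst Bochner_Integration.integral_diff, intro integrable_scaleR_right int, intro integrable_scaleR_right int,
            simp only: integral_scaleR_right)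
      finally show ?thesis .
    qed
    then have "sl p q - sl q r = 0" using inner_eq_zero_iff by blast
    then show ?thesis by simp
  qed
  have i_sl: "i x y = (y - x) *\<^sub>R sl x y" if "x < y" for x y using that by (simp add: sl_def)
  have ext: "sl p y = sl p x" if "c < p" "p < x" "x < y" "y < d" for p x y
  proof -
    have "i p y = i p x + i x y" using i_add[of p x y] that by simp
    also have "\<dots> = (x - p) *\<^sub>R sl p x + (y - x) *\<^sub>R sl p x"
      using slope[OF that] that by (simp add: i_sl)
    also have "\<dots> = (y - p) *\<^sub>R sl p x" by (simp add: scaleR_left_distrib[symmetric])
    finally show ?thesis using that by (simp add: i_sl)
  qed
  have eq: "sl x y = sl x' y'" if "c < x" "x < y" "y < d" "c < x'" "x' < y'" "y' < d" for x y x' y'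
  proof -
    \<comment> \<open>A point to the left of both intervals: each mean equals the mean over the gap
      from \<open>p\<close> to the interval, and the two gaps share their left end.\<close>
    define p where "p = (c + min x x') / 2"
    have p: "c < p" "p < x" "p < x'" using that by (auto simp: p_def)
    have "sl x y = sl p x" "sl x' y' = sl p x'" using slope[of p x y] slope[of p x' y'] p that by auto
    moreover have "sl p x = sl p x'"
      using ext[of p x x'] ext[of p x' x] p that by (cases x x' rule: linorder_cases) auto
    ultimately show ?thesis by simp
  qed
  define C where "C = sl ((2 * c + d) / 3) ((c + 2 * d) / 3)"
  have "i x y = (y - x) *\<^sub>R C" if "c < x" "x \<le> y" "y < d" for x y
  proof (cases "x = y")
    case True
    then show ?thesis by (simp add: i_def)
  next
    case False
    then have "sl x y = C" unfolding C_def using that cd by (intro eq) auto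
    then show ?thesis using i_sl[of x y] False that by simp
  qed
  then show thesis unfolding i_def by (rule that)
qed

text \<open>The counterpart of \<open>C1c_integral_tail\<close> for products with
  \<open>dual\<close>, whose derivative may jump at atoms. The Lipschitz constant dominates the
  difference quotients, and their integral over \<open>{y..}\<close> is minus the mean of
  \<open>\<Phi>\<close> over a short interval to the right of \<open>y\<close>.\<close>

lemma integral_tail_of_lipschitz_derivative:
  fixes \<Phi> \<psi> :: "real \<Rightarrow> 'a::euclidean_space"
  assumes pq: "c < p" "q < d" and supp: "\<And>x. x \<notin> {p..q} \<Longrightarrow> \<Phi> x = 0"
    and cont: "continuous_on UNIV \<Phi>"
    and lip: "\<And>x y. x \<in> {c<..<d} \<Longrightarrow> y \<in> {c<..<d} \<Longrightarrow> norm (\<Phi> x - \<Phi> y) \<le> L * \<bar>x - y\<bar>"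
    and S: "countable S" and der: "\<And>x. x \<notin> S \<Longrightarrow> (\<Phi> has_vector_derivative \<psi> x) (at x)"
    and \<psi>[measurable]: "\<psi> \<in> borel_measurable borel"
  shows "integrable lborel \<psi>" "(\<integral>x. indicator {y..} x *\<^sub>R \<psi> x \<partial>lborel) = - \<Phi> y"
proof -
  have [measurable]: "\<Phi> \<in> borel_measurable borel" by (rule borel_measurable_continuous_onI[OF cont])
  obtain B where B: "\<And>x. norm (\<Phi> x) \<le> B"
  proof -
    have "bounded (\<Phi> ` {p..q})"
      by (intro compact_imp_bounded compact_continuous_image continuous_on_subset[OF cont]) auto
    then obtain B where "\<And>x. x \<in> {p..q} \<Longrightarrow> norm (\<Phi> x) \<le> B" unfolding bounded_iff by blast
    then have "norm (\<Phi> x) \<le> max B 0" for x using supp[of x] by (cases "x \<in> {p..q}") force+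
    then show ?thesis by (rule that)
  qed
  have B0: "0 \<le> B" using B[of 0] norm_ge_zero order_trans by blast
  \<comment> \<open>The Lipschitz bound holds only inside \<open>{c<..<d}\<close>. Steps of at most
    \<open>\<delta>\<close> keep both \<open>x\<close> and \<open>x + h n\<close> there whenever the
    difference quotient can be nonzero.\<close>
  define \<delta> where "\<delta> = min (p - c) (d - q) / 2"
  have \<delta>: "0 < \<delta>" "\<delta> < p - c" "\<delta> < d - q" using pq by (auto simp: \<delta>_def min_def)
  define h where "h = (\<lambda>n. \<delta> / real (Suc n))"
  have h: "0 < h n" "h n \<le> \<delta>" for n using \<delta>(1) by (auto simp: h_def field_simps)
  have h_lim: "h \<longlonglongrightarrow> 0" unfolding h_def
    using tendsto_mult[OF tendsto_const[of \<delta>] lim_1_over_n[THEN LIMSEQ_Suc]] by (simp add: divide_inverse)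
  define Q where "Q = (\<lambda>n x. (\<Phi> (x + h n) - \<Phi> x) /\<^sub>R h n)"
  have Q_bd: "norm (Q n x) \<le> indicator {c..d} x * \<bar>L\<bar>" for n x
  proof (cases "x \<in> {p - h n..q}")
    case True
    have "x \<in> {c<..<d}" "x + h n \<in> {c<..<d}" using True h[of n] \<delta> by auto
    then have "norm (\<Phi> (x + h n) - \<Phi> x) \<le> L * h n" using lip[of "x + h n" x] h(1)[of n] by simp
    also have "\<dots> \<le> \<bar>L\<bar> * h n" using h(1)[of n] by (intro mult_right_mono) auto
    finally have "norm (Q n x) \<le> \<bar>L\<bar>"
      using h(1)[of n] unfolding Q_def by (simp add: pos_divide_le_eq[symmetric] divide_inverse mult.commute)
    then show ?thesis using \<open>x \<in> {c<..<d}\<close> by (simp add: indicator_def)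
  next
    case False
    then have "x \<notin> {p..q}" "x + h n \<notin> {p..q}" using h(1)[of n] by auto
    then show ?thesis by (simp add: Q_def supp)
  qed
  have Q_lim: "(\<lambda>n. Q n x) \<longlonglongrightarrow> \<psi> x" if "x \<notin> S" for x
  proof -
    have "((\<lambda>k. norm (\<Phi> (x + k) - \<Phi> x - k *\<^sub>R \<psi> x) / norm k) \<longlongrightarrow> 0) (at 0)"
      using der[OF that] unfolding has_vector_derivative_def has_derivative_at by auto
    moreover have "filterlim h (at 0) sequentially"
      using h_lim h(1) by (auto simp: filterlim_at intro!: always_eventually) (metis less_irrefl)
    ultimately have "(\<lambda>n. norm (\<Phi> (x + h n) - \<Phi> x - h n *\<^sub>R \<psi> x) / norm (h n)) \<longlonglongrightarrow> 0"
      by (rule filterlim_compose)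
    moreover have "norm (\<Phi> (x + h n) - \<Phi> x - h n *\<^sub>R \<psi> x) / norm (h n) = norm (Q n x - \<psi> x)" for n
    proof -
      have "Q n x - \<psi> x = (\<Phi> (x + h n) - \<Phi> x - h n *\<^sub>R \<psi> x) /\<^sub>R h n"
        using h(1)[of n] unfolding Q_def by (simp add: scaleR_diff_right)
      then show ?thesis using h(1)[of n] by (simp add: divide_inverse mult.commute)
    qed
    ultimately have "(\<lambda>n. norm (Q n x - \<psi> x)) \<longlonglongrightarrow> 0" by simp
    then show ?thesis by (simp add: tendsto_norm_zero_iff LIM_zero_iff)
  qed
  have "S \<in> null_sets lborel" using countable_imp_null_set_lborel[OF S] .
  then have aeS: "AE x in lborel. x \<notin> S" by (rule AE_not_in)
  have [measurable]: "Q n \<in> borel_measurable borel" for n unfolding Q_def by measurable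
  have w: "integrable lborel (\<lambda>x. indicator {c..d} x * \<bar>L\<bar>)"
    using integrable_scaleR_indicator_bounded[of "{c..d}" "\<bar>L\<bar>"] by simp
  have lim_AE: "AE x in lborel. (\<lambda>n. Q n x) \<longlonglongrightarrow> \<psi> x" using aeS Q_lim by auto
  show "integrable lborel \<psi>"
    by (rule integrable_dominated_convergence[OF _ _ w lim_AE]) (use Q_bd in auto)
  have "(\<lambda>n. \<integral>x. indicator {y..} x *\<^sub>R Q n x \<partial>lborel) \<longlonglongrightarrow> (\<integral>x. indicator {y..} x *\<^sub>R \<psi> x \<partial>lborel)"
  proof (rule integral_dominated_convergence[OF _ _ w])
    show "AE x in lborel. (\<lambda>n. indicator {y..} x *\<^sub>R Q n x) \<longlonglongrightarrow> indicator {y..} x *\<^sub>R \<psi> x"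
      using lim_AE by eventually_elim (intro tendsto_intros)
    show "AE x in lborel. norm (indicator {y..} x *\<^sub>R Q n x) \<le> indicator {c..d} x * \<bar>L\<bar>" for n
      by (rule AE_I2, rule order_trans[OF _ Q_bd]) (auto simp: indicator_def)
  qed auto
  \<comment> \<open>After a translation the two half-line integrals differ only on
    \<open>{y..<y + h n}\<close>; rescaling this interval to \<open>{0..<1}\<close> cancels the
    division by \<open>h n\<close>.\<close>
  moreover have "(\<integral>x. indicator {y..} x *\<^sub>R Q n x \<partial>lborel) = - (\<integral>t. indicator {0..<1} t *\<^sub>R \<Phi> (y + h n * t) \<partial>lborel)" for n
  proof -
    have \<Phi>_int: "integrable lborel (\<lambda>x. indicator X x *\<^sub>R \<Phi> x)" if [measurable]: "X \<in> sets borel" for X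
    proof (rule Bochner_Integration.integrable_bound[of _ "\<lambda>x. indicator {p..q} x *\<^sub>R B"])
      show "integrable lborel (\<lambda>x. indicator {p..q} x *\<^sub>R B)"
        by (intro integrable_scaleR_indicator_bounded) auto
    qed (use B B0 supp in \<open>auto simp: indicator_def\<close>)
    have shift: "indicator {y..} x *\<^sub>R \<Phi> (x + h n) = indicator {y + h n..} (h n + 1 * x) *\<^sub>R \<Phi> (h n + 1 * x)" for x
      by (auto simp: indicator_def add.commute)
    have int_shift: "integrable lborel (\<lambda>x. indicator {y..} x *\<^sub>R \<Phi> (x + h n))"
      unfolding shift using lborel_integrable_real_affine[OF \<Phi>_int[of "{y + h n..}"], of 1 "h n"] by simp
    have val_shift: "(\<integral>x. indicator {y..} x *\<^sub>R \<Phi> (x + h n) \<partial>lborel) = (\<integral>x. indicator {y + h n..} x *\<^sub>R \<Phi> x \<partial>lborel)"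
      unfolding shift using lborel_integral_real_affine[of 1 "\<lambda>x. indicator {y + h n..} x *\<^sub>R \<Phi> x" "h n"] by simp
    have "(\<integral>x. indicator {y..} x *\<^sub>R Q n x \<partial>lborel)
       = (\<integral>x. (indicator {y..} x *\<^sub>R \<Phi> (x + h n) - indicator {y..} x *\<^sub>R \<Phi> x) /\<^sub>R h n \<partial>lborel)"
      unfolding Q_def by (rule Bochner_Integration.integral_cong) (auto simp: indicator_def)
    also have "\<dots> = ((\<integral>x. indicator {y + h n..} x *\<^sub>R \<Phi> x \<partial>lborel) - (\<integral>x. indicator {y..} x *\<^sub>R \<Phi> x \<partial>lborel)) /\<^sub>R h n"
      by (simp add: Bochner_Integration.integral_diff[OF int_shift \<Phi>_int] val_shift)
    also have "(\<integral>x. indicator {y + h n..} x *\<^sub>R \<Phi> x \<partial>lborel) - (\<integral>x. indicator {y..} x *\<^sub>R \<Phi> x \<partial>lborel)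
        = (\<integral>x. - (indicator {y..<y + h n} x *\<^sub>R \<Phi> x) \<partial>lborel)"
      using h(1)[of n]
      by (subst Bochner_Integration.integral_diff[symmetric, OF \<Phi>_int \<Phi>_int], simp, simp,
          intro Bochner_Integration.integral_cong refl) (auto simp: indicator_def)
    also have "\<dots> = - (\<integral>x. indicator {y..<y + h n} x *\<^sub>R \<Phi> x \<partial>lborel)" by simp
    also have "(\<integral>x. indicator {y..<y + h n} x *\<^sub>R \<Phi> x \<partial>lborel)
        = h n *\<^sub>R (\<integral>t. indicator {y..<y + h n} (y + h n * t) *\<^sub>R \<Phi> (y + h n * t) \<partial>lborel)"
      using lborel_integral_real_affine[of "h n" "\<lambda>x. indicator {y..<y + h n} x *\<^sub>R \<Phi> x" y] h(1)[of n] by simp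
    also have "(\<lambda>t. indicator {y..<y + h n} (y + h n * t) *\<^sub>R \<Phi> (y + h n * t))
        = (\<lambda>t. indicator {0..<1} t *\<^sub>R \<Phi> (y + h n * t))"
      using h(1)[of n] by (auto simp: fun_eq_iff indicator_def zero_le_mult_iff)
    finally show ?thesis using h(1)[of n] by simp
  qed
  moreover have "(\<lambda>n. \<integral>t. indicator {0..<1} t *\<^sub>R \<Phi> (y + h n * t) \<partial>lborel)
      \<longlonglongrightarrow> (\<integral>t. indicator {0..<1::real} t *\<^sub>R \<Phi> y \<partial>lborel)"
  proof (rule integral_dominated_convergence[where w = "\<lambda>t. indicator {0..<1} t *\<^sub>R B"])
    have "(\<lambda>n. \<Phi> (y + h n * t)) \<longlonglongrightarrow> \<Phi> (y + 0 * t)" for t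
      using cont by (intro isCont_tendsto_compose[of _ \<Phi>] tendsto_intros h_lim) (auto simp: continuous_on_eq_continuous_at)
    then show "AE t in lborel. (\<lambda>n. indicator {0..<1} t *\<^sub>R \<Phi> (y + h n * t)) \<longlonglongrightarrow> indicator {0..<1} t *\<^sub>R \<Phi> y"
      by (intro AE_I2 tendsto_scaleR tendsto_const) auto
    show "integrable lborel (\<lambda>t. indicator {0..<1::real} t *\<^sub>R B)"
      by (rule integrable_scaleR_indicator_bounded) (auto simp: bounded_Ico)
  qed (use B in \<open>auto simp: indicator_def\<close>)
  moreover have "(\<integral>t. indicator {0..<1::real} t *\<^sub>R \<Phi> y \<partial>lborel) = \<Phi> y" by simp
  ultimately have "(\<lambda>n. - (\<integral>t. indicator {0..<1} t *\<^sub>R \<Phi> (y + h n * t) \<partial>lborel)) \<longlonglongrightarrow> (\<integral>x. indicator {y..} x *\<^sub>R \<psi> x \<partial>lborel)"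
    and "(\<lambda>n. - (\<integral>t. indicator {0..<1} t *\<^sub>R \<Phi> (y + h n * t) \<partial>lborel)) \<longlonglongrightarrow> - \<Phi> y"
    by (simp_all only: tendsto_minus)
  then show "(\<integral>x. indicator {y..} x *\<^sub>R \<psi> x \<partial>lborel) = - \<Phi> y"
    by (rule LIMSEQ_unique)
qed

section \<open>The dual field of a minimizer\<close>

lemma L2_integrable:
  assumes "L2 {a<..<b} w"
  shows "integrable lborel (\<lambda>x. indicator {a<..<b} x *\<^sub>R w x)"
proof -
  have m[measurable]: "(\<lambda>x. indicator {a<..<b} x *\<^sub>R w x) \<in> borel_measurable borel"
    and i: "integrable lborel (\<lambda>x. indicator {a<..<b} x *\<^sub>R (norm (w x))\<^sup>2)"
    using assms unfolding L2_def set_borel_measurable_def set_integrable_def by auto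
  show ?thesis
  proof (rule Bochner_Integration.integrable_bound[of _ "\<lambda>x. indicator {a<..<b} x + indicator {a<..<b} x *\<^sub>R (norm (w x))\<^sup>2"])
    show "integrable lborel (\<lambda>x. indicator {a<..<b} x + indicator {a<..<b} x *\<^sub>R (norm (w x))\<^sup>2)"
      using integrable_scaleR_indicator_bounded[of "{a<..<b}" "1::real"] by (intro Bochner_Integration.integrable_add i) auto
    have "norm (w x) \<le> 1 + (norm (w x))\<^sup>2" for x
    proof -
      have "2 * norm (w x) \<le> 1 + (norm (w x))\<^sup>2" using sum_squares_bound[of 1 "norm (w x)"] by simp
      then show ?thesis using norm_ge_zero[of "w x"] by linarith
    qed
    then show "AE x in lborel. norm (indicator {a<..<b} x *\<^sub>R w x) \<le> norm (indicator {a<..<b} x + indicator {a<..<b} x *\<^sub>R (norm (w x))\<^sup>2)"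
      by (auto simp: indicator_def)
  qed (use m in auto)
qed

lemma set_integrable_L2_inner:
  fixes w v :: "real \<Rightarrow> real^'n"
  assumes "L2 \<Omega> w" "L2 \<Omega> v"
  shows "set_integrable lborel \<Omega> (\<lambda>x. w x \<bullet> v x)"
  unfolding set_integrable_def
proof (rule Bochner_Integration.integrable_bound)
  show "integrable lborel (\<lambda>x. indicator \<Omega> x *\<^sub>R (norm (w x))\<^sup>2 + indicator \<Omega> x *\<^sub>R (norm (v x))\<^sup>2)"
    using assms unfolding L2_def set_integrable_def by (intro Bochner_Integration.integrable_add) auto
  have [measurable]: "(\<lambda>x. indicator \<Omega> x *\<^sub>R w x) \<in> borel_measurable borel" "(\<lambda>x. indicator \<Omega> x *\<^sub>R v x) \<in> borel_measurable borel"
    using assms unfolding L2_def set_borel_measurable_def by auto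
  have "(\<lambda>x. (indicator \<Omega> x *\<^sub>R w x) \<bullet> (indicator \<Omega> x *\<^sub>R v x)) \<in> borel_measurable borel" by measurable
  also have "(\<lambda>x. (indicator \<Omega> x *\<^sub>R w x) \<bullet> (indicator \<Omega> x *\<^sub>R v x)) = (\<lambda>x. indicator \<Omega> x *\<^sub>R (w x \<bullet> v x))"
    by (auto simp: indicator_def fun_eq_iff)
  finally show "(\<lambda>x. indicator \<Omega> x *\<^sub>R (w x \<bullet> v x)) \<in> borel_measurable lborel" by simp
  have "\<bar>w x \<bullet> v x\<bar> \<le> (norm (w x))\<^sup>2 + (norm (v x))\<^sup>2" for x
  proof -
    have "\<bar>w x \<bullet> v x\<bar> \<le> norm (w x) * norm (v x)" by (rule Cauchy_Schwarz_ineq2)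
    also have "\<dots> \<le> (norm (w x))\<^sup>2 + (norm (v x))\<^sup>2"
    proof -
      have "0 \<le> norm (w x) * norm (v x)" by simp
      moreover have "2 * (norm (w x) * norm (v x)) \<le> (norm (w x))\<^sup>2 + (norm (v x))\<^sup>2"
        using sum_squares_bound[of "norm (w x)" "norm (v x)"] by (simp add: mult.assoc)
      ultimately show ?thesis by linarith
    qed
    finally show ?thesis .
  qed
  then show "AE x in lborel. norm (indicator \<Omega> x *\<^sub>R (w x \<bullet> v x)) \<le> norm (indicator \<Omega> x *\<^sub>R (norm (w x))\<^sup>2 + indicator \<Omega> x *\<^sub>R (norm (v x))\<^sup>2)"
    by (auto simp: indicator_def)
qed

lemma L2_iff_inner:
  "L2 \<Omega> w \<longleftrightarrow> set_borel_measurable lborel \<Omega> w \<and> set_integrable lborel \<Omega> (\<lambda>x. w x \<bullet> w x)"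
  by (simp add: L2_def power2_norm_eq_inner)

lemma L2_scaleR:
  fixes w :: "real \<Rightarrow> real^'n"
  assumes "L2 \<Omega> w"
  shows "L2 \<Omega> (\<lambda>x. t *\<^sub>R w x)"
proof -
  have 1: "(\<lambda>x. indicator \<Omega> x *\<^sub>R w x) \<in> borel_measurable lborel"
    and 2: "integrable lborel (\<lambda>x. indicator \<Omega> x *\<^sub>R (w x \<bullet> w x))"
    using assms unfolding L2_iff_inner set_borel_measurable_def set_integrable_def by auto
  have "(\<lambda>x. t *\<^sub>R (indicator \<Omega> x *\<^sub>R w x)) \<in> borel_measurable lborel"
    by (rule borel_measurable_scaleR[OF borel_measurable_const 1])
  moreover have "integrable lborel (\<lambda>x. (t * t) *\<^sub>R (indicator \<Omega> x *\<^sub>R (w x \<bullet> w x)))"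
    by (rule integrable_scaleR_right[OF 2])
  ultimately show ?thesis
    unfolding L2_iff_inner set_borel_measurable_def set_integrable_def by (simp add: mult_ac)
qed

lemma L2_add:
  fixes w v :: "real \<Rightarrow> real^'n"
  assumes "L2 \<Omega> w" "L2 \<Omega> v"
  shows "L2 \<Omega> (\<lambda>x. w x + v x)"
  unfolding L2_iff_inner
proof
  show "set_borel_measurable lborel \<Omega> (\<lambda>x. w x + v x)"
    using assms unfolding L2_def set_borel_measurable_def by (auto simp: scaleR_add_right intro!: borel_measurable_add)
  have "set_integrable lborel \<Omega> (\<lambda>x. (w x \<bullet> w x + w x \<bullet> v x) + (v x \<bullet> w x + v x \<bullet> v x))"
    using assms by (intro set_integral_add set_integrable_L2_inner)
  then show "set_integrable lborel \<Omega> (\<lambda>x. (w x + v x) \<bullet> (w x + v x))"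
    by (simp add: inner_add_left inner_add_right add_ac)
qed

lemma L2_diff:
  fixes w v :: "real \<Rightarrow> real^'n"
  assumes "L2 \<Omega> w" "L2 \<Omega> v"
  shows "L2 \<Omega> (\<lambda>x. w x - v x)"
  using L2_add[OF assms(1) L2_scaleR[OF assms(2), of "-1"]] by simp

lemma L2_bounded:
  fixes v :: "real \<Rightarrow> real^'n"
  assumes [measurable]: "v \<in> borel_measurable borel" and bd: "\<And>x. norm (v x) \<le> B"
  shows "L2 {a<..<b} v"
  unfolding L2_def set_borel_measurable_def set_integrable_def
proof
  show "integrable lborel (\<lambda>x. indicator {a<..<b} x *\<^sub>R (norm (v x))\<^sup>2)"
  proof (rule Bochner_Integration.integrable_bound[of _ "\<lambda>x. indicator {a<..<b} x *\<^sub>R B\<^sup>2"])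
    show "integrable lborel (\<lambda>x. indicator {a<..<b} x *\<^sub>R B\<^sup>2)"
      by (intro integrable_scaleR_indicator_bounded) auto
  qed (use bd in \<open>auto simp: indicator_def intro!: power_mono\<close>)
qed measurable

lemma C1c_derivative_eq_0:
  assumes "C1c \<Omega> \<phi>" "x \<notin> \<Omega>"
  shows "vector_derivative \<phi> (at x) = 0"
proof -
  obtain K where "K \<subseteq> \<Omega>" "\<And>x. x \<notin> K \<Longrightarrow> vector_derivative \<phi> (at x) = 0"
    using C1c_support[OF assms(1)] by metis
  then show ?thesis using assms(2) by blast
qed

lemma C1c_L2:
  assumes "C1c \<Omega> \<phi>"
  shows "L2 {a<..<b} (\<lambda>x. vector_derivative \<phi> (at x))"
proof -
  obtain B where "\<And>x. norm (vector_derivative \<phi> (at x)) \<le> B" using C1c_derivative_bounded[OF assms] by metis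
  then show ?thesis
    by (intro L2_bounded borel_measurable_continuous_onI C1c_continuous_derivative[OF assms])
qed

lemma set_integral_C1c:
  assumes "C1c \<Omega> \<phi>"
  shows "(LINT x:\<Omega>|lborel. v x \<bullet> vector_derivative \<phi> (at x)) = (\<integral>x. v x \<bullet> vector_derivative \<phi> (at x) \<partial>lborel)"
  unfolding set_lebesgue_integral_def
  by (rule Bochner_Integration.integral_cong) (auto simp: indicator_def C1c_derivative_eq_0[OF assms])

lemma integrable_inner_bounded:
  fixes \<sigma> v :: "'b \<Rightarrow> 'a::euclidean_space"
  assumes s: "integrable N \<sigma>" and [measurable]: "v \<in> borel_measurable N" and v: "\<And>x. norm (v x) \<le> B"
  shows "integrable N (\<lambda>x. \<sigma> x \<bullet> v x)"
proof (rule Bochner_Integration.integrable_bound[of _ "\<lambda>x. norm (\<sigma> x) * B"])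
  show "integrable N (\<lambda>x. norm (\<sigma> x) * B)" using s by auto
  have [measurable]: "\<sigma> \<in> borel_measurable N" using s by auto
  show "(\<lambda>x. \<sigma> x \<bullet> v x) \<in> borel_measurable N" by measurable
  have B: "0 \<le> B" using order_trans[OF norm_ge_zero v] .
  have "\<bar>\<sigma> x \<bullet> v x\<bar> \<le> norm (\<sigma> x) * B" for x
    using Cauchy_Schwarz_ineq2[of "\<sigma> x" "v x"] mult_left_mono[OF v[of x], of "norm (\<sigma> x)"] by simp
  then show "AE x in N. norm (\<sigma> x \<bullet> v x) \<le> norm (norm (\<sigma> x) * B)"
    using B by (intro AE_I2) (auto simp: abs_mult)
qed

lemma AE_le_if_integral_le:
  fixes k l :: "'a \<Rightarrow> real"
  assumes k: "integrable N k" and l: "integrable N l"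
    and le: "\<And>B. B \<in> sets N \<Longrightarrow> (\<integral>x. indicator B x *\<^sub>R k x \<partial>N) \<le> (\<integral>x. indicator B x *\<^sub>R l x \<partial>N)"
  shows "AE x in N. k x \<le> l x"
proof -
  have [measurable]: "k \<in> borel_measurable N" "l \<in> borel_measurable N" using k l by auto
  define B where "B = {x \<in> space N. l x < k x}"
  have B[measurable]: "B \<in> sets N" unfolding B_def by measurable
  have i: "integrable N (\<lambda>x. indicator B x *\<^sub>R (k x - l x))"
    using k l by (intro integrable_mult_indicator B Bochner_Integration.integrable_diff)
  have nn: "AE x in N. 0 \<le> indicator B x *\<^sub>R (k x - l x)" by (auto simp: indicator_def B_def)
  have "(\<integral>x. indicator B x *\<^sub>R (k x - l x) \<partial>N) = (\<integral>x. indicator B x *\<^sub>R k x \<partial>N) - (\<integral>x. indicator B x *\<^sub>R l x \<partial>N)"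
    unfolding scaleR_diff_right using k l by (intro Bochner_Integration.integral_diff integrable_mult_indicator B)
  also have "\<dots> \<le> 0" using le[OF B] by simp
  finally have "(\<integral>x. indicator B x *\<^sub>R (k x - l x) \<partial>N) = 0" using integral_nonneg_AE[OF nn] by simp
  then have "AE x in N. indicator B x *\<^sub>R (k x - l x) = 0"
    using integral_nonneg_eq_0_iff_AE[OF i nn] by simp
  then show ?thesis
    using AE_space by eventually_elim (auto simp: indicator_def B_def split: if_splits)
qed

section \<open>Comparison inequalities for the minimizer\<close>

locale rof_minimizer =
  fixes a b lam :: real and f u :: "real \<Rightarrow> real^'n"
  assumes lam: "lam > 0" and L2_f: "L2 {a<..<b} f" and L2_u: "L2 {a<..<b} u"
    and minimal: "\<And>w. L2 {a<..<b} w \<Longrightarrow> energy {a<..<b} lam f u \<le> energy {a<..<b} lam f w"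
begin

text \<open>The zero function is a competitor of finite energy, which excludes the value infinity;
  the test function 0 bounds the supremum below by 0.\<close>

lemma TV_u_finite:
  obtains T where "TV {a<..<b} u = ereal T"
proof -
  have 0: "TV {a<..<b} (\<lambda>x. 0 :: real^'n) = 0"
  proof -
    have "C1c {a<..<b} (\<lambda>x. 0 :: real^'n)" by (rule C1cI[where D = "\<lambda>x. 0" and K = "{}"]) auto
    then have ne: "{\<phi> :: real \<Rightarrow> real^'n. C1c {a<..<b} \<phi> \<and> (\<forall>x. norm (\<phi> x) \<le> 1)} \<noteq> {}" by fastforce
    show ?thesis unfolding TV_def using SUP_const[OF ne, of "0::ereal"]
      by (simp add: set_lebesgue_integral_def zero_ereal_def[symmetric])
  qed
  have "L2 {a<..<b} (\<lambda>x. 0 :: real^'n)" by (rule L2_bounded[where B = 0]) auto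
  from minimal[OF this] have "TV {a<..<b} u \<noteq> \<infinity>"
    unfolding energy_def 0 by auto
  moreover have "0 \<le> TV {a<..<b} u"
  proof -
    have "C1c {a<..<b} (\<lambda>x. 0 :: real^'n)" by (rule C1cI[where D = "\<lambda>x. 0" and K = "{}"]) auto
    then have "ereal (LINT x:{a<..<b}|lborel. u x \<bullet> vector_derivative (\<lambda>x. 0) (at x)) \<le> TV {a<..<b} u"
      unfolding TV_def by (intro SUP_upper) auto
    then show ?thesis by (simp add: set_lebesgue_integral_def zero_ereal_def[symmetric])
  qed
  ultimately show ?thesis using that by (cases "TV {a<..<b} u") auto
qed

text \<open>The indicator makes half-line integrals start at \<open>a\<close> and stop at
  \<open>b\<close>. Thus \<open>dual\<close>, the field \<open>z\<close> of the overview, lives on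
  the whole line and is constant on either side of the interval.\<close>

definition dual_deriv :: "real \<Rightarrow> real^'n" where
  "dual_deriv x = indicator {a<..<b} x *\<^sub>R ((u x - f x) /\<^sub>R lam)"

definition dual :: "real \<Rightarrow> real^'n" where
  "dual x = (\<integral>y. indicator {..x} y *\<^sub>R dual_deriv y \<partial>lborel)"

lemma integrable_dual_deriv: "integrable lborel dual_deriv"
proof -
  have "integrable lborel (\<lambda>x. (indicator {a<..<b} x *\<^sub>R (u x - f x)) /\<^sub>R lam)"
    by (intro integrable_scaleR_right L2_integrable L2_diff L2_u L2_f)
  then show ?thesis unfolding dual_deriv_def by (simp add: mult.commute[of _ "inverse lam"])
qed

text \<open>The hypothesis bounds the total variation of \<open>u + v\<close> by
  \<open>T + C\<close>. By convexity, moving a fraction \<open>t\<close> of the way costs at most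
  \<open>t * C\<close>, while the fidelity changes to first order by \<open>t\<close> times the
  integral of \<open>v x \<bullet> dual_deriv x\<close>; minimality, division by \<open>t\<close>
  and small \<open>t\<close> give the claim.\<close>

lemma first_variation:
  assumes T: "TV {a<..<b} u = ereal T" and v: "L2 {a<..<b} v"
    and le: "\<And>\<phi>. C1c {a<..<b} \<phi> \<Longrightarrow> (\<And>x. norm (\<phi> x) \<le> 1) \<Longrightarrow>
      (LINT x:{a<..<b}|lborel. (u x + v x) \<bullet> vector_derivative \<phi> (at x)) \<le> T + C"
  shows "- (\<integral>x. v x \<bullet> dual_deriv x \<partial>lborel) \<le> C"
proof -
  let ?I = "{a<..<b}"
  define V where "V = (LINT x:?I|lborel. v x \<bullet> v x)"
  define P where "P = (LINT x:?I|lborel. (u x - f x) \<bullet> v x)"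
  define q where "q = (LINT x:?I|lborel. (u x - f x) \<bullet> (u x - f x))"
  have V0: "0 \<le> V" unfolding V_def set_lebesgue_integral_def by (rule integral_nonneg_AE) auto
  note ints = set_integrable_L2_inner[OF L2_diff[OF L2_u L2_f] L2_diff[OF L2_u L2_f]]
    set_integrable_L2_inner[OF L2_diff[OF L2_u L2_f] v] set_integrable_L2_inner[OF v v]
  have main: "0 \<le> C + P / lam + t * V / (2 * lam)" if t: "0 < t" "t \<le> 1" for t
  proof -
    let ?w = "\<lambda>x. u x + t *\<^sub>R v x"
    have w: "L2 ?I ?w" by (intro L2_add L2_u L2_scaleR v)
    have TVw: "TV ?I ?w \<le> ereal (T + t * C)"
      unfolding TV_def
    proof (rule SUP_least, simp, elim conjE)
      fix \<phi> :: "real \<Rightarrow> real^'n" assume \<phi>: "C1c ?I \<phi>" "\<forall>x. norm (\<phi> x) \<le> 1"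
      let ?D = "\<lambda>x. vector_derivative \<phi> (at x)"
      have iu: "set_integrable lborel ?I (\<lambda>x. u x \<bullet> ?D x)" and iv: "set_integrable lborel ?I (\<lambda>x. (u x + v x) \<bullet> ?D x)"
        by (intro set_integrable_L2_inner L2_u L2_add v C1c_L2[OF \<phi>(1)])+
      have "ereal (LINT x:?I|lborel. u x \<bullet> ?D x) \<le> TV ?I u"
        unfolding TV_def using \<phi> by (intro SUP_upper) auto
      then have u_le: "(LINT x:?I|lborel. u x \<bullet> ?D x) \<le> T" by (simp add: T)
      have "(LINT x:?I|lborel. ?w x \<bullet> ?D x) = (LINT x:?I|lborel. (1 - t) * (u x \<bullet> ?D x) + t * ((u x + v x) \<bullet> ?D x))"
        by (simp add: inner_simps algebra_simps)
      also have "\<dots> = (1 - t) * (LINT x:?I|lborel. u x \<bullet> ?D x) + t * (LINT x:?I|lborel. (u x + v x) \<bullet> ?D x)"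
        by (simp add: set_integral_add(2) iu iv)
      also have "\<dots> \<le> (1 - t) * T + t * (T + C)"
        using t u_le le[OF \<phi>(1)] \<phi>(2) by (intro add_mono mult_left_mono) auto
      also have "\<dots> = T + t * C" by (simp add: algebra_simps)
      finally show "(LINT x:?I|lborel. ?w x \<bullet> ?D x) \<le> T + t * C" .
    qed
    have qw: "(LINT x:?I|lborel. (norm (?w x - f x))\<^sup>2) = q + 2 * t * P + t\<^sup>2 * V"
    proof -
      have "(LINT x:?I|lborel. (norm (?w x - f x))\<^sup>2)
         = (LINT x:?I|lborel. ((u x - f x) \<bullet> (u x - f x) + 2 * t * ((u x - f x) \<bullet> v x)) + t\<^sup>2 * (v x \<bullet> v x))"
      proof (rule arg_cong[where f = "\<lambda>h. set_lebesgue_integral lborel ?I h"], rule ext)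
        fix x
        have "(norm (?w x - f x))\<^sup>2 = ((u x - f x) + t *\<^sub>R v x) \<bullet> ((u x - f x) + t *\<^sub>R v x)"
          by (simp add: power2_norm_eq_inner add_diff_eq add.commute)
        also have "\<dots> = ((u x - f x) \<bullet> (u x - f x) + 2 * t * ((u x - f x) \<bullet> v x)) + t\<^sup>2 * (v x \<bullet> v x)"
          using inner_commute[of "v x" "u x - f x"]
          by (simp only: inner_add_left inner_add_right inner_scaleR_left inner_scaleR_right power2_eq_square)
            (simp add: algebra_simps)
        finally show "(norm (?w x - f x))\<^sup>2 = ((u x - f x) \<bullet> (u x - f x) + 2 * t * ((u x - f x) \<bullet> v x)) + t\<^sup>2 * (v x \<bullet> v x)" .
      qed
      also have "\<dots> = q + 2 * t * P + t\<^sup>2 * V"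
        unfolding q_def P_def V_def using ints by (simp add: set_integral_add)
      finally show ?thesis .
    qed
    have qu: "(LINT x:?I|lborel. (norm (u x - f x))\<^sup>2) = q" by (simp add: q_def power2_norm_eq_inner)
    have "ereal (T + 1 / (2 * lam) * q) = energy ?I lam f u" by (simp add: energy_def T qu)
    also have "\<dots> \<le> energy ?I lam f ?w" by (rule minimal[OF w])
    also have "\<dots> \<le> ereal (T + t * C) + ereal (1 / (2 * lam) * (q + 2 * t * P + t\<^sup>2 * V))"
      unfolding energy_def qw by (rule add_right_mono[OF TVw])
    finally have "0 \<le> t * C + 1 / (2 * lam) * (2 * t * P + t\<^sup>2 * V)" by (simp add: algebra_simps)
    also have "\<dots> = t * (C + P / lam + t * V / (2 * lam))" using lam by (simp add: field_simps power2_eq_square)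
    finally show ?thesis using t by (simp add: zero_le_mult_iff)
  qed
  have "- (P / lam) \<le> C + e" if "e > 0" for e
  proof -
    \<comment> \<open>At most 1, to stay on the segment from \<open>u\<close> to
      \<open>u + v\<close>, and small enough that the second-order term is at most \<open>e\<close>;
      \<open>V + 1\<close> guards against \<open>V = 0\<close>.\<close>
    define t where "t = min 1 (e * (2 * lam) / (V + 1))"
    have t: "0 < t" "t \<le> 1" using that lam V0 by (auto simp: t_def)
    have "t * V \<le> (e * (2 * lam) / (V + 1)) * V" unfolding t_def using V0 by (intro mult_right_mono) auto
    also have "\<dots> \<le> e * (2 * lam)"
    proof -
      have "V / (V + 1) \<le> 1" using V0 by simp
      from mult_left_mono[OF this, of "e * (2 * lam)"] show ?thesis using that lam by simp
    qed
    finally have "t * V / (2 * lam) \<le> e" using lam by (simp add: pos_divide_le_eq)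
    with main[OF t] show ?thesis by simp
  qed
  then have "- (P / lam) \<le> C" by (rule field_le_epsilon)
  also have "P / lam = (\<integral>x. v x \<bullet> dual_deriv x \<partial>lborel)"
    unfolding P_def set_lebesgue_integral_def
    by (subst integral_divide_zero[symmetric], rule Bochner_Integration.integral_cong[OF refl])
       (simp add: dual_deriv_def inner_commute divide_inverse)
  finally show ?thesis .
qed

text \<open>First variation along a step of height \<open>e\<close> that ends at \<open>x\<close>:
  its pairing with the derivative of \<open>\<phi>\<close> is \<open>e \<bullet> \<phi> x\<close>.
  The free bound \<open>C\<close> serves two purposes, \<open>norm e\<close> for every
  \<open>x\<close> and the sharper 0 for \<open>x = b\<close>.\<close>

lemma dual_step_bound:
  assumes "\<And>\<phi>. C1c {a<..<b} \<phi> \<Longrightarrow> (\<And>y. norm (\<phi> y) \<le> 1) \<Longrightarrow> e \<bullet> \<phi> x \<le> C"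
  shows "- (e \<bullet> dual x) \<le> C"
proof -
  obtain T where T: "TV {a<..<b} u = ereal T" by (rule TV_u_finite)
  let ?v = "\<lambda>y. indicator {..x} y *\<^sub>R e"
  have v: "L2 {a<..<b} ?v" by (rule L2_bounded[where B = "norm e"]) (auto simp: indicator_def)
  have "- (\<integral>y. ?v y \<bullet> dual_deriv y \<partial>lborel) \<le> C"
  proof (rule first_variation[OF T v])
    fix \<phi> :: "real \<Rightarrow> real^'n" assume \<phi>: "C1c {a<..<b} \<phi>" "\<And>y. norm (\<phi> y) \<le> 1"
    let ?D = "\<lambda>x. vector_derivative \<phi> (at x)"
    have "ereal (LINT x:{a<..<b}|lborel. u x \<bullet> ?D x) \<le> TV {a<..<b} u"
      unfolding TV_def using \<phi> by (intro SUP_upper) auto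
    then have u_le: "(LINT x:{a<..<b}|lborel. u x \<bullet> ?D x) \<le> T" by (simp add: T)
    have int: "integrable lborel (\<lambda>y. indicator {..x} y *\<^sub>R ?D y)"
      using C1c_derivative_integrable[OF \<phi>(1)] by (intro integrable_mult_indicator) auto
    have "(LINT y:{a<..<b}|lborel. ?v y \<bullet> ?D y) = (\<integral>y. e \<bullet> (indicator {..x} y *\<^sub>R ?D y) \<partial>lborel)"
      unfolding set_integral_C1c[OF \<phi>(1)] by simp
    also have "\<dots> = e \<bullet> \<phi> x"
      by (subst integral_inner_right[OF int]) (simp add: C1c_integral_head[OF \<phi>(1)])
    also have "\<dots> \<le> C" by (rule assms) (use \<phi> in auto)
    finally have v_le: "(LINT y:{a<..<b}|lborel. ?v y \<bullet> ?D y) \<le> C" .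
    have "(LINT y:{a<..<b}|lborel. (u y + ?v y) \<bullet> ?D y) = (LINT y:{a<..<b}|lborel. u y \<bullet> ?D y + ?v y \<bullet> ?D y)"
      by (simp add: inner_add_left)
    also have "\<dots> = (LINT y:{a<..<b}|lborel. u y \<bullet> ?D y) + (LINT y:{a<..<b}|lborel. ?v y \<bullet> ?D y)"
      by (intro set_integral_add set_integrable_L2_inner L2_u v C1c_L2[OF \<phi>(1)])
    finally show "(LINT y:{a<..<b}|lborel. (u y + ?v y) \<bullet> ?D y) \<le> T + C" using u_le v_le by simp
  qed
  moreover have "(\<integral>y. ?v y \<bullet> dual_deriv y \<partial>lborel) = e \<bullet> dual x"
  proof -
    have "integrable lborel (\<lambda>y. indicator {..x} y *\<^sub>R dual_deriv y)"
      using integrable_dual_deriv by (intro integrable_mult_indicator) auto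
    from integral_inner_right[OF this, of e] show ?thesis by (simp add: dual_def)
  qed
  ultimately show ?thesis by simp
qed

lemma norm_dual_le_1: "norm (dual x) \<le> 1"
proof -
  have "- (e \<bullet> dual x) \<le> norm e" for e
  proof (rule dual_step_bound)
    fix \<phi> :: "real \<Rightarrow> real^'n" assume "\<And>y. norm (\<phi> y) \<le> 1"
    then show "e \<bullet> \<phi> x \<le> norm e"
      using norm_cauchy_schwarz[of e "\<phi> x"] mult_left_le[of "norm (\<phi> x)" "norm e"] by simp
  qed
  from this[of "- dual x"] have "(norm (dual x))\<^sup>2 \<le> norm (dual x) * 1" by (simp add: power2_norm_eq_inner)
  then show ?thesis by (cases "norm (dual x) = 0") (auto simp: power2_eq_square)
qed

text \<open>On \<open>{a<..<b}\<close> the step that ends at \<open>b\<close> is a constant, and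
  adding a constant costs no variation because test functions vanish at \<open>b\<close>. The choice
  \<open>e = - dual b\<close> then forces \<open>dual b = 0\<close>.\<close>

lemma integral_dual_deriv: "(\<integral>x. dual_deriv x \<partial>lborel) = 0"
proof -
  have 1: "(\<integral>x. dual_deriv x \<partial>lborel) = dual b"
    unfolding dual_def by (rule Bochner_Integration.integral_cong) (auto simp: dual_deriv_def indicator_def)
  have "- (e \<bullet> dual b) \<le> 0" for e
    by (rule dual_step_bound) (simp add: C1c_eq_0)
  from this[of "- dual b"] have "dual b \<bullet> dual b = 0" using inner_ge_zero[of "dual b"] by simp
  then show ?thesis using 1 by simp
qed

text \<open>The total integral is zero, so a tail is minus the corresponding head. This is the shape
  of \<open>C1c_integral_tail\<close> and lets \<open>dual\<close> stand in for a test function in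
  \<open>Fubini_halfline\<close>.\<close>

lemma dual_deriv_integral_tail: "(\<integral>x. indicator {y..} x *\<^sub>R dual_deriv x \<partial>lborel) = - dual y"
proof -
  have i: "integrable lborel (\<lambda>x. indicator A x *\<^sub>R dual_deriv x)" if "A \<in> sets borel" for A
    using integrable_dual_deriv that by (intro integrable_mult_indicator) auto
  have [measurable]: "dual_deriv \<in> borel_measurable borel" using integrable_dual_deriv by auto
  have "(\<integral>x. indicator {y..} x *\<^sub>R dual_deriv x \<partial>lborel) + dual y
      = (\<integral>x. indicator {y..} x *\<^sub>R dual_deriv x + indicator {..y} x *\<^sub>R dual_deriv x \<partial>lborel)"
    unfolding dual_def by (rule Bochner_Integration.integral_add[symmetric]) (auto intro: i)
  also have "\<dots> = (\<integral>x. dual_deriv x \<partial>lborel)"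
    using AE_lborel_singleton[of y] by (intro integral_cong_AE) (auto simp: indicator_def)
  finally show ?thesis by (simp add: integral_dual_deriv eq_neg_iff_add_eq_0)
qed

lemma continuous_dual: "continuous_on UNIV dual"
  unfolding dual_def[abs_def] continuous_on_eq_continuous_at[OF open_UNIV]
  by (intro ballI isCont_halfline_integral integrable_dual_deriv AE_lborel_singleton) simp

lemma dual_measurable[measurable]: "dual \<in> borel_measurable borel"
  by (rule borel_measurable_continuous_onI[OF continuous_dual])

text \<open>Compare \<open>u\<close> with the competitor obtained by collapsing \<open>u\<close> on \<open>J = {p<..q}\<close>, whose derivative is
  that of \<open>u\<close> with \<open>J\<close> removed: its total variation drops by at least \<open>e \<bullet> u'(J)\<close> for any \<open>e\<close> in the unit ball,
  while the first variation of the fidelity term is the integral of \<open>dual\<close> against \<open>u'\<close> over \<open>J\<close>.\<close>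
lemma interval_bound:
  assumes "finite_measure N" and N: "sets N = sets borel" and s: "integrable N \<sigma>"
    and test: "\<And>\<phi>. C1c {a<..<b} \<phi> \<Longrightarrow>
       (LINT x:{a<..<b}|lborel. u x \<bullet> vector_derivative \<phi> (at x)) = - (\<integral>x. \<sigma> x \<bullet> \<phi> x \<partial>N)"
    and pq: "a < p" "p < q" "q < b" and e: "norm e \<le> 1"
  shows "(\<integral>x. indicator {p<..q} x *\<^sub>R (\<sigma> x \<bullet> e) \<partial>N) \<le> (\<integral>x. indicator {p<..q} x *\<^sub>R (\<sigma> x \<bullet> dual x) \<partial>N)"
proof -
  let ?I = "{a<..<b}" and ?J = "{p<..q}"
  interpret N: finite_measure N by fact
  note [measurable_cong] = N
  have [measurable]: "\<sigma> \<in> borel_measurable N" using s by auto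
  obtain T where T: "TV ?I u = ereal T" by (rule TV_u_finite)
  define \<sigma>J where "\<sigma>J = (\<lambda>y. indicator ?J y *\<^sub>R \<sigma> y)"
  have sJ: "integrable N \<sigma>J" unfolding \<sigma>J_def using s N by (intro integrable_mult_indicator) auto
  \<comment> \<open>Minus the distribution function of \<open>u'\<close> restricted to
    \<open>?J\<close>, so that \<open>u + v\<close> has the derivative of \<open>u\<close> outside
    \<open>?J\<close> and none on \<open>?J\<close>.\<close>
  define v where "v = (\<lambda>x. - (\<integral>y. indicator {..x} y *\<^sub>R \<sigma>J y \<partial>N))"
  have v: "L2 ?I v"
  proof (rule L2_bounded)
    show "v \<in> borel_measurable borel" unfolding v_def
      by (intro borel_measurable_uminus borel_measurable_halfline_integral assms sJ)
    show "norm (v x) \<le> (\<integral>y. norm (\<sigma>J y) \<partial>N)" for x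
      unfolding v_def using norm_restricted_integral_le[OF sJ] by simp
  qed
  have v_int: "(\<integral>x. v x \<bullet> \<psi> x \<partial>lborel) = - (\<integral>y. \<sigma>J y \<bullet> (\<integral>x. indicator {y..} x *\<^sub>R \<psi> x \<partial>lborel) \<partial>N)"
    if "integrable lborel \<psi>" for \<psi> :: "real \<Rightarrow> real^'n"
    unfolding v_def using Fubini_halfline[OF assms(1) N sJ that] by simp
  define C where "C = - (\<integral>x. \<sigma>J x \<bullet> e \<partial>N)"
  have "- (\<integral>x. v x \<bullet> dual_deriv x \<partial>lborel) \<le> C"
  proof (rule first_variation[OF T v])
    fix \<phi> :: "real \<Rightarrow> real^'n" assume \<phi>: "C1c ?I \<phi>" and \<phi>1: "\<And>y. norm (\<phi> y) \<le> 1"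
    let ?D = "\<lambda>x. vector_derivative \<phi> (at x)"
    have [measurable]: "\<phi> \<in> borel_measurable borel"
      using C1c_continuous[OF \<phi>] by (rule borel_measurable_continuous_onI)
    have "(LINT x:?I|lborel. v x \<bullet> ?D x) = (\<integral>x. \<sigma>J x \<bullet> \<phi> x \<partial>N)"
      unfolding set_integral_C1c[OF \<phi>] v_int[OF C1c_derivative_integrable[OF \<phi>]] C1c_integral_tail[OF \<phi>] by simp
    moreover have "(LINT x:?I|lborel. (u x + v x) \<bullet> ?D x) = (LINT x:?I|lborel. u x \<bullet> ?D x) + (LINT x:?I|lborel. v x \<bullet> ?D x)"
      unfolding inner_add_left by (intro set_integral_add set_integrable_L2_inner L2_u v C1c_L2[OF \<phi>])
    ultimately have lhs: "(LINT x:?I|lborel. (u x + v x) \<bullet> ?D x) = - (\<integral>x. \<sigma> x \<bullet> \<phi> x \<partial>N) + (\<integral>x. \<sigma>J x \<bullet> \<phi> x \<partial>N)"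
      by (simp add: test[OF \<phi>])
    obtain \<eta> \<eta>' :: "nat \<Rightarrow> real \<Rightarrow> real" and r :: real
      where r: "r < b" and \<eta>: "\<And>n x. (\<eta> n has_real_derivative \<eta>' n x) (at x)"
      and \<eta>'_cont: "\<And>n. continuous_on UNIV (\<eta>' n)"
      and \<eta>0: "\<And>n x. 0 \<le> \<eta> n x" and \<eta>1: "\<And>n x. \<eta> n x \<le> 1" and \<eta>_supp: "\<And>n x. x \<notin> {p..r} \<Longrightarrow> \<eta> n x = 0"
      and \<eta>_lim: "\<And>x. (\<lambda>n. \<eta> n x) \<longlonglongrightarrow> indicator {p<..q} x"
      using C1_cutoff[OF pq(2,3)] by metis
    have \<eta>_cont: "continuous_on UNIV (\<eta> n)" for n
      unfolding continuous_on_eq_continuous_at[OF open_UNIV] using DERIV_isCont[OF \<eta>] by blast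
    then have [measurable]: "\<eta> n \<in> borel_measurable borel" for n by (rule borel_measurable_continuous_onI)
    \<comment> \<open>A convex combination of \<open>\<phi>\<close> and \<open>- e\<close>, hence
      still in the unit ball; in the limit it is \<open>\<phi>\<close> off \<open>?J\<close> and
      \<open>- e\<close> on \<open>?J\<close>. Since \<open>test\<close> carries a minus sign, the
      part on \<open>?J\<close> contributes plus the integral of
      \<open>\<sigma>J x \<bullet> e\<close>.\<close>
    define \<Phi> where "\<Phi> = (\<lambda>n x. (1 - \<eta> n x) *\<^sub>R \<phi> x - \<eta> n x *\<^sub>R e)"
    have \<Phi>1: "norm (\<Phi> n x) \<le> 1" for n x
    proof -
      have "norm (\<Phi> n x) \<le> norm ((1 - \<eta> n x) *\<^sub>R \<phi> x) + norm (\<eta> n x *\<^sub>R e)" unfolding \<Phi>_def by (rule norm_triangle_ineq4)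
      also have "\<dots> = (1 - \<eta> n x) * norm (\<phi> x) + \<eta> n x * norm e" using \<eta>0 \<eta>1 by simp
      also have "\<dots> \<le> (1 - \<eta> n x) * 1 + \<eta> n x * 1"
        using \<eta>0 \<eta>1 \<phi>1 e by (intro add_mono mult_left_mono) auto
      finally show ?thesis by simp
    qed
    have \<Phi>C: "C1c ?I (\<Phi> n)" for n
    proof -
      obtain K where K: "compact K" "K \<subseteq> ?I" "\<And>x. x \<notin> K \<Longrightarrow> \<phi> x = 0" using C1c_support[OF \<phi>] by metis
      show ?thesis
      proof (rule C1cI[where K = "K \<union> {p..r}"])
        show "(\<Phi> n has_vector_derivative ((1 - \<eta> n x) *\<^sub>R ?D x + (- \<eta>' n x) *\<^sub>R \<phi> x - \<eta>' n x *\<^sub>R e)) (at x)" for x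
          unfolding \<Phi>_def
          by (rule has_vector_derivative_diff, rule has_vector_derivative_scaleR[OF _ C1c_has_derivative[OF \<phi>]],
              use \<eta>[of n x] in \<open>auto intro!: derivative_eq_intros\<close>)
        show "continuous_on UNIV (\<lambda>x. (1 - \<eta> n x) *\<^sub>R ?D x + (- \<eta>' n x) *\<^sub>R \<phi> x - \<eta>' n x *\<^sub>R e)"
          by (intro continuous_intros \<eta>_cont \<eta>'_cont C1c_continuous_derivative[OF \<phi>] C1c_continuous[OF \<phi>])
        show "compact (K \<union> {p..r})" using K by (intro compact_Un) auto
        show "K \<union> {p..r} \<subseteq> ?I" using K pq r by auto
        show "\<Phi> n x = 0" if "x \<notin> K \<union> {p..r}" for x using that K(3)[of x] \<eta>_supp[of x n] by (simp add: \<Phi>_def)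
      qed
    qed
    have \<Phi>_le: "- (\<integral>x. \<sigma> x \<bullet> \<Phi> n x \<partial>N) \<le> T" for n
    proof -
      have "ereal (LINT x:?I|lborel. u x \<bullet> vector_derivative (\<Phi> n) (at x)) \<le> TV ?I u"
        unfolding TV_def using \<Phi>C[of n] \<Phi>1[of n] by (intro SUP_upper) auto
      then show ?thesis by (simp add: T test[OF \<Phi>C])
    qed
    have "(\<lambda>n. - (\<integral>x. \<sigma> x \<bullet> \<Phi> n x \<partial>N))
       \<longlonglongrightarrow> - (\<integral>x. \<sigma> x \<bullet> ((1 - indicator ?J x) *\<^sub>R \<phi> x - indicator ?J x *\<^sub>R e) \<partial>N)"
    proof (intro tendsto_minus, rule integral_dominated_convergence[where w = "\<lambda>x. norm (\<sigma> x)"])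
      show "AE x in N. (\<lambda>n. \<sigma> x \<bullet> \<Phi> n x) \<longlonglongrightarrow> \<sigma> x \<bullet> ((1 - indicator ?J x) *\<^sub>R \<phi> x - indicator ?J x *\<^sub>R e)"
        unfolding \<Phi>_def by (intro AE_I2 tendsto_intros \<eta>_lim)
      have "\<bar>\<sigma> x \<bullet> \<Phi> n x\<bar> \<le> norm (\<sigma> x)" for n x
        using Cauchy_Schwarz_ineq2[of "\<sigma> x" "\<Phi> n x"] mult_left_le[OF \<Phi>1[of n x], of "norm (\<sigma> x)"] by simp
      then show "AE x in N. norm (\<sigma> x \<bullet> \<Phi> n x) \<le> norm (\<sigma> x)" for n by simp
      show "(\<lambda>x. \<sigma> x \<bullet> \<Phi> n x) \<in> borel_measurable N" for n unfolding \<Phi>_def by measurable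
    qed (use s in \<open>auto simp: N\<close>)
    then have le_T: "- (\<integral>x. \<sigma> x \<bullet> ((1 - indicator ?J x) *\<^sub>R \<phi> x - indicator ?J x *\<^sub>R e) \<partial>N) \<le> T"
      by (rule LIMSEQ_le_const2) (use \<Phi>_le in auto)
    have ii: "integrable N (\<lambda>x. \<sigma> x \<bullet> \<phi> x)" "integrable N (\<lambda>x. \<sigma>J x \<bullet> \<phi> x)" "integrable N (\<lambda>x. \<sigma>J x \<bullet> e)"
      using s sJ \<phi>1 by (auto intro!: integrable_inner_bounded[where B = 1])
    have "(\<integral>x. \<sigma> x \<bullet> ((1 - indicator ?J x) *\<^sub>R \<phi> x - indicator ?J x *\<^sub>R e) \<partial>N)
        = (\<integral>x. (\<sigma> x \<bullet> \<phi> x - \<sigma>J x \<bullet> \<phi> x) - \<sigma>J x \<bullet> e \<partial>N)"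
      by (rule Bochner_Integration.integral_cong) (auto simp: \<sigma>J_def indicator_def)
    also have "\<dots> = (\<integral>x. \<sigma> x \<bullet> \<phi> x \<partial>N) - (\<integral>x. \<sigma>J x \<bullet> \<phi> x \<partial>N) + C"
      using ii by (simp add: C_def)
    finally show "(LINT x:?I|lborel. (u x + v x) \<bullet> ?D x) \<le> T + C"
      using le_T unfolding lhs by simp
  qed
  moreover have "- (\<integral>x. v x \<bullet> dual_deriv x \<partial>lborel) = - (\<integral>x. \<sigma>J x \<bullet> dual x \<partial>N)"
    unfolding v_int[OF integrable_dual_deriv] dual_deriv_integral_tail by simp
  ultimately show ?thesis by (simp add: C_def \<sigma>J_def)
qed

text \<open>For each fixed \<open>e\<close> the interval inequality gives a pointwise one off a null
  set that depends on \<open>e\<close>. A countable dense set of vectors shares one null set, and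
  continuity in \<open>e\<close> then permits \<open>e = \<sigma> x\<close>.\<close>

lemma density_le_inner_dual:
  assumes "finite_measure N" and N: "sets N = sets borel" and s: "integrable N \<sigma>"
    and s0: "\<And>x. x \<notin> {a<..<b} \<Longrightarrow> \<sigma> x = 0"
    and test: "\<And>\<phi>. C1c {a<..<b} \<phi> \<Longrightarrow>
       (LINT x:{a<..<b}|lborel. u x \<bullet> vector_derivative \<phi> (at x)) = - (\<integral>x. \<sigma> x \<bullet> \<phi> x \<partial>N)"
  shows "AE x in N. norm (\<sigma> x) \<le> \<sigma> x \<bullet> dual x"
proof -
  note [measurable_cong] = N
  have [measurable]: "\<sigma> \<in> borel_measurable N" using s by auto
  have le1: "AE x in N. \<sigma> x \<bullet> e \<le> \<sigma> x \<bullet> dual x" if e: "norm e \<le> 1" for e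
  proof (rule AE_le_if_integral_le)
    show ie: "integrable N (\<lambda>x. \<sigma> x \<bullet> e)" and id: "integrable N (\<lambda>x. \<sigma> x \<bullet> dual x)"
      using s e norm_dual_le_1 by (auto intro!: integrable_inner_bounded[where B = 1])
    show "(\<integral>x. indicator B x *\<^sub>R (\<sigma> x \<bullet> e) \<partial>N) \<le> (\<integral>x. indicator B x *\<^sub>R (\<sigma> x \<bullet> dual x) \<partial>N)" if "B \<in> sets N" for B
      by (rule integral_le_on_borel_if_le_on_intervals[OF assms(1) N ie assms(1) N id, of a b])
         (use that N s0 interval_bound[OF assms(1) N s test _ _ _ e] in auto)
  qed
  \<comment> \<open>The homogeneous form lifts the restriction to the unit ball, so that a dense
    subset of the whole space can be used and a vector \<open>\<sigma> x\<close> of any length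
    inserted.\<close>
  have le: "AE x in N. \<sigma> x \<bullet> e \<le> norm e * (\<sigma> x \<bullet> dual x)" for e
  proof (cases "e = 0")
    case False
    have "AE x in N. \<sigma> x \<bullet> (e /\<^sub>R norm e) \<le> \<sigma> x \<bullet> dual x" using False by (intro le1) simp
    then show ?thesis by eventually_elim (use False in \<open>simp add: field_simps\<close>)
  qed simp
  obtain D :: "(real^'n) set" where D: "countable D" "\<And>X. open X \<Longrightarrow> X \<noteq> {} \<Longrightarrow> \<exists>d\<in>D. d \<in> X"
    by (erule countable_dense_setE)
  have "AE x in N. \<forall>e\<in>D. \<sigma> x \<bullet> e \<le> norm e * (\<sigma> x \<bullet> dual x)"
    using D(1) le by (simp add: AE_ball_countable)
  then show ?thesis
  proof eventually_elim
    case (elim x)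
    let ?X = "{e. norm e * (\<sigma> x \<bullet> dual x) < \<sigma> x \<bullet> e}"
    have "open ?X" by (intro open_Collect_less continuous_intros)
    then have "?X = {}" using D(2)[of ?X] elim by fastforce
    then have "\<sigma> x \<bullet> \<sigma> x \<le> norm (\<sigma> x) * (\<sigma> x \<bullet> dual x)" by (metis (mono_tags, lifting) empty_iff mem_Collect_eq not_less)
    then have "norm (\<sigma> x) * norm (\<sigma> x) \<le> norm (\<sigma> x) * (\<sigma> x \<bullet> dual x)"
      by (simp add: power2_norm_eq_inner[symmetric] power2_eq_square)
    then show ?case by (cases "\<sigma> x = 0") auto
  qed
qed

lemma dual_diff:
  assumes "x \<le> y"
  shows "dual y - dual x = (\<integral>t. indicator {x<..y} t *\<^sub>R dual_deriv t \<partial>lborel)"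
proof -
  have i: "integrable lborel (\<lambda>t. indicator A t *\<^sub>R dual_deriv t)" if "A \<in> sets borel" for A
    using integrable_dual_deriv that by (intro integrable_mult_indicator) auto
  have "dual y - dual x = (\<integral>t. indicator {..y} t *\<^sub>R dual_deriv t - indicator {..x} t *\<^sub>R dual_deriv t \<partial>lborel)"
    unfolding dual_def by (rule Bochner_Integration.integral_diff[symmetric]) (auto intro: i)
  also have "\<dots> = (\<integral>t. indicator {x<..y} t *\<^sub>R dual_deriv t \<partial>lborel)"
    by (rule Bochner_Integration.integral_cong) (use assms in \<open>auto simp: indicator_def\<close>)
  finally show ?thesis .
qed

end

section \<open>The contact set\<close>

text \<open>\<open>\<sigma>\<close> times \<open>N\<close> represents \<open>u'\<close> on
  \<open>{a<..<b}\<close>, and \<open>\<tau>\<close> times \<open>M\<close> represents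
  \<open>f'\<close> on \<open>{c<..<d}\<close>. Nothing relates \<open>N\<close> to
  \<open>M\<close>, so the two derivatives meet only in integrals over common sets.\<close>

locale rof_minimizer_BV_data = rof_minimizer a b lam f u
  for a b lam :: real and f u :: "real \<Rightarrow> real^'n" +
  fixes c d :: real and N M :: "real measure" and \<sigma> \<tau> :: "real \<Rightarrow> real^'n"
  assumes cd: "c < d" and sub: "{c<..<d} \<subseteq> {a<..<b}"
    and N_fin: "finite_measure N" and N: "sets N = sets borel" and s: "integrable N \<sigma>"
    and s0: "\<And>x. x \<notin> {a<..<b} \<Longrightarrow> \<sigma> x = 0"
    and u_deriv: "\<And>\<phi>. C1c {a<..<b} \<phi> \<Longrightarrow>
       (LINT x:{a<..<b}|lborel. u x \<bullet> vector_derivative \<phi> (at x)) = - (\<integral>x. \<sigma> x \<bullet> \<phi> x \<partial>N)"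
    and M_fin: "finite_measure M" and M: "sets M = sets borel" and t: "integrable M \<tau>"
    and t0: "\<And>x. x \<notin> {c<..<d} \<Longrightarrow> \<tau> x = 0"
    and f_deriv: "\<And>\<phi>. C1c {c<..<d} \<phi> \<Longrightarrow>
       (LINT x:{c<..<d}|lborel. f x \<bullet> vector_derivative \<phi> (at x)) = - (\<integral>x. \<tau> x \<bullet> \<phi> x \<partial>M)"
begin

definition \<sigma>U :: "real \<Rightarrow> real^'n" where "\<sigma>U x = indicator {c<..<d} x *\<^sub>R \<sigma> x"

definition cumulative :: "real \<Rightarrow> real^'n" where
  "cumulative x = (\<integral>y. indicator {..x} y *\<^sub>R \<sigma>U y \<partial>N) - (\<integral>y. indicator {..x} y *\<^sub>R \<tau> y \<partial>M)"

text \<open>Off this countable, hence Lebesgue null, set \<open>cumulative\<close> is continuous, so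
  \<open>dual\<close> is differentiable at the remaining points of \<open>{c<..<d}\<close>.\<close>

definition atoms :: "real set" where "atoms = {x. measure N {x} \<noteq> 0} \<union> {x. measure M {x} \<noteq> 0}"

lemma sU: "integrable N \<sigma>U"
  unfolding \<sigma>U_def using s N by (intro integrable_mult_indicator) auto

lemma countable_atoms: "countable atoms"
  unfolding atoms_def
  using finite_measure.countable_support[OF N_fin] finite_measure.countable_support[OF M_fin] by auto

lemma cumulative_measurable[measurable]: "cumulative \<in> borel_measurable borel"
  unfolding cumulative_def[abs_def]
  by (intro borel_measurable_diff borel_measurable_halfline_integral N_fin M_fin N M sU t)

lemma cumulative_bounded: "norm (cumulative x) \<le> (\<integral>y. norm (\<sigma>U y) \<partial>N) + (\<integral>y. norm (\<tau> y) \<partial>M)"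
  unfolding cumulative_def
  by (rule order_trans[OF norm_triangle_ineq4 add_mono[OF norm_restricted_integral_le[OF sU] norm_restricted_integral_le[OF t]]])

lemma cumulative_isCont:
  assumes "x \<notin> atoms"
  shows "isCont cumulative x"
proof -
  have ae: "AE y in L. y \<noteq> x" if "finite_measure L" "sets L = sets borel" "measure L {x} = 0" for L
  proof -
    have "{x} \<in> null_sets L" using that finite_measure.emeasure_eq_measure[OF that(1)] by (auto simp: null_sets_def)
    then show ?thesis using AE_not_in by fastforce
  qed
  show ?thesis
    unfolding cumulative_def[abs_def] using assms
    by (intro continuous_diff isCont_halfline_integral N M sU t ae N_fin M_fin) (auto simp: atoms_def)
qed

text \<open>Two uses of \<open>Fubini_halfline\<close>: \<open>cumulative\<close> has the weak
  derivative \<open>\<sigma>U\<close> times \<open>N\<close> minus \<open>\<tau>\<close> times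
  \<open>M\<close>. The tail condition in place of smoothness admits Lipschitz \<open>\<Phi>\<close>
  as well as test functions.\<close>

lemma integral_cumulative:
  assumes p: "integrable lborel \<psi>" and tail: "\<And>y. (\<integral>x. indicator {y..} x *\<^sub>R \<psi> x \<partial>lborel) = - \<Phi> y"
  shows "(\<integral>x. cumulative x \<bullet> \<psi> x \<partial>lborel) = (\<integral>x. \<tau> x \<bullet> \<Phi> x \<partial>M) - (\<integral>x. \<sigma>U x \<bullet> \<Phi> x \<partial>N)"
proof -
  have i: "integrable lborel (\<lambda>x. (\<integral>y. indicator {..x} y *\<^sub>R g y \<partial>L) \<bullet> \<psi> x)"
    if "finite_measure L" "sets L = sets borel" "integrable L g" for L and g :: "real \<Rightarrow> real^'n"
    using integrable_inner_bounded[OF p, of "\<lambda>x. \<integral>y. indicator {..x} y *\<^sub>R g y \<partial>L", OF _ norm_restricted_integral_le[OF that(3)]]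
      borel_measurable_halfline_integral[OF that] by (simp add: inner_commute)
  have "(\<integral>x. cumulative x \<bullet> \<psi> x \<partial>lborel)
     = (\<integral>x. (\<integral>y. indicator {..x} y *\<^sub>R \<sigma>U y \<partial>N) \<bullet> \<psi> x \<partial>lborel) - (\<integral>x. (\<integral>y. indicator {..x} y *\<^sub>R \<tau> y \<partial>M) \<bullet> \<psi> x \<partial>lborel)"
    unfolding cumulative_def inner_diff_left
    by (intro Bochner_Integration.integral_diff i N_fin N sU M_fin M t)
  also have "\<dots> = - (\<integral>x. \<sigma>U x \<bullet> \<Phi> x \<partial>N) + (\<integral>x. \<tau> x \<bullet> \<Phi> x \<partial>M)"
    unfolding Fubini_halfline[OF N_fin N sU p] Fubini_halfline[OF M_fin M t p] tail by simp
  finally show ?thesis by simp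
qed

text \<open>On \<open>{c<..<d}\<close> the functions \<open>u - f\<close> and \<open>cumulative\<close> have the same distributional derivative.\<close>
lemma dual_primitive:
  obtains C where "\<And>x y. c < x \<Longrightarrow> x \<le> y \<Longrightarrow> y < d \<Longrightarrow>
    dual y - dual x = (\<integral>t. indicator {x<..y} t *\<^sub>R ((cumulative t + C) /\<^sub>R lam) \<partial>lborel)"
proof -
  let ?U = "{c<..<d}"
  \<comment> \<open>On \<open>?U\<close> the scaled \<open>dual_deriv\<close> is
    \<open>u - f\<close>, so \<open>\<kappa>\<close> is a difference of two functions with the same
    weak derivative; \<open>du_Bois_Reymond\<close> supplies the constant.\<close>
  define \<kappa> where "\<kappa> = (\<lambda>x. indicator ?U x *\<^sub>R (lam *\<^sub>R dual_deriv x) - indicator ?U x *\<^sub>R cumulative x)"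
  have i1: "integrable lborel (\<lambda>x. indicator ?U x *\<^sub>R (lam *\<^sub>R dual_deriv x))"
    using integrable_dual_deriv by (intro integrable_mult_indicator) auto
  have cum_int: "integrable lborel (\<lambda>x. indicator A x *\<^sub>R cumulative x)"
    if "bounded A" and [measurable]: "A \<in> sets borel" for A
  proof (rule Bochner_Integration.integrable_bound)
    show "integrable lborel (\<lambda>x. indicator A x *\<^sub>R ((\<integral>y. norm (\<sigma>U y) \<partial>N) + (\<integral>y. norm (\<tau> y) \<partial>M)))"
      using that by (intro integrable_scaleR_indicator_bounded)
    show "AE x in lborel. norm (indicator A x *\<^sub>R cumulative x) \<le> norm (indicator A x *\<^sub>R ((\<integral>y. norm (\<sigma>U y) \<partial>N) + (\<integral>y. norm (\<tau> y) \<partial>M)))"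
      using cumulative_bounded by (intro AE_I2) (auto simp: indicator_def intro: order_trans[OF _ abs_ge_self])
  qed measurable
  have i2: "integrable lborel (\<lambda>x. indicator ?U x *\<^sub>R cumulative x)" by (rule cum_int) auto
  have \<kappa>: "integrable lborel \<kappa>" unfolding \<kappa>_def using i1 i2 by (rule Bochner_Integration.integrable_diff)
  obtain C where C: "\<And>x y. c < x \<Longrightarrow> x \<le> y \<Longrightarrow> y < d \<Longrightarrow> (\<integral>t. indicator {x<..y} t *\<^sub>R \<kappa> t \<partial>lborel) = (y - x) *\<^sub>R C"
  proof (rule du_Bois_Reymond[OF cd \<kappa>])
    fix \<phi> :: "real \<Rightarrow> real^'n" assume \<phi>: "C1c ?U \<phi>"
    let ?D = "\<lambda>x. vector_derivative \<phi> (at x)"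
    have \<phi>I: "C1c {a<..<b} \<phi>" by (rule C1c_mono[OF \<phi> sub])
    obtain B where B: "\<And>x. norm (?D x) \<le> B" using C1c_derivative_bounded[OF \<phi>] by metis
    have D_meas[measurable]: "?D \<in> borel_measurable borel"
      by (rule borel_measurable_continuous_onI[OF C1c_continuous_derivative[OF \<phi>]])
    have 1: "(\<integral>x. (indicator ?U x *\<^sub>R (lam *\<^sub>R dual_deriv x)) \<bullet> ?D x \<partial>lborel) = (\<integral>x. \<tau> x \<bullet> \<phi> x \<partial>M) - (\<integral>x. \<sigma>U x \<bullet> \<phi> x \<partial>N)"
    proof -
      have iu: "integrable lborel (\<lambda>x. (indicator {a<..<b} x *\<^sub>R u x) \<bullet> ?D x)"
        and jf: "integrable lborel (\<lambda>x. (indicator {a<..<b} x *\<^sub>R f x) \<bullet> ?D x)"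
        by (intro integrable_inner_bounded[OF L2_integrable[OF L2_u] _ B] integrable_inner_bounded[OF L2_integrable[OF L2_f] _ B]; simp)+
      have "(\<integral>x. (indicator ?U x *\<^sub>R (lam *\<^sub>R dual_deriv x)) \<bullet> ?D x \<partial>lborel)
         = (\<integral>x. (indicator {a<..<b} x *\<^sub>R u x) \<bullet> ?D x - (indicator {a<..<b} x *\<^sub>R f x) \<bullet> ?D x \<partial>lborel)"
      proof (rule Bochner_Integration.integral_cong[OF refl])
        fix x
        show "(indicator ?U x *\<^sub>R (lam *\<^sub>R dual_deriv x)) \<bullet> ?D x
          = (indicator {a<..<b} x *\<^sub>R u x) \<bullet> ?D x - (indicator {a<..<b} x *\<^sub>R f x) \<bullet> ?D x"
        proof (cases "x \<in> ?U")
          case True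
          then have "x \<in> {a<..<b}" using sub by blast
          then show ?thesis using True lam by (simp add: dual_deriv_def inner_diff_left)
        next
          case False
          then show ?thesis by (simp add: C1c_derivative_eq_0[OF \<phi> False])
        qed
      qed
      also have "\<dots> = (\<integral>x. (indicator {a<..<b} x *\<^sub>R u x) \<bullet> ?D x \<partial>lborel) - (\<integral>x. (indicator {a<..<b} x *\<^sub>R f x) \<bullet> ?D x \<partial>lborel)"
        by (rule Bochner_Integration.integral_diff[OF iu jf])
      also have "(\<integral>x. (indicator {a<..<b} x *\<^sub>R u x) \<bullet> ?D x \<partial>lborel) = - (\<integral>x. \<sigma> x \<bullet> \<phi> x \<partial>N)"
        using u_deriv[OF \<phi>I] by (simp add: set_lebesgue_integral_def)
      also have "(\<integral>x. \<sigma> x \<bullet> \<phi> x \<partial>N) = (\<integral>x. \<sigma>U x \<bullet> \<phi> x \<partial>N)"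
      proof (rule Bochner_Integration.integral_cong[OF refl])
        show "\<sigma> x \<bullet> \<phi> x = \<sigma>U x \<bullet> \<phi> x" for x
          by (cases "x \<in> ?U") (simp_all add: \<sigma>U_def C1c_eq_0[OF \<phi>])
      qed
      also have "(\<integral>x. (indicator {a<..<b} x *\<^sub>R f x) \<bullet> ?D x \<partial>lborel) = (LINT x:?U|lborel. f x \<bullet> ?D x)"
        unfolding set_lebesgue_integral_def
      proof (rule Bochner_Integration.integral_cong[OF refl])
        fix x
        show "(indicator {a<..<b} x *\<^sub>R f x) \<bullet> ?D x = indicator ?U x *\<^sub>R (f x \<bullet> ?D x)"
        proof (cases "x \<in> ?U")
          case True
          then have "x \<in> {a<..<b}" using sub by blast
          then show ?thesis using True by simp
        next
          case False
          then show ?thesis by (simp add: C1c_derivative_eq_0[OF \<phi> False])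
        qed
      qed
      also have "\<dots> = - (\<integral>x. \<tau> x \<bullet> \<phi> x \<partial>M)" by (rule f_deriv[OF \<phi>])
      finally show ?thesis by simp
    qed
    have 2: "(\<integral>x. (indicator ?U x *\<^sub>R cumulative x) \<bullet> ?D x \<partial>lborel) = (\<integral>x. \<tau> x \<bullet> \<phi> x \<partial>M) - (\<integral>x. \<sigma>U x \<bullet> \<phi> x \<partial>N)"
    proof -
      have "(\<integral>x. (indicator ?U x *\<^sub>R cumulative x) \<bullet> ?D x \<partial>lborel) = (\<integral>x. cumulative x \<bullet> ?D x \<partial>lborel)"
        using set_integral_C1c[OF \<phi>, of cumulative] by (simp add: set_lebesgue_integral_def)
      also have "\<dots> = (\<integral>x. \<tau> x \<bullet> \<phi> x \<partial>M) - (\<integral>x. \<sigma>U x \<bullet> \<phi> x \<partial>N)"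
        by (rule integral_cumulative[OF C1c_derivative_integrable[OF \<phi>] C1c_integral_tail[OF \<phi>]])
      finally show ?thesis .
    qed
    have "(\<integral>x. \<kappa> x \<bullet> ?D x \<partial>lborel) = (\<integral>x. (indicator ?U x *\<^sub>R (lam *\<^sub>R dual_deriv x)) \<bullet> ?D x \<partial>lborel)
        - (\<integral>x. (indicator ?U x *\<^sub>R cumulative x) \<bullet> ?D x \<partial>lborel)"
      unfolding \<kappa>_def inner_diff_left
      by (intro Bochner_Integration.integral_diff integrable_inner_bounded[OF i1 _ B] integrable_inner_bounded[OF i2 _ B]) auto
    then show "(\<integral>x. \<kappa> x \<bullet> ?D x \<partial>lborel) = 0" using 1 2 by simp
  qed blast
  show thesis
  proof (rule that[of C])
    fix x y assume xy: "c < x" "x \<le> y" "y < d"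
    let ?i = "\<lambda>t. indicator {x<..y} t :: real"
    have j0: "integrable lborel (\<lambda>t. ?i t *\<^sub>R \<kappa> t)" using \<kappa> by (intro integrable_mult_indicator) auto
    have j1: "integrable lborel (\<lambda>t. ?i t *\<^sub>R cumulative t)" by (rule cum_int) (auto intro: bounded_subset[OF bounded_closed_interval[of x y]])
    have j2: "integrable lborel (\<lambda>t. ?i t *\<^sub>R C)"
      by (rule integrable_scaleR_indicator_bounded) (auto intro: bounded_subset[OF bounded_closed_interval[of x y]])
    have "dual y - dual x = (\<integral>t. (?i t *\<^sub>R \<kappa> t + ?i t *\<^sub>R cumulative t) /\<^sub>R lam \<partial>lborel)"
      unfolding dual_diff[OF xy(2)]
    proof (rule Bochner_Integration.integral_cong[OF refl])
      fix t
      show "?i t *\<^sub>R dual_deriv t = (?i t *\<^sub>R \<kappa> t + ?i t *\<^sub>R cumulative t) /\<^sub>R lam"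
        using xy lam by (auto simp: \<kappa>_def indicator_def)
    qed
    also have "\<dots> = ((y - x) *\<^sub>R C + (\<integral>t. ?i t *\<^sub>R cumulative t \<partial>lborel)) /\<^sub>R lam"
      using Bochner_Integration.integral_add[OF j0 j1] C[OF xy] by (simp only: integral_scaleR_right)
    also have "(y - x) *\<^sub>R C = (\<integral>t. ?i t *\<^sub>R C \<partial>lborel)" using xy by simp
    also have "((\<integral>t. ?i t *\<^sub>R C \<partial>lborel) + (\<integral>t. ?i t *\<^sub>R cumulative t \<partial>lborel)) /\<^sub>R lam
       = (\<integral>t. (?i t *\<^sub>R C + ?i t *\<^sub>R cumulative t) /\<^sub>R lam \<partial>lborel)"
      using Bochner_Integration.integral_add[OF j2 j1] by (simp only: integral_scaleR_right)
    also have "\<dots> = (\<integral>t. ?i t *\<^sub>R ((cumulative t + C) /\<^sub>R lam) \<partial>lborel)"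
      by (rule Bochner_Integration.integral_cong) (auto simp: indicator_def add.commute)
    finally show "dual y - dual x = (\<integral>t. ?i t *\<^sub>R ((cumulative t + C) /\<^sub>R lam) \<partial>lborel)" .
  qed
qed

definition contact :: "real set" where "contact = {x. dual x \<bullet> dual x = 1}"

lemma contact_borel[measurable]: "contact \<in> sets borel"
  unfolding contact_def by measurable

text \<open>Test the equation \<open>lam dual'' = u' - f'\<close> with \<open>\<eta> |dual|\<^bsup>2k\<^esup> dual\<close>. As \<open>k\<close> grows the weight tends to
  the indicator of the contact set, on which \<open>|dual|\<^sup>2\<close> is maximal; the terms in which the derivative
  does not fall on \<open>\<eta>\<close> have a sign.\<close>
lemma contact_inequality_cutoff:
  fixes \<eta> \<eta>' :: "real \<Rightarrow> real"
  assumes pr: "c < p" "r < d" and \<eta>: "\<And>x. (\<eta> has_real_derivative \<eta>' x) (at x)" and \<eta>'_cont: "continuous_on UNIV \<eta>'"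
    and \<eta>0: "\<And>x. 0 \<le> \<eta> x" and \<eta>1: "\<And>x. \<eta> x \<le> 1" and \<eta>_supp: "\<And>x. x \<notin> {p..r} \<Longrightarrow> \<eta> x = 0"
  shows "(\<integral>x. \<eta> x * (indicator contact x * (\<sigma>U x \<bullet> dual x)) \<partial>N) \<le> (\<integral>x. \<eta> x * (indicator contact x * (\<tau> x \<bullet> dual x)) \<partial>M)"
proof -
  note [measurable_cong] = N M
  have [measurable]: "\<sigma>U \<in> borel_measurable N" "\<tau> \<in> borel_measurable M" using sU t by auto
  obtain C where C: "\<And>x y. c < x \<Longrightarrow> x \<le> y \<Longrightarrow> y < d \<Longrightarrow>
    dual y - dual x = (\<integral>t. indicator {x<..y} t *\<^sub>R ((cumulative t + C) /\<^sub>R lam) \<partial>lborel)"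
    using dual_primitive by blast
  \<comment> \<open>A version of \<open>dual_deriv\<close> on \<open>{c<..<d}\<close> that is
    bounded and continuous off \<open>atoms\<close>. It makes \<open>dual\<close> Lipschitz there
    and differentiable off \<open>atoms\<close>.\<close>
  define G where "G = (\<lambda>t. (cumulative t + C) /\<^sub>R lam)"
  have G_meas[measurable]: "G \<in> borel_measurable borel" unfolding G_def by measurable
  define B where "B = ((\<integral>y. norm (\<sigma>U y) \<partial>N) + (\<integral>y. norm (\<tau> y) \<partial>M) + norm C) / lam"
  have GB: "norm (G x) \<le> B" for x
  proof -
    have "norm (cumulative x + C) \<le> (\<integral>y. norm (\<sigma>U y) \<partial>N) + (\<integral>y. norm (\<tau> y) \<partial>M) + norm C"
      by (rule order_trans[OF norm_triangle_ineq add_right_mono[OF cumulative_bounded]])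
    then show ?thesis using lam unfolding G_def B_def by (simp add: divide_inverse mult.commute)
  qed
  have B0: "0 \<le> B" using order_trans[OF norm_ge_zero GB] .
  have dual_G: "dual y - dual x = (\<integral>t. indicator {x<..y} t *\<^sub>R G t \<partial>lborel)" if "c < x" "x \<le> y" "y < d" for x y
    unfolding G_def by (rule C[OF that])
  have dual_lip: "norm (dual x - dual y) \<le> B * \<bar>x - y\<bar>" if "x \<in> {c<..<d}" "y \<in> {c<..<d}" for x y
  proof -
    have *: "norm (dual y - dual x) \<le> B * (y - x)" if "c < x" "x \<le> y" "y < d" for x y
    proof -
      have "norm (\<integral>t. indicator {x<..y} t *\<^sub>R G t \<partial>lborel) \<le> (\<integral>t. indicator {x<..y} t *\<^sub>R B \<partial>lborel)"
      proof (rule Bochner_Integration.integral_norm_bound_integral)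
        have i: "integrable lborel (\<lambda>t. indicator {x<..y} t *\<^sub>R B)"
          by (rule integrable_scaleR_indicator_bounded) (auto intro: bounded_subset[OF bounded_closed_interval[of x y]])
        then show "integrable lborel (\<lambda>t. indicator {x<..y} t *\<^sub>R B)" .
        show "integrable lborel (\<lambda>t. indicator {x<..y} t *\<^sub>R G t)"
          by (rule Bochner_Integration.integrable_bound[OF i]) (use GB B0 in \<open>auto simp: indicator_def\<close>)
      qed (use GB in \<open>auto simp: indicator_def\<close>)
      then show ?thesis using that dual_G[OF that] by (simp add: mult.commute)
    qed
    show ?thesis
    proof (cases "x \<le> y")
      case True
      then show ?thesis using *[of x y] that by (simp add: norm_minus_commute)
    next
      case False
      then show ?thesis using *[of y x] that by simp
    qed
  qed
  have dual_der: "(dual has_vector_derivative G x) (at x)" if "x \<in> {c<..<d}" "x \<notin> atoms" for x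
  proof (rule primitive_has_vector_derivative[OF dual_G G_meas GB])
    show "isCont G x" unfolding G_def using cumulative_isCont[OF that(2)] by (intro continuous_intros)
  qed (use that in auto)
  define \<rho> where "\<rho> = (\<lambda>x. dual x \<bullet> dual x)"
  have \<rho>0: "0 \<le> \<rho> x" for x by (simp add: \<rho>_def)
  have \<rho>1: "\<rho> x \<le> 1" for x
    using norm_dual_le_1[of x] unfolding \<rho>_def power2_norm_eq_inner[symmetric] by (simp add: power_le_one)
  have \<rho>_cont: "continuous_on UNIV \<rho>" unfolding \<rho>_def by (intro continuous_intros continuous_dual)
  then have [measurable]: "\<rho> \<in> borel_measurable borel" by (rule borel_measurable_continuous_onI)
  have \<eta>_cont: "continuous_on UNIV \<eta>"
    unfolding continuous_on_eq_continuous_at[OF open_UNIV] using DERIV_isCont[OF \<eta>] by blast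
  have [measurable]: "\<eta> \<in> borel_measurable borel" "\<eta>' \<in> borel_measurable borel"
    using \<eta>_cont \<eta>'_cont by (auto intro: borel_measurable_continuous_onI)
  have \<rho>_der: "(\<rho> has_real_derivative 2 * (dual x \<bullet> G x)) (at x)" if "x \<in> {c<..<d}" "x \<notin> atoms" for x
  proof -
    have "(\<rho> has_derivative (\<lambda>h. dual x \<bullet> (h *\<^sub>R G x) + (h *\<^sub>R G x) \<bullet> dual x)) (at x)"
      unfolding \<rho>_def using dual_der[OF that] unfolding has_vector_derivative_def
      by (intro has_derivative_inner)
    then show ?thesis
      unfolding has_field_derivative_def by (rule has_derivative_eq_rhs) (auto simp: fun_eq_iff inner_commute)
  qed
  \<comment> \<open>At a contact point \<open>\<rho>\<close> attains its global maximum 1, so its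
    derivative vanishes.\<close>
  have contact_0: "dual x \<bullet> G x = 0" if "x \<in> {c<..<d}" "x \<notin> atoms" "x \<in> contact" for x
  proof -
    have "2 * (dual x \<bullet> G x) = 0"
      by (rule DERIV_local_max[OF \<rho>_der[OF that(1,2)], of 1]) (use that(3) \<rho>1 in \<open>auto simp: contact_def \<rho>_def\<close>)
    then show ?thesis by simp
  qed
  have \<eta>'_supp: "\<eta>' x = 0" if "x \<notin> {p..r}" for x
  proof -
    have "open (- {p..r})" by auto
    then have "((\<lambda>_. 0) has_real_derivative 0) (at x) \<longleftrightarrow> (\<eta> has_real_derivative 0) (at x)"
      by (intro DERIV_cong_ev) (use that \<eta>_supp in \<open>auto simp: eventually_nhds intro: exI[of _ "- {p..r}"]\<close>)
    then have "(\<eta> has_real_derivative 0) (at x)" by simp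
    from DERIV_unique[OF \<eta> this] show ?thesis .
  qed
  obtain E where E: "\<And>x. \<bar>\<eta>' x\<bar> \<le> E"
  proof -
    have "bounded (\<eta>' ` {p..r})"
      by (intro compact_imp_bounded compact_continuous_image continuous_on_subset[OF \<eta>'_cont]) auto
    then obtain E where E: "\<And>x. x \<in> {p..r} \<Longrightarrow> \<bar>\<eta>' x\<bar> \<le> E" unfolding bounded_iff real_norm_def by blast
    have "\<bar>\<eta>' x\<bar> \<le> max E 0" for x using E[of x] \<eta>'_supp[of x] by (cases "x \<in> {p..r}") auto
    then show ?thesis by (rule that)
  qed
  have \<eta>_lip: "\<bar>\<eta> x - \<eta> y\<bar> \<le> E * \<bar>x - y\<bar>" for x y
    using field_differentiable_bound[of UNIV \<eta> \<eta>' E x y] \<eta> E by simp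
  have E0: "0 \<le> E" using E[of 0] by simp
  have ineq: "lam * (\<integral>x. \<eta>' x * (\<rho> x ^ k * (dual x \<bullet> G x)) \<partial>lborel)
      \<le> (\<integral>x. \<eta> x * (\<rho> x ^ k * (\<tau> x \<bullet> dual x)) \<partial>M) - (\<integral>x. \<eta> x * (\<rho> x ^ k * (\<sigma>U x \<bullet> dual x)) \<partial>N)" for k
  proof -
    define \<Phi> where "\<Phi> = (\<lambda>x. (\<eta> x * \<rho> x ^ k) *\<^sub>R dual x)"
    \<comment> \<open>The formal derivative of \<open>\<Phi>\<close>. For \<open>k = 0\<close> the
      truncated exponent \<open>k - 1\<close> is harmless because of the factor
      \<open>real k\<close>.\<close>
    define \<psi> where "\<psi> = (\<lambda>x. (\<eta> x * \<rho> x ^ k) *\<^sub>R G x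
        + (\<eta>' x * \<rho> x ^ k + \<eta> x * (real k * \<rho> x ^ (k - 1) * (2 * (dual x \<bullet> G x)))) *\<^sub>R dual x)"
    have \<Phi>_der: "(\<Phi> has_vector_derivative \<psi> x) (at x)" if x: "x \<notin> atoms" for x
    proof (cases "x \<in> {c<..<d}")
      case True
      have "((\<lambda>x. \<eta> x * \<rho> x ^ k) has_real_derivative
          \<eta>' x * \<rho> x ^ k + \<eta> x * (real k * \<rho> x ^ (k - 1) * (2 * (dual x \<bullet> G x)))) (at x)"
        by (rule derivative_eq_intros refl \<eta> \<rho>_der[OF True x])+ (simp add: algebra_simps)
      then show ?thesis
        unfolding \<Phi>_def \<psi>_def by (rule has_vector_derivative_scaleR[OF _ dual_der[OF True x]])
    next
      case False
      then have out: "x \<notin> {p..r}" using pr by auto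
      have "((\<lambda>_. 0) has_vector_derivative 0) (at x)" by simp
      then have "(\<Phi> has_vector_derivative 0) (at x)"
        by (rule has_vector_derivative_transform_within_open[where S = "- {p..r}"]) (use out \<eta>_supp in \<open>auto simp: \<Phi>_def\<close>)
      moreover have "\<psi> x = 0" using out by (simp add: \<psi>_def \<eta>_supp \<eta>'_supp)
      ultimately show ?thesis by simp
    qed
    have \<Phi>_supp: "\<Phi> x = 0" if "x \<notin> {p..r}" for x using that by (simp add: \<Phi>_def \<eta>_supp)
    have \<Phi>_cont: "continuous_on UNIV \<Phi>"
      unfolding \<Phi>_def by (intro continuous_intros \<eta>_cont \<rho>_cont continuous_dual)
    have \<psi>_meas: "\<psi> \<in> borel_measurable borel" unfolding \<psi>_def by measurable
    \<comment> \<open>The summands come from \<open>\<eta>\<close>, from \<open>\<rho> ^ k\<close>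
      (where \<open>\<rho>\<close> has constant \<open>2 * B\<close> because \<open>dual\<close>
      stays in the unit ball) and from \<open>dual\<close>. Growth with \<open>k\<close> does no
      harm: the bound serves each \<open>k\<close> separately.\<close>
    have \<Phi>_lip: "norm (\<Phi> x - \<Phi> y) \<le> (E + real k * (2 * B) + B) * \<bar>x - y\<bar>" if xy: "x \<in> {c<..<d}" "y \<in> {c<..<d}" for x y
    proof -
      have \<rho>_lip: "\<bar>\<rho> x - \<rho> y\<bar> \<le> 2 * B * \<bar>x - y\<bar>"
      proof -
        have "\<rho> x - \<rho> y = (dual x - dual y) \<bullet> (dual x + dual y)"
          unfolding \<rho>_def by (simp add: inner_diff_left inner_add_right inner_commute[of "dual y" "dual x"])
        then have "\<bar>\<rho> x - \<rho> y\<bar> \<le> norm (dual x - dual y) * norm (dual x + dual y)"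
          using Cauchy_Schwarz_ineq2 by simp
        also have "\<dots> \<le> (B * \<bar>x - y\<bar>) * 2"
          using dual_lip[OF xy] norm_triangle_le[of "dual x" "dual y" 2] norm_dual_le_1[of x] norm_dual_le_1[of y] B0
          by (intro mult_mono) auto
        finally show ?thesis by simp
      qed
      have pow_lip: "\<bar>\<rho> x ^ k - \<rho> y ^ k\<bar> \<le> real k * \<bar>\<rho> x - \<rho> y\<bar>"
        using norm_power_diff[of "\<rho> x" "\<rho> y" k] \<rho>0 \<rho>1 by simp
      have pow01: "0 \<le> \<rho> z ^ k" "\<rho> z ^ k \<le> 1" for z using \<rho>0[of z] \<rho>1[of z] by (auto intro: power_le_one)
      have "\<Phi> x - \<Phi> y = ((\<eta> x - \<eta> y) * \<rho> x ^ k) *\<^sub>R dual x + (\<eta> y * (\<rho> x ^ k - \<rho> y ^ k)) *\<^sub>R dual x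
         + (\<eta> y * \<rho> y ^ k) *\<^sub>R (dual x - dual y)"
        unfolding \<Phi>_def by (simp add: algebra_simps)
      also have "norm \<dots> \<le> norm (((\<eta> x - \<eta> y) * \<rho> x ^ k) *\<^sub>R dual x) + norm ((\<eta> y * (\<rho> x ^ k - \<rho> y ^ k)) *\<^sub>R dual x)
         + norm ((\<eta> y * \<rho> y ^ k) *\<^sub>R (dual x - dual y))"
        by (intro order_trans[OF norm_triangle_ineq] add_mono norm_triangle_ineq order_refl)
      also have "\<dots> \<le> E * \<bar>x - y\<bar> + real k * (2 * B) * \<bar>x - y\<bar> + B * \<bar>x - y\<bar>"
      proof (intro add_mono)
        have "norm (((\<eta> x - \<eta> y) * \<rho> x ^ k) *\<^sub>R dual x) = \<bar>\<eta> x - \<eta> y\<bar> * (\<rho> x ^ k * norm (dual x))"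
          using pow01[of x] by (simp add: abs_mult)
        also have "\<dots> \<le> (E * \<bar>x - y\<bar>) * (1 * 1)"
          using \<eta>_lip[of x y] pow01[of x] norm_dual_le_1[of x] E0 by (intro mult_mono) auto
        finally show "norm (((\<eta> x - \<eta> y) * \<rho> x ^ k) *\<^sub>R dual x) \<le> E * \<bar>x - y\<bar>" by simp
        have "norm ((\<eta> y * (\<rho> x ^ k - \<rho> y ^ k)) *\<^sub>R dual x) = (\<eta> y * norm (dual x)) * \<bar>\<rho> x ^ k - \<rho> y ^ k\<bar>"
          using \<eta>0[of y] by (simp add: abs_mult)
        also have "\<dots> \<le> (1 * 1) * (real k * (2 * B * \<bar>x - y\<bar>))"
          using \<eta>0[of y] \<eta>1[of y] norm_dual_le_1[of x] order_trans[OF pow_lip mult_left_mono[OF \<rho>_lip, of "real k"]]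
          by (intro mult_mono) auto
        finally show "norm ((\<eta> y * (\<rho> x ^ k - \<rho> y ^ k)) *\<^sub>R dual x) \<le> real k * (2 * B) * \<bar>x - y\<bar>" by (simp add: mult.assoc)
        have "norm ((\<eta> y * \<rho> y ^ k) *\<^sub>R (dual x - dual y)) = (\<eta> y * \<rho> y ^ k) * norm (dual x - dual y)"
          using \<eta>0[of y] pow01[of y] by simp
        also have "\<dots> \<le> (1 * 1) * (B * \<bar>x - y\<bar>)"
          using \<eta>0[of y] \<eta>1[of y] pow01[of y] dual_lip[OF xy] by (intro mult_mono) auto
        finally show "norm ((\<eta> y * \<rho> y ^ k) *\<^sub>R (dual x - dual y)) \<le> B * \<bar>x - y\<bar>" by simp
      qed
      finally show ?thesis by (simp add: algebra_simps)
    qed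
    note tail = integral_tail_of_lipschitz_derivative[OF pr \<Phi>_supp \<Phi>_cont \<Phi>_lip countable_atoms \<Phi>_der \<psi>_meas]
    have \<psi>_int: "integrable lborel \<psi>" by (rule tail(1))
    have \<psi>_supp: "\<psi> x = 0" if "x \<notin> {p..r}" for x using that by (simp add: \<psi>_def \<eta>_supp \<eta>'_supp)
    \<comment> \<open>This removes the unknown constant \<open>C\<close> contained in
      \<open>G\<close>. The point \<open>p - 1\<close> lies to the left of the support.\<close>
    have \<psi>_0: "(\<integral>x. \<psi> x \<partial>lborel) = 0"
    proof -
      have "(\<integral>x. \<psi> x \<partial>lborel) = (\<integral>x. indicator {p - 1..} x *\<^sub>R \<psi> x \<partial>lborel)"
        by (rule Bochner_Integration.integral_cong) (auto simp: indicator_def \<psi>_supp)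
      also have "\<dots> = - \<Phi> (p - 1)" by (rule tail(2))
      also have "\<dots> = 0" by (simp add: \<Phi>_supp)
      finally show ?thesis .
    qed
    have G\<psi>_int: "integrable lborel (\<lambda>x. \<psi> x \<bullet> G x)"
      by (rule integrable_inner_bounded[OF \<psi>_int _ GB]) simp
    have cum_int: "integrable lborel (\<lambda>x. cumulative x \<bullet> \<psi> x)"
      using integrable_inner_bounded[OF \<psi>_int _ cumulative_bounded] by (simp add: inner_commute)
    have "lam * (\<integral>x. \<psi> x \<bullet> G x \<partial>lborel) = (\<integral>x. cumulative x \<bullet> \<psi> x + C \<bullet> \<psi> x \<partial>lborel)"
      unfolding integral_mult_right_zero[symmetric] G_def using lam
      by (intro Bochner_Integration.integral_cong) (auto simp: inner_commute inner_add_right inner_add_left)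
    also have "\<dots> = (\<integral>x. cumulative x \<bullet> \<psi> x \<partial>lborel) + C \<bullet> (\<integral>x. \<psi> x \<partial>lborel)"
      using \<psi>_int cum_int by (subst Bochner_Integration.integral_add) auto
    also have "\<dots> = (\<integral>x. \<tau> x \<bullet> \<Phi> x \<partial>M) - (\<integral>x. \<sigma>U x \<bullet> \<Phi> x \<partial>N)"
      using integral_cumulative[OF \<psi>_int tail(2)] by (simp add: \<psi>_0)
    finally have eq: "lam * (\<integral>x. \<psi> x \<bullet> G x \<partial>lborel) = (\<integral>x. \<tau> x \<bullet> \<Phi> x \<partial>M) - (\<integral>x. \<sigma>U x \<bullet> \<Phi> x \<partial>N)" .
    \<comment> \<open>Expanding \<open>\<psi> x \<bullet> G x\<close> produces
      \<open>G x \<bullet> G x\<close> and the square of \<open>dual x \<bullet> G x\<close> with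
      nonnegative factors. Only the term with \<open>\<eta>'\<close> lacks a sign and is
      kept.\<close>
    have low: "\<eta>' x * (\<rho> x ^ k * (dual x \<bullet> G x)) \<le> \<psi> x \<bullet> G x" for x
    proof -
      have "\<psi> x \<bullet> G x = \<eta>' x * (\<rho> x ^ k * (dual x \<bullet> G x)) + \<eta> x * \<rho> x ^ k * (G x \<bullet> G x)
         + 2 * \<eta> x * (real k * \<rho> x ^ (k - 1)) * (dual x \<bullet> G x)\<^sup>2"
        unfolding \<psi>_def by (simp add: inner_add_left power2_eq_square algebra_simps)
      moreover have "0 \<le> \<eta> x * \<rho> x ^ k * (G x \<bullet> G x)" using \<eta>0[of x] \<rho>0[of x] by simp
      moreover have "0 \<le> 2 * \<eta> x * (real k * \<rho> x ^ (k - 1)) * (dual x \<bullet> G x)\<^sup>2" using \<eta>0[of x] \<rho>0[of x] by simp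
      ultimately show ?thesis by linarith
    qed
    have low_int: "integrable lborel (\<lambda>x. \<eta>' x * (\<rho> x ^ k * (dual x \<bullet> G x)))"
    proof (rule Bochner_Integration.integrable_bound)
      show "integrable lborel (\<lambda>x. indicator {p..r} x *\<^sub>R (E * B))"
        by (intro integrable_scaleR_indicator_bounded) auto
      have "\<bar>\<eta>' x * (\<rho> x ^ k * (dual x \<bullet> G x))\<bar> \<le> E * (1 * (1 * B))" for x
        unfolding abs_mult
        using E[of x] E0 \<rho>0[of x] \<rho>1[of x] GB[of x] norm_dual_le_1[of x]
          order_trans[OF Cauchy_Schwarz_ineq2[of "dual x" "G x"] mult_mono[OF norm_dual_le_1[of x] GB[of x]]]
        by (intro mult_mono) (auto simp: power_le_one)
      then show "AE x in lborel. norm (\<eta>' x * (\<rho> x ^ k * (dual x \<bullet> G x))) \<le> norm (indicator {p..r} x *\<^sub>R (E * B))"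
        using \<eta>'_supp by (intro AE_I2) (auto simp: indicator_def intro: order_trans[OF _ abs_ge_self])
    qed measurable
    have "lam * (\<integral>x. \<eta>' x * (\<rho> x ^ k * (dual x \<bullet> G x)) \<partial>lborel) \<le> lam * (\<integral>x. \<psi> x \<bullet> G x \<partial>lborel)"
      using lam low low_int G\<psi>_int by (intro mult_left_mono integral_mono) auto
    also have "\<dots> = (\<integral>x. \<eta> x * (\<rho> x ^ k * (\<tau> x \<bullet> dual x)) \<partial>M) - (\<integral>x. \<eta> x * (\<rho> x ^ k * (\<sigma>U x \<bullet> dual x)) \<partial>N)"
      unfolding eq \<Phi>_def by (simp add: mult.assoc)
    finally show ?thesis .
  qed
  have \<rho>_lim: "(\<lambda>k. \<rho> x ^ k) \<longlonglongrightarrow> indicator contact x" for x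
  proof (cases "x \<in> contact")
    case True
    then show ?thesis by (simp add: contact_def \<rho>_def)
  next
    case False
    then have "\<rho> x < 1" using \<rho>1[of x] by (auto simp: contact_def \<rho>_def)
    then show ?thesis using False \<rho>0[of x] by (simp add: LIMSEQ_realpow_zero)
  qed
  have lim_g: "(\<lambda>k. \<integral>x. \<eta> x * (\<rho> x ^ k * (g x \<bullet> dual x)) \<partial>L) \<longlonglongrightarrow> (\<integral>x. \<eta> x * (indicator contact x * (g x \<bullet> dual x)) \<partial>L)"
    if L: "sets L = sets borel" and g: "integrable L g" for L and g :: "real \<Rightarrow> real^'n"
  proof (rule integral_dominated_convergence[where w = "\<lambda>x. norm (g x)"])
    note [measurable_cong] = L
    have [measurable]: "g \<in> borel_measurable L" using g by auto
    show "(\<lambda>x. \<eta> x * (indicator contact x * (g x \<bullet> dual x))) \<in> borel_measurable L" by measurable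
    show "(\<lambda>x. \<eta> x * (\<rho> x ^ k * (g x \<bullet> dual x))) \<in> borel_measurable L" for k by measurable
    show "AE x in L. (\<lambda>k. \<eta> x * (\<rho> x ^ k * (g x \<bullet> dual x))) \<longlonglongrightarrow> \<eta> x * (indicator contact x * (g x \<bullet> dual x))"
      by (intro AE_I2 tendsto_intros \<rho>_lim)
    have "\<bar>\<eta> x * (\<rho> x ^ k * (g x \<bullet> dual x))\<bar> \<le> 1 * (1 * (norm (g x) * 1))" for k x
      unfolding abs_mult
      using \<eta>0[of x] \<eta>1[of x] \<rho>0[of x] \<rho>1[of x]
        order_trans[OF Cauchy_Schwarz_ineq2[of "g x" "dual x"] mult_left_mono[OF norm_dual_le_1[of x], of "norm (g x)"]]
      by (intro mult_mono) (auto simp: power_le_one)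
    then show "AE x in L. norm (\<eta> x * (\<rho> x ^ k * (g x \<bullet> dual x))) \<le> norm (g x)" for k by simp
  qed (use g in auto)
  \<comment> \<open>The kept term dies in the limit: on the contact set inside
    \<open>{c<..<d}\<close> the product \<open>dual x \<bullet> G x\<close> is zero off
    \<open>atoms\<close>, off the contact set \<open>\<rho> x ^ k\<close> tends to 0, and
    \<open>\<eta>'\<close> vanishes outside \<open>{p..r}\<close>.\<close>
  have "(\<lambda>k. lam * (\<integral>x. \<eta>' x * (\<rho> x ^ k * (dual x \<bullet> G x)) \<partial>lborel)) \<longlonglongrightarrow> lam * (\<integral>x. 0 \<partial>(lborel :: real measure))"
  proof (intro tendsto_mult tendsto_const,
      rule integral_dominated_convergence[where w = "\<lambda>x. indicator {p..r} x *\<^sub>R (E * B)"])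
    show "integrable lborel (\<lambda>x. indicator {p..r} x *\<^sub>R (E * B))"
      by (intro integrable_scaleR_indicator_bounded) auto
    have "AE x in lborel. x \<notin> atoms"
      by (rule AE_not_in[OF countable_imp_null_set_lborel[OF countable_atoms]])
    then show "AE x in lborel. (\<lambda>k. \<eta>' x * (\<rho> x ^ k * (dual x \<bullet> G x))) \<longlonglongrightarrow> 0"
    proof eventually_elim
      case (elim x)
      have "(\<lambda>k. \<eta>' x * (\<rho> x ^ k * (dual x \<bullet> G x))) \<longlonglongrightarrow> \<eta>' x * (indicator contact x * (dual x \<bullet> G x))"
        by (intro tendsto_intros \<rho>_lim)
      moreover have "\<eta>' x * (indicator contact x * (dual x \<bullet> G x)) = 0"
      proof (cases "x \<in> {c<..<d}")
        case True
        then show ?thesis using contact_0[OF True elim] by (cases "x \<in> contact") auto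
      next
        case False
        then have "x \<notin> {p..r}" using pr by auto
        then show ?thesis by (simp add: \<eta>'_supp)
      qed
      ultimately show ?case by simp
    qed
    have "\<bar>\<eta>' x * (\<rho> x ^ k * (dual x \<bullet> G x))\<bar> \<le> E * (1 * (1 * B))" for k x
      unfolding abs_mult
      using E[of x] E0 \<rho>0[of x] \<rho>1[of x] GB[of x] norm_dual_le_1[of x]
        order_trans[OF Cauchy_Schwarz_ineq2[of "dual x" "G x"] mult_mono[OF norm_dual_le_1[of x] GB[of x]]]
      by (intro mult_mono) (auto simp: power_le_one)
    then show "AE x in lborel. norm (\<eta>' x * (\<rho> x ^ k * (dual x \<bullet> G x))) \<le> indicator {p..r} x *\<^sub>R (E * B)" for k
      using \<eta>'_supp by (intro AE_I2) (auto simp: indicator_def)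
  qed measurable
  then have "lam * (\<integral>x. 0 \<partial>(lborel :: real measure)) \<le> (\<integral>x. \<eta> x * (indicator contact x * (\<tau> x \<bullet> dual x)) \<partial>M)
      - (\<integral>x. \<eta> x * (indicator contact x * (\<sigma>U x \<bullet> dual x)) \<partial>N)"
    by (rule LIMSEQ_le[OF _ tendsto_diff[OF lim_g[OF M t] lim_g[OF N sU]]]) (use ineq in blast)
  then show ?thesis by simp
qed

text \<open>Cutoffs that tend to \<open>indicator {p<..q}\<close> eliminate \<open>\<eta>\<close>,
  and a comparison on half-open intervals carries over to Borel sets.\<close>

lemma contact_inequality:
  assumes "B \<in> sets borel"
  shows "(\<integral>x. indicator B x *\<^sub>R (indicator contact x * (\<sigma>U x \<bullet> dual x)) \<partial>N)
    \<le> (\<integral>x. indicator B x *\<^sub>R (indicator contact x * (\<tau> x \<bullet> dual x)) \<partial>M)"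
proof -
  have int: "integrable L (\<lambda>x. indicator contact x * (g x \<bullet> dual x))"
    if "sets L = sets borel" "integrable L g" for L and g :: "real \<Rightarrow> real^'n"
  proof -
    note [measurable_cong] = that(1)
    have "integrable L (\<lambda>x. g x \<bullet> dual x)"
      by (rule integrable_inner_bounded[OF that(2) _ norm_dual_le_1]) simp
    from integrable_mult_indicator[OF _ this, of contact] show ?thesis using that(1) by simp
  qed
  show ?thesis
  proof (rule integral_le_on_borel_if_le_on_intervals[OF N_fin N int[OF N sU] M_fin M int[OF M t], of c d])
    show "indicator contact x * (\<sigma>U x \<bullet> dual x) = 0" if "x \<notin> {c<..<d}" for x using that by (simp add: \<sigma>U_def)
    show "indicator contact x * (\<tau> x \<bullet> dual x) = 0" if "x \<notin> {c<..<d}" for x using t0[OF that] by simp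
    fix p q assume pq: "c < p" "p < q" "q < d"
    obtain \<eta> \<eta>' :: "nat \<Rightarrow> real \<Rightarrow> real" and r :: real
      where r: "r < d" and \<eta>: "\<And>n x. (\<eta> n has_real_derivative \<eta>' n x) (at x)"
      and \<eta>'_cont: "\<And>n. continuous_on UNIV (\<eta>' n)"
      and \<eta>0: "\<And>n x. 0 \<le> \<eta> n x" and \<eta>1: "\<And>n x. \<eta> n x \<le> 1" and \<eta>_supp: "\<And>n x. x \<notin> {p..r} \<Longrightarrow> \<eta> n x = 0"
      and \<eta>_lim: "\<And>x. (\<lambda>n. \<eta> n x) \<longlonglongrightarrow> indicator {p<..q} x"
      using C1_cutoff[OF pq(2,3)] by metis
    have \<eta>_cont: "continuous_on UNIV (\<eta> n)" for n
      unfolding continuous_on_eq_continuous_at[OF open_UNIV] using DERIV_isCont[OF \<eta>] by blast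
    then have [measurable]: "\<eta> n \<in> borel_measurable borel" for n by (rule borel_measurable_continuous_onI)
    have lim: "(\<lambda>n. \<integral>x. \<eta> n x * (indicator contact x * (g x \<bullet> dual x)) \<partial>L)
        \<longlonglongrightarrow> (\<integral>x. indicator {p<..q} x *\<^sub>R (indicator contact x * (g x \<bullet> dual x)) \<partial>L)"
      if L: "sets L = sets borel" and g: "integrable L g" for L and g :: "real \<Rightarrow> real^'n"
    proof (rule integral_dominated_convergence[where w = "\<lambda>x. norm (indicator contact x * (g x \<bullet> dual x))"])
      note [measurable_cong] = L
      have [measurable]: "g \<in> borel_measurable L" using g by auto
      show "(\<lambda>x. indicator {p<..q} x *\<^sub>R (indicator contact x * (g x \<bullet> dual x))) \<in> borel_measurable L" by measurable
      show "(\<lambda>x. \<eta> n x * (indicator contact x * (g x \<bullet> dual x))) \<in> borel_measurable L" for n by measurable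
      show "AE x in L. (\<lambda>n. \<eta> n x * (indicator contact x * (g x \<bullet> dual x)))
          \<longlonglongrightarrow> indicator {p<..q} x *\<^sub>R (indicator contact x * (g x \<bullet> dual x))"
        unfolding real_scaleR_def by (intro AE_I2 tendsto_intros \<eta>_lim)
      show "integrable L (\<lambda>x. norm (indicator contact x * (g x \<bullet> dual x)))"
        using int[OF L g] by (rule integrable_norm)
      show "AE x in L. norm (\<eta> n x * (indicator contact x * (g x \<bullet> dual x))) \<le> norm (indicator contact x * (g x \<bullet> dual x))" for n
        using \<eta>0 \<eta>1 by (intro AE_I2) (simp add: abs_mult mult_left_le_one_le)
    qed
    show "(\<integral>x. indicator {p<..q} x *\<^sub>R (indicator contact x * (\<sigma>U x \<bullet> dual x)) \<partial>N)
        \<le> (\<integral>x. indicator {p<..q} x *\<^sub>R (indicator contact x * (\<tau> x \<bullet> dual x)) \<partial>M)"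
      by (rule LIMSEQ_le[OF lim[OF N sU] lim[OF M t]])
         (use contact_inequality_cutoff[OF pq(1) r \<eta> \<eta>'_cont \<eta>0 \<eta>1 \<eta>_supp] in blast)
  qed (rule assms)
qed

text \<open>Scalar integrals serve as the bridge: the variation of \<open>\<mu>u\<close> is bounded
  by the integral of \<open>\<sigma> x \<bullet> dual x\<close>, \<open>contact_inequality\<close>
  moves such integrals from \<open>N\<close> to \<open>M\<close>, and
  \<open>integral_le_var_measure\<close> turns the result back into a variation.\<close>

lemma var_measure_le:
  assumes \<mu>u: "\<And>A. A \<in> sets borel \<Longrightarrow> A \<subseteq> {a<..<b} \<Longrightarrow> \<mu>u A = (\<integral>x. indicator A x *\<^sub>R \<sigma> x \<partial>N)"
    and \<mu>f: "\<And>A. A \<in> sets borel \<Longrightarrow> A \<subseteq> {c<..<d} \<Longrightarrow> \<mu>f A = (\<integral>x. indicator A x *\<^sub>R \<tau> x \<partial>M)"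
    and A: "A \<in> sets borel" "A \<subseteq> {c<..<d}"
  shows "var_measure \<mu>u A \<le> var_measure \<mu>f A"
proof -
  note [measurable_cong] = N M
  have [measurable]: "\<sigma> \<in> borel_measurable N" "\<tau> \<in> borel_measurable M" using s t by auto
  have ae: "AE x in N. norm (\<sigma> x) \<le> \<sigma> x \<bullet> dual x"
    by (rule density_le_inner_dual[OF N_fin N s s0 u_deriv])
  have sd: "integrable N (\<lambda>x. \<sigma> x \<bullet> dual x)"
    by (rule integrable_inner_bounded[OF s _ norm_dual_le_1]) simp
  \<comment> \<open>Where \<open>norm (dual x) < 1\<close>, Cauchy-Schwarz is strict for nonzero
    \<open>\<sigma> x\<close> and contradicts \<open>ae\<close>.\<close>
  have ae_contact: "AE x in N. x \<notin> contact \<longrightarrow> \<sigma> x = 0"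
    using ae
  proof eventually_elim
    case (elim x)
    show ?case
    proof (intro impI, rule ccontr)
      assume x: "x \<notin> contact" "\<sigma> x \<noteq> 0"
      then have "norm (dual x) \<noteq> 1" by (auto simp: contact_def power2_norm_eq_inner[symmetric])
      then have "norm (dual x) < 1" using norm_dual_le_1[of x] by simp
      then have "norm (\<sigma> x) * norm (dual x) < norm (\<sigma> x) * 1" using x by (intro mult_strict_left_mono) auto
      then show False using elim norm_cauchy_schwarz[of "\<sigma> x" "dual x"] by simp
    qed
  qed
  \<comment> \<open>The bound on each piece is the integral of one scalar density, so every
    partition of \<open>A\<close> gives the same total.\<close>
  have "var_measure \<mu>u A \<le> ennreal (\<integral>x. indicator A x *\<^sub>R (\<sigma> x \<bullet> dual x) \<partial>N)"
    unfolding var_measure_def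
  proof (rule SUP_least)
    fix B :: "nat \<Rightarrow> real set" assume "B \<in> {B. disjoint_family B \<and> range B \<subseteq> sets borel \<and> (\<Union>k. B k) = A}"
    then have B: "disjoint_family B" "\<And>k. B k \<in> sets borel" "(\<Union>k. B k) = A" by auto
    let ?i = "\<lambda>k. \<integral>x. indicator (B k) x *\<^sub>R (\<sigma> x \<bullet> dual x) \<partial>N"
    have sums: "?i sums (\<integral>x. indicator A x *\<^sub>R (\<sigma> x \<bullet> dual x) \<partial>N)"
      using integral_indicator_disjoint_sums[OF sd, of B] B N by simp
    have le: "norm (\<mu>u (B k)) \<le> ?i k" for k
    proof -
      have "B k \<subseteq> {a<..<b}" using B(3) A(2) sub by blast
      then have "norm (\<mu>u (B k)) = norm (\<integral>x. indicator (B k) x *\<^sub>R \<sigma> x \<partial>N)" using \<mu>u[OF B(2)] by simp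
      also have "\<dots> \<le> ?i k"
      proof (rule order_trans[OF integral_norm_bound integral_mono_AE])
        show "integrable N (\<lambda>x. norm (indicator (B k) x *\<^sub>R \<sigma> x))" "integrable N (\<lambda>x. indicator (B k) x *\<^sub>R (\<sigma> x \<bullet> dual x))"
          using s sd B(2) N by (auto intro!: integrable_norm integrable_mult_indicator simp del: real_scaleR_def norm_scaleR)
        show "AE x in N. norm (indicator (B k) x *\<^sub>R \<sigma> x) \<le> indicator (B k) x *\<^sub>R (\<sigma> x \<bullet> dual x)"
          using ae by eventually_elim (auto simp: indicator_def)
      qed
      finally show ?thesis .
    qed
    have i0: "0 \<le> ?i k" for k using order_trans[OF norm_ge_zero le] .
    have "(\<Sum>k. ennreal (norm (\<mu>u (B k)))) \<le> (\<Sum>k. ennreal (?i k))"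
      by (intro suminf_le summableI ennreal_leI le)
    also have "\<dots> = ennreal (\<integral>x. indicator A x *\<^sub>R (\<sigma> x \<bullet> dual x) \<partial>N)"
      using suminf_ennreal_eq[OF i0 sums] .
    finally show "(\<Sum>k. ennreal (norm (\<mu>u (B k)))) \<le> ennreal (\<integral>x. indicator A x *\<^sub>R (\<sigma> x \<bullet> dual x) \<partial>N)" .
  qed
  \<comment> \<open>On the side of \<open>u\<close> the restriction to the contact set is free by
    \<open>ae_contact\<close>. It has to happen before the passage to \<open>f\<close>, since the
    inequality between the two derivatives is known only there.\<close>
  also have "(\<integral>x. indicator A x *\<^sub>R (\<sigma> x \<bullet> dual x) \<partial>N) = (\<integral>x. indicator A x *\<^sub>R (indicator contact x * (\<sigma>U x \<bullet> dual x)) \<partial>N)"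
  proof (rule integral_cong_AE)
    show "AE x in N. indicator A x *\<^sub>R (\<sigma> x \<bullet> dual x) = indicator A x *\<^sub>R (indicator contact x * (\<sigma>U x \<bullet> dual x))"
      using ae_contact
    proof eventually_elim
      case (elim x)
      show ?case using elim A(2) by (cases "x \<in> A"; cases "x \<in> contact") (auto simp: \<sigma>U_def)
    qed
  qed (use A in \<open>simp_all add: \<sigma>U_def\<close>)
  also have "ennreal \<dots> \<le> ennreal (\<integral>x. indicator A x *\<^sub>R (indicator contact x * (\<tau> x \<bullet> dual x)) \<partial>M)"
    by (rule ennreal_leI[OF contact_inequality[OF A(1)]])
  also have "(\<integral>x. indicator A x *\<^sub>R (indicator contact x * (\<tau> x \<bullet> dual x)) \<partial>M)
      = (\<integral>x. indicator (A \<inter> contact) x *\<^sub>R (\<tau> x \<bullet> dual x) \<partial>M)"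
    by (rule Bochner_Integration.integral_cong) (auto simp: indicator_def)
  \<comment> \<open>Here \<open>dual\<close> is the direction field on
    \<open>A \<inter> contact\<close>; the rest of \<open>A\<close> can only enlarge the variation
    of \<open>\<mu>f\<close>.\<close>
  also have "ennreal \<dots> \<le> var_measure \<mu>f A"
  proof (rule integral_le_var_measure[OF M t _ A(1)])
    show "\<mu>f C = (\<integral>x. indicator C x *\<^sub>R \<tau> x \<partial>M)" if "C \<in> sets borel" "C \<subseteq> A" for C
      using that A(2) by (intro \<mu>f) auto
  qed (use A norm_dual_le_1 in auto)
  finally show ?thesis .
qed

end

theorem mainTheorem1:
  fixes a b c d lam :: real and f u :: "real \<Rightarrow> real^'n"
  assumes "a < b" and "lam > 0"
    and "L2 {a<..<b} f"
    and "L2 {a<..<b} u"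
    and "\<forall>w. L2 {a<..<b} w \<longrightarrow> energy {a<..<b} lam f u \<le> energy {a<..<b} lam f w"
    and "c < d" and "{c<..<d} \<subseteq> {a<..<b}"
    and "set_integrable lborel {c<..<d} f" and "TV {c<..<d} f < \<infinity>"
  shows "\<forall>\<mu>u \<mu>f. is_deriv_measure {a<..<b} u \<mu>u \<longrightarrow> is_deriv_measure {c<..<d} f \<mu>f \<longrightarrow>
           (\<forall>A \<in> sets borel. A \<subseteq> {c<..<d} \<longrightarrow> var_measure \<mu>u A \<le> var_measure \<mu>f A)"
proof (intro allI impI ballI)
  fix \<mu>u \<mu>f :: "real set \<Rightarrow> real^'n" and A :: "real set"
  assume \<mu>u: "is_deriv_measure {a<..<b} u \<mu>u" and \<mu>f: "is_deriv_measure {c<..<d} f \<mu>f"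
    and A: "A \<in> sets borel" "A \<subseteq> {c<..<d}"
  show "var_measure \<mu>u A \<le> var_measure \<mu>f A"
    using \<mu>u
  proof (rule is_deriv_measureE)
    fix N :: "real measure" and \<sigma> :: "real \<Rightarrow> real^'n"
    assume N: "finite_measure N" "sets N = sets borel" "integrable N \<sigma>" "\<And>x. x \<notin> {a<..<b} \<Longrightarrow> \<sigma> x = 0"
      and u: "\<And>A. A \<in> sets borel \<Longrightarrow> A \<subseteq> {a<..<b} \<Longrightarrow> \<mu>u A = (\<integral>x. indicator A x *\<^sub>R \<sigma> x \<partial>N)"
      and u': "\<And>\<phi>. C1c {a<..<b} \<phi> \<Longrightarrow>
        (LINT x:{a<..<b}|lborel. u x \<bullet> vector_derivative \<phi> (at x)) = - (\<integral>x. \<sigma> x \<bullet> \<phi> x \<partial>N)"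
    show ?thesis
      using \<mu>f
    proof (rule is_deriv_measureE)
      fix M :: "real measure" and \<tau> :: "real \<Rightarrow> real^'n"
      assume M: "finite_measure M" "sets M = sets borel" "integrable M \<tau>" "\<And>x. x \<notin> {c<..<d} \<Longrightarrow> \<tau> x = 0"
        and f: "\<And>A. A \<in> sets borel \<Longrightarrow> A \<subseteq> {c<..<d} \<Longrightarrow> \<mu>f A = (\<integral>x. indicator A x *\<^sub>R \<tau> x \<partial>M)"
        and f': "\<And>\<phi>. C1c {c<..<d} \<phi> \<Longrightarrow>
          (LINT x:{c<..<d}|lborel. f x \<bullet> vector_derivative \<phi> (at x)) = - (\<integral>x. \<tau> x \<bullet> \<phi> x \<partial>M)"
      interpret rof_minimizer_BV_data a b lam f u c d N M \<sigma> \<tau>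
        by (intro rof_minimizer_BV_data.intro rof_minimizer.intro rof_minimizer_BV_data_axioms.intro)
           (rule assms(2-4,6,7) assms(5)[rule_format] N M u' f' | assumption)+
      show ?thesis by (rule var_measure_le[OF u f A])
    qed
  qed
qed

end
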